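(* Let $m\ge 2$ be an integer, let $G$ be a finite simple graph on the vertex set $[n]$, and let $\Psi:\mathcal{K}\times\mathcal{G}\to\mathbb{N}_0$ be a $d$-compatible map. Then $$\mathrm{depth}(S/\mathcal{J}_{K_m,G})\ \geq\ \Psi(K_m,G).$$ Moreover, the map $\Psi:\mathcal{K}\times\mathcal{G}\to\mathbb{N}_0$ defined by $\Psi(K_m,G)=(m-2)t+f(G)+d(G)$, where $t$ denotes the number of connected components of $G$, is $d$-compatible. Hence, for every $m\ge 2$ and every finite simple graph $G$ on $[n]$ with $t$ connected components, $$\mathrm{depth}(S/\mathcal{J}_{K_m,G})\ \geq\ (m-2)t+f(G)+d(G).$$
   Context: Generalized binomial edge ideals. Let $K$ be a field, $m\ge 2$, $n\ge 1$ integers, $[n]=\{1,\dots,n\}$, and $S=K[x_{ij}: i\in[m],\, j\in[n]]$. For a finite simple graph $G$ on $[n]$ with edge set $E(G)$, the generalized binomial edge ideal of $G$ is $$\mathcal{J}_{K_m,G}=\big(x_{ik}x_{jl}-x_{il}x_{jk} : 1\le i<j\le m,\ \{k,l\}\in E(G),\ k<l\big)\subseteq S$$ (here $K_m$ is the complete graph on $m$ vertices). Depth is the depth of the graded $S$-module with respect to the homogeneous maximal ideal $\mathfrak m$ of $S$, i.e. $\mathrm{depth}(M)=\min\{i : H^i_{\mathfrak m}(M)\ne 0\}$. Graph notation. All graphs are finite and simple. $\mathcal{N}_G(v)$ is the set of vertices adjacent to $v$. A vertex $v$ is free if the induced subgraph of $G$ on $\mathcal{N}_G(v)$ is complete (in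 particular an isolated vertex is free), and non-free otherwise. $G-v$ is the induced subgraph of $G$ on $V(G)\setminus\{v\}$. $G_v$ is the graph with vertex set $V(G)$ and edge set $E(G)\cup\{\{u,w\}: u,w\in\mathcal{N}_G(v),\ u\neq w\}$; $G_v-v$ means $(G_v)-v$. $f(G)$ is the number of free vertices of $G$. If $G$ has connected components $G_1,\dots,G_t$, then $d(G)=i(G)+\sum_{j=1}^t\mathrm{diam}(G_j)$, where $i(G)$ is the number of isolated vertices of $G$ and $\mathrm{diam}(G_j)$ is the maximum of the distances $d_{G_j}(u,v)$ (length of a shortest path, $d_{G_j}(u,u)=0$) over vertices $u,v$ of $G_j$. $d$-compatible maps. $\mathcal{G}$ is the set of all finite simple graphs (on arbitrary non-empty finite sets of positive integers), $\mathcal{K}$ is the set of complete graphs $K_m$, $m\ge 2$, and $\mathbb{N}_0$ is the set of non-negative integers. A map $\Psi:\mathcal{K}\times\mathcal{G}\to\mathbb{N}_0$ is $d$-compatible if for all $K_m\in\mathcal{K}$ and $G\in\mathcal{G}$: (1) if $G=\bigsqcup_{i=1}^{t}K_{n_i}$ is a disjoint union of complete graphs (with $n_i\ge1$), then $\Psi(K_m,G)\le t(m-1)+\sum_{i=1}^t n_i$; (2) if $G$ is not a disjoint union of complete graphs, then there exists a non-free vertex $v\in V(G)$ such that (a) $\Psi(K_m,G-v)\ge\Psi(K_m,G)$, (b) $\Psi(K_m,G_v)\ge\Psi(K_m,G)$, and (c) $\Psi(K_m,G_v-v)\ge\Psi(K_m,G)-1$. *)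

theory Defs
  imports
    "HOL-Algebra.Module"
    "HOL-Algebra.Ideal"
    "HOL-Library.Poly_Mapping"
    "HOL-Library.FuncSet"
    "HOL-Library.Disjoint_Sets"
    "HOL-Library.Extended_Nat"
begin

section \<open>Finite simple graphs\<close>

record ugraph =
  verts :: "nat set"
  edges :: "nat set set"

definition all_pairs :: "nat set \<Rightarrow> nat set set" where
  "all_pairs A = {{u, w} | u w. u \<in> A \<and> w \<in> A \<and> u \<noteq> w}"

text \<open>The class of all finite simple graphs on non-empty finite sets of positive integers.\<close>

definition graphs :: "ugraph set" where
  "graphs = {G. finite (verts G) \<and> verts G \<noteq> {} \<and> 0 \<notin> verts G \<and> edges G \<subseteq> all_pairs (verts G)}"

definition complete_graph :: "nat \<Rightarrow> ugraph" where
  "complete_graph m = \<lparr>verts = {1..m}, edges = all_pairs {1..m}\<rparr>"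

definition neighbours :: "ugraph \<Rightarrow> nat \<Rightarrow> nat set" where
  "neighbours G v = {u \<in> verts G. {u, v} \<in> edges G}"

definition induced :: "ugraph \<Rightarrow> nat set \<Rightarrow> ugraph" where
  "induced G W = \<lparr>verts = verts G \<inter> W, edges = {e \<in> edges G. e \<subseteq> W}\<rparr>"

definition is_complete :: "ugraph \<Rightarrow> bool" where
  "is_complete G \<longleftrightarrow> edges G = all_pairs (verts G)"

definition free_vertex :: "ugraph \<Rightarrow> nat \<Rightarrow> bool" where
  "free_vertex G v \<longleftrightarrow> v \<in> verts G \<and> is_complete (induced G (neighbours G v))"

text \<open>The graphs \<open>G - v\<close> and \<open>G\<^sub>v\<close>.\<close>

definition delete_vertex :: "ugraph \<Rightarrow> nat \<Rightarrow> ugraph" where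
  "delete_vertex G v = induced G (verts G - {v})"

definition complete_at :: "ugraph \<Rightarrow> nat \<Rightarrow> ugraph" where
  "complete_at G v = G\<lparr>edges := edges G \<union> all_pairs (neighbours G v)\<rparr>"

definition is_path :: "ugraph \<Rightarrow> nat \<Rightarrow> nat list \<Rightarrow> nat \<Rightarrow> bool" where
  "is_path G u p w \<longleftrightarrow> p \<noteq> [] \<and> hd p = u \<and> last p = w \<and> set p \<subseteq> verts G \<and> distinct p \<and>
     successively (\<lambda>a b. {a, b} \<in> edges G) p"

definition graph_components :: "ugraph \<Rightarrow> ugraph set" where
  "graph_components G = (\<lambda>u. induced G {w. \<exists>p. is_path G u p w}) ` verts G"

text \<open>Distance and diameter are only used for connected graphs.\<close>

definition graph_dist :: "ugraph \<Rightarrow> nat \<Rightarrow> nat \<Rightarrow> nat" where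
  "graph_dist G u w = (LEAST k. \<exists>p. is_path G u p w \<and> length p = k + 1)"

definition diam :: "ugraph \<Rightarrow> nat" where
  "diam G = Max {graph_dist G u w | u w. u \<in> verts G \<and> w \<in> verts G}"

definition num_components :: "ugraph \<Rightarrow> nat" where
  "num_components G = card (graph_components G)"

definition num_free :: "ugraph \<Rightarrow> nat" where
  "num_free G = card {v. free_vertex G v}"

definition num_isolated :: "ugraph \<Rightarrow> nat" where
  "num_isolated G = card {v \<in> verts G. neighbours G v = {}}"

definition d_inv :: "ugraph \<Rightarrow> nat" where
  "d_inv G = num_isolated G + (\<Sum>H\<in>graph_components G. diam H)"

text \<open>\<open>G\<close> is the disjoint union of the complete graphs on the blocks of \<open>P\<close>.\<close>

definition disjoint_union_of_complete :: "ugraph \<Rightarrow> nat set set \<Rightarrow> bool" where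
  "disjoint_union_of_complete G P \<longleftrightarrow>
     partition_on (verts G) P \<and> edges G = (\<Union>B\<in>P. all_pairs B)"

text \<open>
  Only the values of \<open>\<Psi>\<close> at \<open>(K\<^sub>m, G)\<close> with \<open>m \<ge> 2\<close> and \<open>G \<in> graphs\<close> are constrained.
  Condition (c) is stated with \<open>+ 1\<close> on the left-hand side instead of a subtraction.
\<close>

definition d_compatible :: "(ugraph \<Rightarrow> ugraph \<Rightarrow> nat) \<Rightarrow> bool" where
  "d_compatible \<Psi> \<longleftrightarrow> (\<forall>m\<ge>2. \<forall>G\<in>graphs. let K = complete_graph m in
     (\<forall>P. disjoint_union_of_complete G P \<longrightarrow>
        \<Psi> K G \<le> card P * (m - 1) + (\<Sum>B\<in>P. card B)) \<and>
     ((\<nexists>P. disjoint_union_of_complete G P) \<longrightarrow>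
        (\<exists>v\<in>verts G. \<not> free_vertex G v \<and>
           \<Psi> K (delete_vertex G v) \<ge> \<Psi> K G \<and>
           \<Psi> K (complete_at G v) \<ge> \<Psi> K G \<and>
           \<Psi> K (delete_vertex (complete_at G v) v) + 1 \<ge> \<Psi> K G)))"


section \<open>Modules\<close>

definition regular_module :: "('a, 'r) ring_scheme \<Rightarrow> ('a, 'a) module" where
  "regular_module R = \<lparr>carrier = carrier R, mult = mult R, one = one R, zero = zero R,
     add = add R, smult = mult R\<rparr>"

text \<open>The multiplicative fields of the ring part of a module record are irrelevant here.\<close>

definition quot_module :: "('a, 'b, 'e) module_scheme \<Rightarrow> 'b set \<Rightarrow> ('a, 'b set) module" where
  "quot_module M N = \<lparr>carrier = a_rcosets\<^bsub>M\<^esub> N, mult = undefined, one = undefined,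
     zero = N, add = (<+>\<^bsub>M\<^esub>), smult = (\<lambda>r X. \<Union>x\<in>X. N +>\<^bsub>M\<^esub> (r \<odot>\<^bsub>M\<^esub> x))\<rparr>"

text \<open>
  The localisation \<open>M\<^sub>f\<close>: the class \<open>loc_frac R M f a k\<close> represents \<open>a / f\<^sup>k\<close>, and
  \<open>a / f\<^sup>k = b / f\<^sup>l\<close> iff \<open>f\<^bsup>p + l\<^esup> a = f\<^bsup>p + k\<^esup> b\<close> for some \<open>p\<close>.
\<close>

definition loc_frac :: "('a, 'r) ring_scheme \<Rightarrow> ('a, 'b, 'e) module_scheme \<Rightarrow> 'a \<Rightarrow> 'b \<Rightarrow> nat \<Rightarrow> ('b \<times> nat) set" where
  "loc_frac R M f a k = {(b, l). b \<in> carrier M \<and>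
     (\<exists>p::nat. (f [^]\<^bsub>R\<^esub> (p + l)) \<odot>\<^bsub>M\<^esub> a = (f [^]\<^bsub>R\<^esub> (p + k)) \<odot>\<^bsub>M\<^esub> b)}"

definition localization :: "('a, 'r) ring_scheme \<Rightarrow> ('a, 'b, 'e) module_scheme \<Rightarrow> 'a \<Rightarrow> ('a, ('b \<times> nat) set) module" where
  "localization R M f = \<lparr>carrier = {loc_frac R M f a k | a k. a \<in> carrier M},
     mult = undefined, one = undefined, zero = loc_frac R M f \<zero>\<^bsub>M\<^esub> 0,
     add = (\<lambda>X Y. \<Union>(a, k)\<in>X. \<Union>(b, l)\<in>Y.
       loc_frac R M f ((f [^]\<^bsub>R\<^esub> l) \<odot>\<^bsub>M\<^esub> a \<oplus>\<^bsub>M\<^esub> (f [^]\<^bsub>R\<^esub> k) \<odot>\<^bsub>M\<^esub> b) (k + l)),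
     smult = (\<lambda>r X. \<Union>(a, k)\<in>X. loc_frac R M f (r \<odot>\<^bsub>M\<^esub> a) k)\<rparr>"

text \<open>The canonical map \<open>M\<^sub>f \<rightarrow> M\<^sub>f\<^sub>g\<close>, \<open>a / f\<^sup>k \<mapsto> g\<^sup>k a / (f g)\<^sup>k\<close>.\<close>

definition localization_map ::
  "('a, 'r) ring_scheme \<Rightarrow> ('a, 'b, 'e) module_scheme \<Rightarrow> 'a \<Rightarrow> 'a \<Rightarrow> ('b \<times> nat) set \<Rightarrow> ('b \<times> nat) set" where
  "localization_map R M f g X =
     (\<Union>(a, k)\<in>X. loc_frac R M (f \<otimes>\<^bsub>R\<^esub> g) ((g [^]\<^bsub>R\<^esub> k) \<odot>\<^bsub>M\<^esub> a) k)"


section \<open>Local cohomology and depth\<close>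

text \<open>
  For a list \<open>xs = [x\<^sub>0, \<dots>, x\<^bsub>r-1\<^esub>]\<close> of ring elements generating an ideal \<open>I\<close>, the local cohomology
  modules \<open>H\<^sup>p\<^sub>I(M)\<close> are the cohomology modules of the (extended) Cech complex whose term in degree
  \<open>p\<close> is the direct sum of the localisations of \<open>M\<close> at \<open>\<Prod>\<^bsub>i \<in> A\<^esub> x\<^sub>i\<close>, where \<open>A\<close> ranges over the
  \<open>p\<close>-element subsets of \<open>{0, \<dots>, r - 1}\<close>.
\<close>

definition subset_prod :: "('a, 'r) ring_scheme \<Rightarrow> 'a list \<Rightarrow> nat set \<Rightarrow> 'a" where
  "subset_prod R xs A = (\<Otimes>\<^bsub>R\<^esub>i\<in>A. xs ! i)"

definition index_sets :: "'a list \<Rightarrow> nat \<Rightarrow> nat set set" where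
  "index_sets xs p = {A. A \<subseteq> {..<length xs} \<and> card A = p}"

definition cech_module ::
  "('a, 'r) ring_scheme \<Rightarrow> 'a list \<Rightarrow> ('a, 'b, 'e) module_scheme \<Rightarrow> nat \<Rightarrow> ('a, nat set \<Rightarrow> ('b \<times> nat) set) module" where
  "cech_module R xs M p = (let L = (\<lambda>A. localization R M (subset_prod R xs A)) in
     \<lparr>carrier = (\<Pi>\<^sub>E A\<in>index_sets xs p. carrier (L A)), mult = undefined, one = undefined,
      zero = (\<lambda>A\<in>index_sets xs p. \<zero>\<^bsub>L A\<^esub>),
      add = (\<lambda>c d. \<lambda>A\<in>index_sets xs p. c A \<oplus>\<^bsub>L A\<^esub> d A),
      smult = (\<lambda>r c. \<lambda>A\<in>index_sets xs p. r \<odot>\<^bsub>L A\<^esub> c A)\<rparr>)"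

text \<open>
  \<open>(d c)\<^sub>A = \<Sum>\<^bsub>i \<in> A\<^esub> (-1)\<^sup>s c\<^bsub>A - {i}\<^esub> |\<^sub>A\<close>, where \<open>s\<close> is the position of \<open>i\<close> in \<open>A\<close>, counted from 0.
\<close>

definition cech_diff ::
  "('a, 'r) ring_scheme \<Rightarrow> 'a list \<Rightarrow> ('a, 'b, 'e) module_scheme \<Rightarrow> nat \<Rightarrow>
     (nat set \<Rightarrow> ('b \<times> nat) set) \<Rightarrow> nat set \<Rightarrow> ('b \<times> nat) set" where
  "cech_diff R xs M p c = (\<lambda>A\<in>index_sets xs (Suc p).
     let L = localization R M (subset_prod R xs A) in
     \<Oplus>\<^bsub>L\<^esub>i\<in>A. ((\<ominus>\<^bsub>R\<^esub> \<one>\<^bsub>R\<^esub>) [^]\<^bsub>R\<^esub> card {j \<in> A. j < i}) \<odot>\<^bsub>L\<^esub>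
       localization_map R M (subset_prod R xs (A - {i})) (xs ! i) (c (A - {i})))"

definition cech_cocycles ::
  "('a, 'r) ring_scheme \<Rightarrow> 'a list \<Rightarrow> ('a, 'b, 'e) module_scheme \<Rightarrow> nat \<Rightarrow> (nat set \<Rightarrow> ('b \<times> nat) set) set" where
  "cech_cocycles R xs M p =
     {c \<in> carrier (cech_module R xs M p). cech_diff R xs M p c = \<zero>\<^bsub>cech_module R xs M (Suc p)\<^esub>}"

definition cech_coboundaries ::
  "('a, 'r) ring_scheme \<Rightarrow> 'a list \<Rightarrow> ('a, 'b, 'e) module_scheme \<Rightarrow> nat \<Rightarrow> (nat set \<Rightarrow> ('b \<times> nat) set) set" where
  "cech_coboundaries R xs M p = (case p of
       0 \<Rightarrow> {\<zero>\<^bsub>cech_module R xs M 0\<^esub>}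
     | Suc q \<Rightarrow> cech_diff R xs M q ` carrier (cech_module R xs M q))"

definition local_cohomology ::
  "('a, 'r) ring_scheme \<Rightarrow> 'a list \<Rightarrow> ('a, 'b, 'e) module_scheme \<Rightarrow> nat \<Rightarrow>
     ('a, (nat set \<Rightarrow> ('b \<times> nat) set) set) module" where
  "local_cohomology R xs M p =
     quot_module ((cech_module R xs M p)\<lparr>carrier := cech_cocycles R xs M p\<rparr>)
       (cech_coboundaries R xs M p)"

text \<open>
  The infimum is a minimum whenever some local cohomology module is non-zero; otherwise it is \<open>\<infinity>\<close>,
  the usual convention for the zero module.
\<close>

definition depth :: "('a, 'r) ring_scheme \<Rightarrow> 'a list \<Rightarrow> ('a, 'b, 'e) module_scheme \<Rightarrow> enat" where
  "depth R xs M =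
     Inf {enat p | p. carrier (local_cohomology R xs M p) \<noteq> {\<zero>\<^bsub>local_cohomology R xs M p\<^esub>}}"


section \<open>Generalized binomial edge ideals\<close>

text \<open>Polynomials in the variables \<open>x\<^sub>i\<^sub>j\<close> (\<open>i, j\<close> natural numbers): finitely supported maps from
  exponent vectors to coefficients.\<close>

type_synonym 'k mpoly2 = "((nat \<times> nat) \<Rightarrow>\<^sub>0 nat) \<Rightarrow>\<^sub>0 'k"

definition Xvar :: "nat \<Rightarrow> nat \<Rightarrow> 'k::field mpoly2" where
  "Xvar i j = Poly_Mapping.single (Poly_Mapping.single (i, j) 1) 1"

text \<open>\<open>S = K[x\<^sub>i\<^sub>j : i \<in> [m], j \<in> [n]]\<close>\<close>

definition poly_ring :: "nat \<Rightarrow> nat \<Rightarrow> 'k::field mpoly2 ring" where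
  "poly_ring m n =
     \<lparr>carrier = {p. \<forall>t\<in>Poly_Mapping.keys p. Poly_Mapping.keys t \<subseteq> {1..m} \<times> {1..n}},
      mult = (*), one = 1, zero = 0, add = (+)\<rparr>"

text \<open>The variables of \<open>S\<close>, which generate its homogeneous maximal ideal.\<close>

definition poly_vars :: "nat \<Rightarrow> nat \<Rightarrow> 'k::field mpoly2 list" where
  "poly_vars m n = concat (map (\<lambda>i. map (\<lambda>j. Xvar i j) [1..<Suc n]) [1..<Suc m])"

definition gen_binomial_edge_ideal :: "nat \<Rightarrow> nat \<Rightarrow> ugraph \<Rightarrow> 'k::field mpoly2 set" where
  "gen_binomial_edge_ideal m n G = Idl\<^bsub>poly_ring m n\<^esub>
     {Xvar i k * Xvar j l - Xvar i l * Xvar j k | i j k l.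
        1 \<le> i \<and> i < j \<and> j \<le> m \<and> {k, l} \<in> edges G \<and> k < l}"

definition gen_binomial_edge_quotient ::
  "nat \<Rightarrow> nat \<Rightarrow> ugraph \<Rightarrow> ('k::field mpoly2, 'k mpoly2 set) module" where
  "gen_binomial_edge_quotient m n G =
     quot_module (regular_module (poly_ring m n)) (gen_binomial_edge_ideal m n G)"

definition depth_S :: "nat \<Rightarrow> nat \<Rightarrow> ('k::field mpoly2, 'b) module \<Rightarrow> enat" where
  "depth_S m n M = depth (poly_ring m n) (poly_vars m n) M"

text \<open>\<open>\<Psi>(K\<^sub>m, G) = (m - 2) t + f(G) + d(G)\<close>; here \<open>m\<close> is read off from \<open>K\<^sub>m\<close> as its number of
  vertices.\<close>

definition Psi0 :: "ugraph \<Rightarrow> ugraph \<Rightarrow> nat" where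
  "Psi0 K G = (card (verts K) - 2) * num_components G + num_free G + d_inv G"

end

theory Submission
  imports Defs
begin

text \<open>
  The depth bound is an induction on the graph \<open>G\<close>, first on the number of its vertices and then on
  the number of its non-edges, along the vertex \<open>v\<close> that \<open>d\<close>-compatibility provides. Write \<open>J(H)\<close> for
  the ideal of a graph \<open>H\<close> on a subset of \<open>[n]\<close>, all variables in the missing columns included,
  so that the ring never changes. Then
  \<open>J(G) = J(G\<^sub>v) \<inter> J(G - v)\<close> and \<open>J(G\<^sub>v) + J(G - v) = J(G\<^sub>v - v)\<close>, and the long exact sequence of
  \<open>0 \<rightarrow> S/J(G) \<rightarrow> S/J(G\<^sub>v) \<oplus> S/J(G - v) \<rightarrow> S/J(G\<^sub>v - v) \<rightarrow> 0\<close> gives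
  \<open>depth S/J(G) \<ge> min (depth S/J(G\<^sub>v), depth S/J(G - v), depth S/J(G\<^sub>v - v) + 1)\<close>.

  The formula for \<open>J(G)\<close> as an intersection holds
    for the following reason. Modulo \<open>J(G)\<close> an element of \<open>J(G\<^sub>v)\<close> is a combination of minors on two neighbours of \<open>v\<close>. By
  a Pluecker relation a variable of column \<open>v\<close> times such a minor lies in \<open>J(G)\<close>, so the coefficients
  may be taken free of the variables of column \<open>v\<close>; and setting these variables to zero maps
  \<open>J(G - v)\<close> into \<open>J(G)\<close>. The abstract form of this argument is \<open>ideal_gen_split_Int\<close>.

  The induction ends at disjoint unions of complete graphs, where \<open>J(G)\<close> is generated by the
  \<open>2\<close>-minors of disjoint column blocks. These are treated more generally in \<open>block_depth\<close>, where each
  block may have its own set of rows. An entry \<open>x\<^sub>a\<^sub>b\<close> of a block is a nonzerodivisor modulo the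
  minors, because the relations identify exactly the monomials with equal row and column degrees,
  and adding \<open>x\<^sub>a\<^sub>b\<close> to the ideal yields the intersection of the ideals with row \<open>a\<close> and with
  column \<open>b\<close> of the block removed; the same splitting lemma applies.

  Local cohomology is reached through the elements \<open>x\<^sub>i\<^sup>k\<close>: a Cech cochain with common denominator is
  a Koszul cochain on the powers \<open>x\<^sub>i\<^sup>k\<close>, and passing to a larger denominator is the transition
  map. \<open>koszul_vanish\<close> says that every Koszul cocycle becomes a coboundary for large \<open>k\<close>. The two facts
  about depth that the proof needs, for intersections and for nonzerodivisors, are proved
  for this condition directly, and \<open>local_cohomology_trivial\<close> transports it to the Cech complex.

  For the second part let \<open>u\<close>, \<open>w\<close> be at distance \<open>d = diam C\<close> in a component \<open>C\<close> that is not
  complete, and let \<open>v \<in> C\<close> be non-free and different from both. In \<open>G\<^sub>v\<close> and in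
  \<open>G\<^sub>v - v\<close> distances drop by at most one and free vertices stay free, and \<open>v\<close> becomes free in \<open>G\<^sub>v\<close>.
  Only \<open>G - v\<close> needs a good choice of \<open>v\<close>. If for some such pair some such \<open>v\<close> does not separate \<open>u\<close> from
  \<open>w\<close>, then nothing is lost. Otherwise all inner vertices \<open>v\<^sub>1, \<dots>, v\<^bsub>d-1\<^esub>\<close> of a shortest path separate its ends, and for
  each \<open>i\<close> one asks whether the part of \<open>u\<close> in \<open>G - v\<^sub>i\<close> contributes at least \<open>i\<close> (by its diameter, a new
  isolated vertex, or new free vertices), and the part of \<open>w\<close> at least \<open>d - i\<close>. The largest \<open>i\<close> that is
  good for \<open>u\<close> is also good for \<open>w\<close>: if it is not, then \<open>v\<^bsub>i+1\<^esub>\<close> and \<open>v\<^bsub>i+2\<^esub>\<close> have two nonadjacent common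
  neighbours, and these make \<open>i + 2\<close> good for \<open>u\<close>, or, when \<open>i + 2 = d\<close>, yield a pair at distance \<open>d\<close> that the
  non-free vertex \<open>w\<close> does not separate.
\<close>

section \<open>Koszul cochains on powers of a sequence\<close>

definition ksign :: "nat \<Rightarrow> nat set \<Rightarrow> 'a::comm_ring_1" where
  "ksign i A = (-1) ^ card {j \<in> A. j < i}"

text \<open>
  The differential of the Koszul cochain complex on \<open>x\<^sub>i\<^sup>k\<close>. Cochains are total functions on
  sets; a degree is only fixed by restricting to arguments of a given cardinality, which makes
  degree \<open>-1\<close> harmless.
\<close>

definition kdiff :: "(nat \<Rightarrow> 'a::comm_ring_1) \<Rightarrow> nat \<Rightarrow> (nat set \<Rightarrow> 'a) \<Rightarrow> nat set \<Rightarrow> 'a" where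
  "kdiff x k a A = (\<Sum>i\<in>A. ksign i A * x i ^ k * a (A - {i}))"

text \<open>
  The transition map from exponent \<open>k\<close> to exponent \<open>k + N\<close>. If \<open>a A\<close> is read as the fraction
  \<open>a A / (\<Prod>i\<in>A. x i) ^ k\<close>, it leaves the fraction unchanged.
\<close>

definition ktrans :: "(nat \<Rightarrow> 'a::comm_ring_1) \<Rightarrow> nat \<Rightarrow> (nat set \<Rightarrow> 'a) \<Rightarrow> nat set \<Rightarrow> 'a" where
  "ktrans x N a A = (\<Prod>i\<in>A. x i) ^ N * a A"

lemma ksign_square: "ksign i A * ksign i A = 1"
  by (simp add: ksign_def flip: power_mult_distrib)

lemma ksign_remove_above: "i \<le> j \<Longrightarrow> ksign i (A - {j}) = ksign i A"
proof -
  assume "i \<le> j"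
  then have "{l \<in> A - {j}. l < i} = {l \<in> A. l < i}" by auto
  then show ?thesis by (simp add: ksign_def)
qed

lemma ksign_remove_below:
  assumes "finite A" "i \<in> A" "i < j"
  shows "ksign j (A - {i}) = - ksign j A"
proof -
  have "{l \<in> A. l < j} = insert i {l \<in> A - {i}. l < j}" using assms by auto
  moreover have "finite {l \<in> A - {i}. l < j}" using assms by auto
  ultimately show ?thesis by (simp add: ksign_def)
qed

lemma ksign_swap:
  assumes "finite A" "i \<in> A" "j \<in> A" "i \<noteq> j"
  shows "ksign i A * ksign j (A - {i}) = - (ksign j A * ksign i (A - {j}))"
proof (cases "i < j")
  case True
  then show ?thesis using assms by (simp add: ksign_remove_below ksign_remove_above mult.commute)
next
  case False
  then have "j < i" using assms by auto
  then show ?thesis using assms by (simp add: ksign_remove_below ksign_remove_above mult.commute)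
qed

text \<open>
  The double sum runs over ordered pairs of distinct elements of \<open>A\<close>; by \<open>ksign_swap\<close> the
  terms of \<open>(i, j)\<close> and \<open>(j, i)\<close> cancel.
\<close>

lemma kdiff_diff:
  assumes "finite A"
  shows "kdiff x k (kdiff x k a) A = 0"
proof -
  define g where "g = (\<lambda>i j. ksign i A * ksign j (A - {i}) * (x i ^ k * x j ^ k) * a (A - {i} - {j}))"
  define D where "D = {q \<in> A \<times> A. fst q < snd q}"
  have fin: "finite D" "finite (prod.swap ` D)" using assms by (auto simp: D_def)
  have U: "Sigma A (\<lambda>i. A - {i}) = D \<union> prod.swap ` D"
    by (auto simp: D_def image_iff)
  have dis: "D \<inter> prod.swap ` D = {}" by (auto simp: D_def)
  have anti: "g j i = - g i j" if "(i, j) \<in> D" for i j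
  proof -
    from that have ij: "i \<in> A" "j \<in> A" "i \<noteq> j" by (auto simp: D_def)
    have "A - {i} - {j} = A - {j} - {i}" by auto
    then have "g j i = (ksign j A * ksign i (A - {j})) * (x i ^ k * x j ^ k * a (A - {i} - {j}))"
      by (simp add: g_def mult_ac)
    also have "ksign j A * ksign i (A - {j}) = - (ksign i A * ksign j (A - {i}) :: 'a)"
      using ksign_swap[OF assms ij, where ?'a = 'a] by simp
    finally show ?thesis by (simp add: g_def mult_ac)
  qed
  have "kdiff x k (kdiff x k a) A = (\<Sum>i\<in>A. \<Sum>j\<in>A - {i}. g i j)"
    by (simp add: kdiff_def g_def sum_distrib_left mult_ac)
  also have "\<dots> = (\<Sum>q\<in>Sigma A (\<lambda>i. A - {i}). g (fst q) (snd q))"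
    using assms by (subst sum.Sigma) (auto simp: case_prod_beta)
  also have "\<dots> = (\<Sum>q\<in>D. g (fst q) (snd q)) + (\<Sum>q\<in>prod.swap ` D. g (fst q) (snd q))"
    unfolding U using fin dis by (subst sum.union_disjoint) auto
  also have "(\<Sum>q\<in>prod.swap ` D. g (fst q) (snd q)) = (\<Sum>q\<in>D. g (snd q) (fst q))"
    by (subst sum.reindex) (auto simp: o_def)
  also have "\<dots> = (\<Sum>q\<in>D. - g (fst q) (snd q))"
    by (rule sum.cong) (auto intro: anti)
  finally show ?thesis by (simp add: sum_negf)
qed

lemma kdiff_trans:
  assumes "finite A"
  shows "kdiff x (k + N) (ktrans x N a) A = ktrans x N (kdiff x k a) A"
proof -
  have "ksign i A * x i ^ (k + N) * ktrans x N a (A - {i}) =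
      (\<Prod>i\<in>A. x i) ^ N * (ksign i A * x i ^ k * a (A - {i}))" if "i \<in> A" for i
    using prod.remove[OF assms that, of x]
    by (simp add: ktrans_def power_add power_mult_distrib mult_ac)
  then show ?thesis by (simp add: kdiff_def ktrans_def sum_distrib_left)
qed

lemma ktrans_trans: "ktrans x M (ktrans x N a) = ktrans x (N + M) a"
  by (auto simp: ktrans_def power_add mult_ac)

lemma kdiff_minus: "kdiff x k (\<lambda>A. a A - b A) A = kdiff x k a A - kdiff x k b A"
  by (simp add: kdiff_def algebra_simps sum_subtractf)

lemma kdiff_add: "kdiff x k (\<lambda>A. a A + b A) A = kdiff x k a A + kdiff x k b A"
  by (simp add: kdiff_def algebra_simps sum.distrib)

lemma kdiff_scale: "kdiff x k (\<lambda>A. r * a A) A = r * kdiff x k a A"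
  by (simp add: kdiff_def sum_distrib_left mult_ac)

lemma kdiff_cong: "(\<And>i. i \<in> A \<Longrightarrow> a (A - {i}) = b (A - {i})) \<Longrightarrow> kdiff x k a A = kdiff x k b A"
  unfolding kdiff_def by (rule sum.cong) auto

text \<open>The contracting homotopy that shows that \<open>x\<^sub>j\<^sup>k\<close> annihilates Koszul cohomology.\<close>

definition khtpy :: "nat \<Rightarrow> (nat set \<Rightarrow> 'a::comm_ring_1) \<Rightarrow> nat set \<Rightarrow> 'a" where
  "khtpy j a B = (if j \<in> B then 0 else ksign j (insert j B) * a (insert j B))"

lemma kdiff_homotopy:
  assumes "finite B"
  shows "kdiff x k (khtpy j a) B + khtpy j (kdiff x k a) B = x j ^ k * a B"
proof (cases "j \<in> B")
  case True
  have "kdiff x k (khtpy j a) B = (\<Sum>i\<in>B. if i = j then x j ^ k * a B else 0)"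
    unfolding kdiff_def
  proof (rule sum.cong)
    fix i assume i: "i \<in> B"
    show "ksign i B * x i ^ k * khtpy j a (B - {i}) = (if i = j then x j ^ k * a B else 0)"
    proof (cases "i = j")
      case True
      have "insert j (B - {j}) = B" using \<open>j \<in> B\<close> by auto
      then have "khtpy j a (B - {j}) = ksign j B * a B" by (simp add: khtpy_def)
      moreover have "ksign j B * x j ^ k * (ksign j B * a B) = (ksign j B * ksign j B) * (x j ^ k * a B)"
        by (simp add: mult_ac)
      ultimately show ?thesis using True by (simp add: ksign_square)
    next
      case False
      then show ?thesis using \<open>j \<in> B\<close> by (simp add: khtpy_def)
    qed
  qed simp
  then show ?thesis using True assms by (simp add: khtpy_def)
next
  case False
  let ?A = "insert j B"
  have fA: "finite ?A" using assms by simp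
  have AB: "?A - {j} = B" using False by auto
  have "khtpy j (kdiff x k a) B = ksign j ?A * (ksign j ?A * x j ^ k * a B +
      (\<Sum>i\<in>B. ksign i ?A * x i ^ k * a (?A - {i})))"
    using False assms AB by (simp add: khtpy_def kdiff_def)
  also have "\<dots> = x j ^ k * a B + (\<Sum>i\<in>B. ksign j ?A * ksign i ?A * x i ^ k * a (?A - {i}))"
    using ksign_square[of j ?A, where ?'a = 'a] by (simp add: distrib_left sum_distrib_left flip: mult.assoc)
  finally have 1: "khtpy j (kdiff x k a) B = x j ^ k * a B + (\<Sum>i\<in>B. ksign j ?A * ksign i ?A * x i ^ k * a (?A -
    {i}))" .
  have "kdiff x k (khtpy j a) B = (\<Sum>i\<in>B. - (ksign j ?A * ksign i ?A * x i ^ k * a (?A - {i})))"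
    unfolding kdiff_def
  proof (rule sum.cong)
    fix i assume i: "i \<in> B"
    then have ne: "i \<noteq> j" using False by auto
    have e: "insert j (B - {i}) = ?A - {i}" using ne by auto
    have s: "ksign i ?A * ksign j (?A - {i}) = - (ksign j ?A * (ksign i B :: 'a))"
      using ksign_swap[OF fA _ _ ne] i AB by auto
    have "ksign i B * ksign j (?A - {i}) = ksign i B * (ksign i ?A * ksign i ?A) * (ksign j (?A - {i}) :: 'a)"
      by (simp add: ksign_square)
    also have "\<dots> = ksign i B * ksign i ?A * (ksign i ?A * ksign j (?A - {i}))" by (simp add: mult_ac)
    also have "\<dots> = - ((ksign i B * ksign i B) * (ksign i ?A * ksign j ?A))" by (simp add: s mult_ac)
    finally have t: "ksign i B * ksign j (?A - {i}) = - (ksign j ?A * (ksign i ?A :: 'a))"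
      by (simp add: ksign_square mult_ac)
    have "ksign i B * x i ^ k * khtpy j a (B - {i}) = (ksign i B * ksign j (?A - {i})) * (x i ^ k * a (?A -
      {i}))"
      using ne False by (simp add: khtpy_def e mult_ac)
    then show "ksign i B * x i ^ k * khtpy j a (B - {i}) = - (ksign j ?A * ksign i ?A * x i ^ k * a (?A -
      {i}))"
      by (simp add: t mult_ac)
  qed simp
  then show ?thesis by (simp add: 1 sum_negf)
qed

text \<open>
  \<open>P\<close> is a subring of an ambient ring, since polynomials in finitely many variables form a subset of
  a type of polynomials in infinitely many. All of \<open>x\<close> lies in \<open>P\<close>, but only \<open>x 0, \<dots>, x (r - 1)\<close> enter
  the complexes.
\<close>

locale coord_ring =
  fixes P :: "'a::comm_ring_1 set" and x :: "nat \<Rightarrow> 'a" and r :: nat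
  assumes zero_P [simp]: "0 \<in> P" and one_P [simp]: "1 \<in> P"
    and add_P [intro, simp]: "\<And>a b. a \<in> P \<Longrightarrow> b \<in> P \<Longrightarrow> a + b \<in> P"
    and minus_P [intro, simp]: "\<And>a. a \<in> P \<Longrightarrow> - a \<in> P"
    and mult_P [intro, simp]: "\<And>a b. a \<in> P \<Longrightarrow> b \<in> P \<Longrightarrow> a * b \<in> P"
    and x_P [simp]: "\<And>i. x i \<in> P"
begin

definition ideal_in :: "'a set \<Rightarrow> bool" where
  "ideal_in I \<longleftrightarrow> I \<subseteq> P \<and> 0 \<in> I \<and> (\<forall>a\<in>I. \<forall>b\<in>I. a + b \<in> I) \<and> (\<forall>p\<in>P. \<forall>a\<in>I. p * a \<in> I)"

text \<open>
  Vanishing of the \<open>p\<close>-th cohomology of the direct limit over \<open>k\<close> of the Koszul complexes of \<open>P/I\<close>,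
  expressed with representatives in \<open>P\<close>.
\<close>

definition koszul_vanish :: "'a set \<Rightarrow> nat \<Rightarrow> bool" where
  "koszul_vanish I p \<longleftrightarrow> (\<forall>k a. (\<forall>A. a A \<in> P) \<longrightarrow> (\<forall>A\<subseteq>{..<r}. card A = Suc p \<longrightarrow> kdiff x k a A \<in> I) \<longrightarrow>
     (\<exists>N b. (\<forall>A. b A \<in> P) \<and> (\<forall>A\<subseteq>{..<r}. card A = p \<longrightarrow> ktrans x N a A - kdiff x (k + N) b A \<in> I)))"

definition depth_ge :: "'a set \<Rightarrow> nat \<Rightarrow> bool" where
  "depth_ge I d \<longleftrightarrow> (\<forall>p<d. koszul_vanish I p)"

lemma koszul_vanishE:
  assumes "koszul_vanish I p" "\<And>A. a A \<in> P" "\<And>A. A \<subseteq> {..<r} \<Longrightarrow> card A = Suc p \<Longrightarrow> kdiff x k a A \<in> I"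
  obtains N b where "\<And>A. b A \<in> P"
    "\<And>A. A \<subseteq> {..<r} \<Longrightarrow> card A = p \<Longrightarrow> ktrans x N a A - kdiff x (k + N) b A \<in> I"
proof -
  have "\<exists>N b. (\<forall>A. b A \<in> P) \<and> (\<forall>A\<subseteq>{..<r}. card A = p \<longrightarrow> ktrans x N a A - kdiff x (k + N) b A \<in> I)"
    using assms(1)[unfolded koszul_vanish_def, rule_format, of a k] assms(2,3) by simp
  then show ?thesis using that by auto
qed

lemma diff_P [intro, simp]: "a \<in> P \<Longrightarrow> b \<in> P \<Longrightarrow> a - b \<in> P"
  using add_P[of a "- b"] by simp

lemma power_P [intro, simp]: "a \<in> P \<Longrightarrow> a ^ k \<in> P"
  by (induction k) auto

lemma prod_P [intro]: "(\<And>i. i \<in> A \<Longrightarrow> f i \<in> P) \<Longrightarrow> prod f A \<in> P"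
  by (induction A rule: infinite_finite_induct) auto

lemma sum_P [intro]: "(\<And>i. i \<in> A \<Longrightarrow> f i \<in> P) \<Longrightarrow> sum f A \<in> P"
  by (induction A rule: infinite_finite_induct) auto

lemma ksign_P [simp]: "ksign i A \<in> P"
  by (auto simp: ksign_def)

lemma kdiff_P: "(\<And>A. a A \<in> P) \<Longrightarrow> kdiff x k a A \<in> P"
  by (auto simp: kdiff_def)

lemma ktrans_P: "(\<And>A. a A \<in> P) \<Longrightarrow> ktrans x N a A \<in> P"
  by (auto simp: ktrans_def intro!: mult_P power_P prod_P)

lemma ideal_P: "ideal_in I \<Longrightarrow> a \<in> I \<Longrightarrow> a \<in> P"
  and ideal_zero: "ideal_in I \<Longrightarrow> 0 \<in> I"
  and ideal_add: "ideal_in I \<Longrightarrow> a \<in> I \<Longrightarrow> b \<in> I \<Longrightarrow> a + b \<in> I"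
  and ideal_mult: "ideal_in I \<Longrightarrow> p \<in> P \<Longrightarrow> a \<in> I \<Longrightarrow> p * a \<in> I"
  by (auto simp: ideal_in_def)

lemma ideal_uminus: "ideal_in I \<Longrightarrow> a \<in> I \<Longrightarrow> - a \<in> I"
  using ideal_mult[of I "- 1" a] by auto

lemma ideal_diff: "ideal_in I \<Longrightarrow> a \<in> I \<Longrightarrow> b \<in> I \<Longrightarrow> a - b \<in> I"
  using ideal_add[of I a "- b"] ideal_uminus by auto

lemma ideal_sum: "ideal_in I \<Longrightarrow> (\<And>i. i \<in> A \<Longrightarrow> f i \<in> I) \<Longrightarrow> sum f A \<in> I"
  by (induction A rule: infinite_finite_induct) (auto intro: ideal_zero ideal_add)

lemma kdiff_ideal:
  assumes "ideal_in I" "\<And>i. i \<in> A \<Longrightarrow> a (A - {i}) \<in> I"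
  shows "kdiff x k a A \<in> I"
  unfolding kdiff_def using assms(2) by (intro ideal_sum[OF assms(1)] ideal_mult[OF assms(1)]) auto

lemma ktrans_ideal:
  assumes "ideal_in I" "a A \<in> I"
  shows "ktrans x N a A \<in> I"
  unfolding ktrans_def by (intro ideal_mult[OF assms(1)] assms(2) power_P prod_P) simp

definition ideal_plus :: "'a set \<Rightarrow> 'a set \<Rightarrow> 'a set" where
  "ideal_plus I J = {a + b | a b. a \<in> I \<and> b \<in> J}"

text \<open>
  A witness for one exponent yields a witness for every larger one. This allows several coboundary
  relations to be brought to the same exponent.
\<close>

lemma coboundary_raise:
  assumes I: "ideal_in I" and b: "\<And>A. b A \<in> P"
    and eq: "\<And>A. A \<subseteq> {..<r} \<Longrightarrow> card A = p \<Longrightarrow> ktrans x N a A - kdiff x (k + N) b A \<in> I"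
    and A: "A \<subseteq> {..<r}" "card A = p"
  shows "ktrans x (N + M) a A - kdiff x (k + (N + M)) (ktrans x M b) A \<in> I"
proof -
  have fA: "finite A" using A finite_subset by blast
  have "ktrans x (N + M) a A - kdiff x (k + (N + M)) (ktrans x M b) A =
      ktrans x M (ktrans x N a) A - ktrans x M (kdiff x (k + N) b) A"
    using kdiff_trans[OF fA, of x "k + N" M b] by (simp add: ktrans_trans add.assoc)
  also have "\<dots> = ktrans x M (\<lambda>A. ktrans x N a A - kdiff x (k + N) b A) A"
    by (simp add: ktrans_def algebra_simps)
  also have "\<dots> \<in> I"
    by (rule ktrans_ideal[OF I]) (rule eq[OF A])
  finally show ?thesis .
qed

lemma card_remove: "A \<subseteq> {..<r} \<Longrightarrow> card A = Suc p \<Longrightarrow> i \<in> A \<Longrightarrow> A - {i} \<subseteq> {..<r} \<and> card (A - {i}) = p"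
  by (metis Diff_subset card_Diff_singleton diff_Suc_1 subset_trans)

text \<open>
  The long exact sequence of \<open>0 \<rightarrow> P/(I\<^sub>1 \<inter> I\<^sub>2) \<rightarrow> P/I\<^sub>1 \<oplus> P/I\<^sub>2 \<rightarrow> P/(I\<^sub>1 + I\<^sub>2) \<rightarrow> 0\<close> by hand:
  a cocycle bounds modulo both ideals, the difference of the two bounding cochains is a cocycle
  modulo the sum, and correcting by what it bounds makes the two cochains agree up to
  elements of the two ideals.
\<close>

lemma koszul_vanish_Int:
  assumes I1: "ideal_in I1" and I2: "ideal_in I2"
    and v1: "koszul_vanish I1 p" and v2: "koszul_vanish I2 p"
    and v3: "\<And>q. p = Suc q \<Longrightarrow> koszul_vanish (ideal_plus I1 I2) q"
  shows "koszul_vanish (I1 \<inter> I2) p"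
  unfolding koszul_vanish_def
proof (intro allI impI)
  fix k a assume a: "\<forall>A. a A \<in> P"
    and coc: "\<forall>A\<subseteq>{..<r}. card A = Suc p \<longrightarrow> kdiff x k a A \<in> I1 \<inter> I2"
  obtain N1 b1 where b1: "\<And>A. b1 A \<in> P"
    and e1: "\<And>A. A \<subseteq> {..<r} \<Longrightarrow> card A = p \<Longrightarrow> ktrans x N1 a A - kdiff x (k + N1) b1 A \<in> I1"
    by (rule koszul_vanishE[OF v1, of a k]) (use a coc in auto)
  obtain N2 b2 where b2: "\<And>A. b2 A \<in> P"
    and e2: "\<And>A. A \<subseteq> {..<r} \<Longrightarrow> card A = p \<Longrightarrow> ktrans x N2 a A - kdiff x (k + N2) b2 A \<in> I2"
    by (rule koszul_vanishE[OF v2, of a k]) (use a coc in auto)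
  define N where "N = N1 + N2"
  define c1 where "c1 = ktrans x N2 b1"
  define c2 where "c2 = ktrans x N1 b2"
  have c: "c1 A \<in> P" "c2 A \<in> P" for A using b1 b2 by (auto simp: c1_def c2_def intro: ktrans_P)
  have f1: "ktrans x N a A - kdiff x (k + N) c1 A \<in> I1" if "A \<subseteq> {..<r}" "card A = p" for A
    unfolding N_def c1_def by (rule coboundary_raise[OF I1 b1 e1 that])
  have f2: "ktrans x N a A - kdiff x (k + N) c2 A \<in> I2" if "A \<subseteq> {..<r}" "card A = p" for A
    using coboundary_raise[OF I2 b2 e2 that, of N1] by (simp add: N_def c2_def add.commute)
  show "\<exists>N b. (\<forall>A. b A \<in> P) \<and> (\<forall>A\<subseteq>{..<r}. card A = p \<longrightarrow> ktrans x N a A - kdiff x (k + N) b A \<in> I1 \<inter> I2)"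
  proof (cases p)
    case 0
    have z: "kdiff x (k + N) b A = 0" if "A \<subseteq> {..<r}" "card A = p" for A b
    proof -
      have "finite A" using that(1) finite_subset by blast
      with that 0 have "A = {}" by simp
      then show ?thesis by (simp add: kdiff_def)
    qed
    show ?thesis
      using f1 f2 by (intro exI[of _ N] exI[of _ "\<lambda>_. 0"]) (auto simp: z)
  next
    case (Suc q)
    let ?c = "\<lambda>A. c1 A - c2 A"
    have cc: "kdiff x (k + N) ?c A \<in> ideal_plus I1 I2" if "A \<subseteq> {..<r}" "card A = Suc q" for A
    proof -
      have "kdiff x (k + N) ?c A = - (ktrans x N a A - kdiff x (k + N) c1 A) + (ktrans x N a A - kdiff x (k +
        N) c2 A)"
        by (simp add: kdiff_minus)
      then show ?thesis unfolding ideal_plus_def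
        using f1[OF that(1)] f2[OF that(1)] that(2) Suc I1 by (blast intro: ideal_uminus)
    qed
    have cP: "?c A \<in> P" for A using c by auto
    obtain M d where d: "\<And>A. d A \<in> P"
      and e: "\<And>A. A \<subseteq> {..<r} \<Longrightarrow> card A = q \<Longrightarrow> ktrans x M ?c A - kdiff x (k + N + M) d A \<in> ideal_plus I1 I2"
      by (rule koszul_vanishE[OF v3[OF Suc] cP], erule (1) cc, rule that, assumption+)
    have "\<exists>u w. u \<in> I1 \<and> w \<in> I2 \<and> (A \<subseteq> {..<r} \<longrightarrow> card A = q \<longrightarrow> ktrans x M ?c A - kdiff x (k + N + M) d A = u +
      w)" for A
      using e[of A] ideal_zero[OF I1] ideal_zero[OF I2] unfolding ideal_plus_def by blast
    then obtain u w where u: "\<And>A. u A \<in> I1" and w: "\<And>A. w A \<in> I2"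
      and uw: "\<And>A. A \<subseteq> {..<r} \<Longrightarrow> card A = q \<Longrightarrow> ktrans x M ?c A - kdiff x (k + N + M) d A = u A + w A"
      by metis
    \<comment> \<open>Modulo \<open>I\<^sub>2\<close> this is \<open>c2\<close>, and it agrees with \<open>c1\<close> modulo \<open>I\<^sub>1\<close> and a coboundary.\<close>
    define b where "b = (\<lambda>A. ktrans x M c2 A + w A)"
    have bP: "b A \<in> P" for A
      unfolding b_def by (intro add_P ktrans_P c ideal_P[OF I2 w])
    have res: "ktrans x (N + M) a A - kdiff x (k + (N + M)) b A \<in> I1 \<inter> I2" if A: "A \<subseteq> {..<r}" "card A = p"
      for A
    proof
      have fA: "finite A" using A finite_subset by blast
      have 2: "ktrans x (N + M) a A - kdiff x (k + (N + M)) (ktrans x M c2) A \<in> I2"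
        by (rule coboundary_raise[OF I2 c(2) f2 A])
      have "kdiff x (k + (N + M)) w A \<in> I2" by (rule kdiff_ideal[OF I2]) (rule w)
      from ideal_diff[OF I2 2 this] show "ktrans x (N + M) a A - kdiff x (k + (N + M)) b A \<in> I2"
        by (simp add: b_def kdiff_add diff_diff_eq)
      have 1: "ktrans x (N + M) a A - kdiff x (k + (N + M)) (ktrans x M c1) A \<in> I1"
        by (rule coboundary_raise[OF I1 c(1) f1 A])
      have "kdiff x (k + (N + M)) b A =
          kdiff x (k + (N + M)) (\<lambda>A. ktrans x M c1 A - (u A + kdiff x (k + N + M) d A)) A"
      proof (rule kdiff_cong)
        fix i assume "i \<in> A"
        then have *: "A - {i} \<subseteq> {..<r}" "card (A - {i}) = q" using card_remove A Suc by auto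
        from uw[OF *] show "b (A - {i}) = ktrans x M c1 (A - {i}) - (u (A - {i}) + kdiff x (k + N + M) d (A -
          {i}))"
          by (simp add: b_def ktrans_def algebra_simps)
      qed
      also have "\<dots> = kdiff x (k + (N + M)) (ktrans x M c1) A - kdiff x (k + (N + M)) u A"
        using kdiff_diff[OF fA, of x "k + N + M" d] by (simp add: kdiff_minus kdiff_add add.assoc)
      finally have "ktrans x (N + M) a A - kdiff x (k + (N + M)) b A =
          ktrans x (N + M) a A - kdiff x (k + (N + M)) (ktrans x M c1) A + kdiff x (k + (N + M)) u A" by simp
      also have "\<dots> \<in> I1" by (intro ideal_add[OF I1 1] kdiff_ideal[OF I1] u)
      finally show "ktrans x (N + M) a A - kdiff x (k + (N + M)) b A \<in> I1" .
    qed
    show ?thesis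
      using bP res by (intro exI[of _ "N + M"] exI[of _ b]) auto
  qed
qed

theorem depth_ge_Int:
  assumes "ideal_in I1" "ideal_in I2" "depth_ge I1 d" "depth_ge I2 d"
    "depth_ge (ideal_plus I1 I2) (d - 1)"
  shows "depth_ge (I1 \<inter> I2) d"
  unfolding depth_ge_def
proof (intro allI impI)
  fix p assume "p < d"
  then show "koszul_vanish (I1 \<inter> I2) p"
    using assms(3-5) by (intro koszul_vanish_Int[OF assms(1,2)]) (auto simp: depth_ge_def)
qed

text \<open>
  Multiplication by a nonzerodivisor \<open>y\<close> is injective on the \<open>p\<close>-th cohomology as soon as the cohomology
  of \<open>P/(I + (y))\<close> vanishes one degree lower: if \<open>y a\<close> bounds \<open>b\<close> modulo \<open>I\<close>, then \<open>b\<close> is a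
  cocycle modulo \<open>I + (y)\<close>.
\<close>

lemma coboundary_cancel:
  assumes I: "ideal_in I" and y: "y \<in> P" and nzd: "\<And>f. f \<in> P \<Longrightarrow> y * f \<in> I \<Longrightarrow> f \<in> I"
    and v: "\<And>q. p = Suc q \<Longrightarrow> koszul_vanish (ideal_plus I ((*) y ` P)) q"
    and a: "\<And>A. a A \<in> P" and b: "\<And>A. b A \<in> P"
    and eq: "\<And>A. A \<subseteq> {..<r} \<Longrightarrow> card A = p \<Longrightarrow> y * a A - kdiff x k b A \<in> I"
  shows "\<exists>N f. (\<forall>A. f A \<in> P) \<and> (\<forall>A\<subseteq>{..<r}. card A = p \<longrightarrow> ktrans x N a A - kdiff x (k + N) f A \<in> I)"
proof (cases p)
  case 0
  have z: "kdiff x j b A = 0" if "A \<subseteq> {..<r}" "card A = p" for A b j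
  proof -
    have "finite A" using that(1) finite_subset by blast
    with that 0 have "A = {}" by simp
    then show ?thesis by (simp add: kdiff_def)
  qed
  show ?thesis
    using eq nzd a by (intro exI[of _ 0] exI[of _ "\<lambda>_. 0"]) (auto simp: z ktrans_def)
next
  case (Suc q)
  let ?J = "ideal_plus I ((*) y ` P)"
  have cc: "kdiff x k b A \<in> ?J" if "A \<subseteq> {..<r}" "card A = Suc q" for A
  proof -
    have "kdiff x k b A = - (y * a A - kdiff x k b A) + y * a A" by simp
    then show ?thesis unfolding ideal_plus_def using eq[of A] that Suc a ideal_uminus[OF I] by blast
  qed
  obtain N c where c: "\<And>A. c A \<in> P"
    and e: "\<And>A. A \<subseteq> {..<r} \<Longrightarrow> card A = q \<Longrightarrow> ktrans x N b A - kdiff x (k + N) c A \<in> ?J"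
    by (rule koszul_vanishE[OF v[OF Suc] b], erule (1) cc, rule that, assumption+)
  have "\<exists>u f. u \<in> I \<and> f \<in> P \<and> (A \<subseteq> {..<r} \<longrightarrow> card A = q \<longrightarrow> ktrans x N b A - kdiff x (k + N) c A = u + y * f)"
    for A
    using e[of A] ideal_zero[OF I] zero_P unfolding ideal_plus_def by blast
  then obtain u f where u: "\<And>A. u A \<in> I" and f: "\<And>A. f A \<in> P"
    and uf: "\<And>A. A \<subseteq> {..<r} \<Longrightarrow> card A = q \<Longrightarrow> ktrans x N b A - kdiff x (k + N) c A = u A + y * f A"
    by metis
  have "ktrans x N a A - kdiff x (k + N) f A \<in> I" if A: "A \<subseteq> {..<r}" "card A = p" for A
  proof (rule nzd)
    show "ktrans x N a A - kdiff x (k + N) f A \<in> P" using a f by (auto intro: ktrans_P kdiff_P)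
    have fA: "finite A" using A finite_subset by blast
    have "kdiff x (k + N) (\<lambda>A. y * f A) A = kdiff x (k + N) (\<lambda>A. ktrans x N b A - (kdiff x (k + N) c A +
      u A)) A"
    proof (rule kdiff_cong)
      fix i assume "i \<in> A"
      then have *: "A - {i} \<subseteq> {..<r}" "card (A - {i}) = q" using card_remove A Suc by auto
      from uf[OF *] show "y * f (A - {i}) = ktrans x N b (A - {i}) - (kdiff x (k + N) c (A - {i}) + u (A -
        {i}))"
        by (simp add: algebra_simps)
    qed
    also have "\<dots> = ktrans x N (kdiff x k b) A - kdiff x (k + N) u A"
      using kdiff_diff[OF fA, of x "k + N" c] kdiff_trans[OF fA, of x k N b] by
        (simp add: kdiff_minus kdiff_add)
    finally have "y * (ktrans x N a A - kdiff x (k + N) f A) =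
        ktrans x N (\<lambda>A. y * a A - kdiff x k b A) A + kdiff x (k + N) u A"
      by (simp add: kdiff_scale ktrans_def algebra_simps)
    also have "\<dots> \<in> I" by (intro ideal_add[OF I] ktrans_ideal[OF I] kdiff_ideal[OF I] u eq A)
    finally show "y * (ktrans x N a A - kdiff x (k + N) f A) \<in> I" .
  qed
  then show ?thesis using f by blast
qed

text \<open>
  By the homotopy, \<open>x\<^sub>j\<^sup>k\<close> times a cocycle is a coboundary; the \<open>k\<close> factors are then cancelled one
  after the other.
\<close>

lemma koszul_vanish_nzd:
  assumes I: "ideal_in I" and nzd: "\<And>f. f \<in> P \<Longrightarrow> x j * f \<in> I \<Longrightarrow> f \<in> I" and j: "j < r"
    and v: "\<And>q. p = Suc q \<Longrightarrow> koszul_vanish (ideal_plus I ((*) (x j) ` P)) q"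
  shows "koszul_vanish I p"
  unfolding koszul_vanish_def
proof (intro allI impI)
  fix k a assume a: "\<forall>A. a A \<in> P"
    and coc: "\<forall>A\<subseteq>{..<r}. card A = Suc p \<longrightarrow> kdiff x k a A \<in> I"
  have peel: "\<exists>N f. (\<forall>A. f A \<in> P) \<and> (\<forall>A\<subseteq>{..<r}. card A = p \<longrightarrow> ktrans x N a A - kdiff x (l + N) f A \<in> I)"
    if "\<And>A. a A \<in> P" "\<And>A. b A \<in> P" "\<And>A. A \<subseteq> {..<r} \<Longrightarrow> card A = p \<Longrightarrow> x j ^ s * a A - kdiff x l b A \<in> I"
    for s l and a b :: "nat set \<Rightarrow> 'a"
    using that
  proof (induction s arbitrary: a b l)
    case 0
    then show ?case by (intro exI[of _ 0] exI[of _ b]) (auto simp: ktrans_def)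
  next
    case (Suc s)
    have "\<exists>N f. (\<forall>A. f A \<in> P) \<and> (\<forall>A\<subseteq>{..<r}. card A = p \<longrightarrow>
        ktrans x N (\<lambda>A. x j ^ s * a A) A - kdiff x (l + N) f A \<in> I)"
    proof (rule coboundary_cancel[OF I x_P nzd v])
      show "\<And>A. x j ^ s * a A \<in> P" using Suc.prems(1) by auto
      show "\<And>A. b A \<in> P" by (rule Suc.prems(2))
      show "\<And>A. A \<subseteq> {..<r} \<Longrightarrow> card A = p \<Longrightarrow> x j * (x j ^ s * a A) - kdiff x l b A \<in> I"
        using Suc.prems(3) by (simp add: mult.assoc)
    qed
    then obtain N f where f: "\<And>A. f A \<in> P"
      and e: "\<And>A. A\<subseteq>{..<r} \<Longrightarrow> card A = p \<Longrightarrow> x j ^ s * ktrans x N a A - kdiff x (l + N) f A \<in> I"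
      by (auto simp: ktrans_def mult_ac)
    have "\<exists>M g. (\<forall>A. g A \<in> P) \<and> (\<forall>A\<subseteq>{..<r}. card A = p \<longrightarrow>
        ktrans x M (ktrans x N a) A - kdiff x (l + N + M) g A \<in> I)"
      by (rule Suc.IH[OF _ f e]) (use Suc.prems in \<open>auto intro: ktrans_P\<close>)
    then obtain M g where "\<forall>A. g A \<in> P"
      "\<forall>A\<subseteq>{..<r}. card A = p \<longrightarrow> ktrans x (N + M) a A - kdiff x (l + (N + M)) g A \<in> I"
      by (auto simp: ktrans_trans add.assoc)
    then show ?case by blast
  qed
  show "\<exists>N b. (\<forall>A. b A \<in> P) \<and> (\<forall>A\<subseteq>{..<r}. card A = p \<longrightarrow> ktrans x N a A - kdiff x (k + N) b A \<in> I)"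
  proof (rule peel)
    show "\<And>A. a A \<in> P" using a by auto
    show "\<And>A. khtpy j a A \<in> P" using a by (auto simp: khtpy_def)
    fix A assume A: "A \<subseteq> {..<r}" "card A = p"
    then have fA: "finite A" using finite_subset by blast
    have "x j ^ k * a A - kdiff x k (khtpy j a) A = khtpy j (kdiff x k a) A"
      using kdiff_homotopy[OF fA, of x k j a] by (simp add: algebra_simps)
    also have "\<dots> \<in> I"
      using A j coc fA by (auto simp: khtpy_def ideal_zero[OF I] intro!: ideal_mult[OF I])
    finally show "x j ^ k * a A - kdiff x k (khtpy j a) A \<in> I" .
  qed
qed

theorem depth_ge_nzd:
  assumes "ideal_in I" "\<And>f. f \<in> P \<Longrightarrow> x j * f \<in> I \<Longrightarrow> f \<in> I" "j < r"
    "depth_ge (ideal_plus I ((*) (x j) ` P)) (d - 1)"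
  shows "depth_ge I d"
  unfolding depth_ge_def
proof (intro allI impI)
  fix p assume "p < d"
  then show "koszul_vanish I p"
    using assms(4) by (intro koszul_vanish_nzd[OF assms(1-3)]) (auto simp: depth_ge_def)
qed

end

section \<open>From Koszul cochains to local cohomology\<close>

text \<open>
  The quotient module and its localisations, described by representatives: a localised element is
  \<open>frac f u k\<close>, the class of \<open>u / f\<^sup>k\<close> with \<open>u \<in> P\<close>, and equality of fractions is the relation \<open>loc_eq\<close>.
\<close>

locale quot_coord = coord_ring +
  fixes I :: "'a set"
  assumes ideal_I: "ideal_in I"
begin

definition base_ring :: "'a ring" where
  "base_ring = \<lparr>carrier = P, mult = (*), one = 1, zero = 0, add = (+)\<rparr>"

definition quot :: "('a, 'a set) module" where
  "quot = quot_module (regular_module base_ring) I"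

definition residue_class :: "'a \<Rightarrow> 'a set" where
  "residue_class u = (\<lambda>i. i + u) ` I"

lemma base_ring_simps [simp]: "carrier base_ring = P" "mult base_ring = (*)" "one base_ring =
  1" "zero base_ring = 0" "add base_ring = (+)"
  by (simp_all add: base_ring_def)

lemma cring_base_ring: "cring base_ring"
proof (rule cringI)
  show "abelian_group base_ring"
    by (rule abelian_groupI) (auto intro: bexI[of _ "- _"] simp: add_ac)
  show "comm_monoid base_ring" by (rule comm_monoidI) (auto simp: mult_ac)
qed (auto simp: algebra_simps)

interpretation cring base_ring by (rule cring_base_ring)

lemma base_ring_pow [simp]: "f [^]\<^bsub>base_ring\<^esub> (k::nat) = f ^ k"
  by (induction k) (auto simp: nat_pow_def mult.commute)

lemma base_ring_minus_one [simp]: "\<ominus>\<^bsub>base_ring\<^esub> 1 = - 1"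
  using minus_equality[of "- 1" 1] by simp

lemma residue_class_coset: "I +>\<^bsub>regular_module base_ring\<^esub> u = residue_class u"
  by (auto simp: residue_class_def a_r_coset_def r_coset_def regular_module_def)

lemma in_residue_class: "w \<in> residue_class u \<longleftrightarrow> w - u \<in> I"
  by (force simp: residue_class_def image_iff)

lemma residue_class_refl: "u \<in> residue_class u"
  by (simp add: in_residue_class ideal_zero[OF ideal_I])

lemma residue_class_eq_iff: "residue_class u = residue_class v \<longleftrightarrow> u - v \<in> I"
proof
  assume "residue_class u = residue_class v"
  then show "u - v \<in> I" using residue_class_refl[of u] by (simp add: in_residue_class)
next
  assume uv: "u - v \<in> I"
  have "w - u \<in> I \<longleftrightarrow> w - v \<in> I" for w
    using ideal_add[OF ideal_I _ uv, of "w - u"] ideal_diff[OF ideal_I _ uv, of "w - v"] by auto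
  then show "residue_class u = residue_class v" by (auto simp: in_residue_class)
qed

lemma quot_carrier: "carrier quot = residue_class ` P"
  by (auto simp: quot_def quot_module_def A_RCOSETS_def RCOSETS_def regular_module_def image_iff
      residue_class_def r_coset_def)

lemma quot_add: "residue_class u \<oplus>\<^bsub>quot\<^esub> residue_class v = residue_class (u + v)"
proof -
  have "residue_class u \<oplus>\<^bsub>quot\<^esub> residue_class v = (\<Union>h\<in>residue_class u. \<Union>k\<in>residue_class v. {h + k})"
    by (simp add: quot_def quot_module_def set_add_def set_mult_def regular_module_def)
  also have "\<dots> = residue_class (u + v)"
  proof (rule Set.set_eqI)
    fix w
    show "w \<in> (\<Union>h\<in>residue_class u. \<Union>k\<in>residue_class v. {h + k}) \<longleftrightarrow> w \<in> residue_class (u + v)"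
    proof
      assume "w \<in> (\<Union>h\<in>residue_class u. \<Union>k\<in>residue_class v. {h + k})"
      then obtain h k where "h - u \<in> I" "k - v \<in> I" "w = h + k" by (auto simp: in_residue_class)
      then show "w \<in> residue_class (u + v)"
        using ideal_add[OF ideal_I, of "h - u" "k - v"] by (simp add: in_residue_class algebra_simps)
    next
      assume "w \<in> residue_class (u + v)"
      then have "w - v \<in> residue_class u" by (simp add: in_residue_class algebra_simps)
      then show "w \<in> (\<Union>h\<in>residue_class u. \<Union>k\<in>residue_class v. {h + k})"
        using residue_class_refl[of v] by (intro UN_I) auto
    qed
  qed
  finally show ?thesis .
qed

lemma quot_smult: "s \<in> P \<Longrightarrow> s \<odot>\<^bsub>quot\<^esub> residue_class u = residue_class (s * u)"
proof -
  assume s: "s \<in> P"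
  have "s \<odot>\<^bsub>quot\<^esub> residue_class u = (\<Union>w\<in>residue_class u. residue_class (s * w))"
    by (simp add: quot_def quot_module_def flip: residue_class_coset) (simp add: regular_module_def)
  also have "\<dots> = residue_class (s * u)"
  proof -
    have "residue_class (s * w) = residue_class (s * u)" if "w \<in> residue_class u" for w
      using ideal_mult[OF ideal_I s, of "w - u"] that
      by (simp add: residue_class_eq_iff in_residue_class right_diff_distrib)
    then show ?thesis by (intro UN_constant_eq[OF residue_class_refl] ballI)
  qed
  finally show ?thesis .
qed

lemma quot_zero: "\<zero>\<^bsub>quot\<^esub> = residue_class 0"
  by (simp add: quot_def quot_module_def residue_class_def)

definition frac :: "'a \<Rightarrow> 'a \<Rightarrow> nat \<Rightarrow> ('a set \<times> nat) set" where
  "frac f u k = loc_frac base_ring quot f (residue_class u) k"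

definition loc_eq :: "'a \<Rightarrow> 'a \<Rightarrow> nat \<Rightarrow> 'a \<Rightarrow> nat \<Rightarrow> bool" where
  "loc_eq f u k v l \<longleftrightarrow> (\<exists>q. f ^ (q + l) * u - f ^ (q + k) * v \<in> I)"

lemma frac_mem:
  assumes "f \<in> P" "v \<in> P"
  shows "(residue_class v, l) \<in> frac f u k \<longleftrightarrow> loc_eq f u k v l"
  using assms by (simp add: frac_def loc_frac_def loc_eq_def quot_smult residue_class_eq_iff quot_carrier imageI)

lemma frac_memE:
  assumes "(b, l) \<in> frac f u k" "f \<in> P"
  obtains v where "v \<in> P" "b = residue_class v" "loc_eq f u k v l"
proof -
  from assms have "b \<in> carrier quot" by (simp add: frac_def loc_frac_def)
  then obtain v where "v \<in> P" "b = residue_class v" by (auto simp: quot_carrier)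
  with assms that show ?thesis by (simp add: frac_mem)
qed

lemma loc_eq_refl: "loc_eq f u k u k"
  by (simp add: loc_eq_def ideal_zero[OF ideal_I])

lemma loc_eq_sym: "loc_eq f u k v l \<Longrightarrow> loc_eq f v l u k"
  unfolding loc_eq_def using ideal_uminus[OF ideal_I] by (metis minus_diff_eq)

lemma loc_eq_trans:
  assumes "loc_eq f u k v l" "loc_eq f v l w j" "f \<in> P"
  shows "loc_eq f u k w j"
proof -
  obtain q p where q: "f ^ (q + l) * u - f ^ (q + k) * v \<in> I" and p: "f ^ (p + j) * v - f ^ (p + l) * w \<in> I"
    using assms by (auto simp: loc_eq_def)
  have "f ^ (q + p + l + j) * u - f ^ (q + p + l + k) * w =
      f ^ (p + j) * (f ^ (q + l) * u - f ^ (q + k) * v) + f ^ (q + k) * (f ^ (p + j) * v - f ^ (p + l) * w)"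
    by (simp add: power_add algebra_simps)
  also have "\<dots> \<in> I"
    by (intro ideal_add[OF ideal_I] ideal_mult[OF ideal_I] p q) (use assms in auto)
  finally show ?thesis unfolding loc_eq_def by blast
qed

lemma frac_eq_iff:
  assumes "f \<in> P" "v \<in> P"
  shows "frac f u k = frac f v l \<longleftrightarrow> loc_eq f u k v l"
proof
  assume "frac f u k = frac f v l"
  then show "loc_eq f u k v l" using frac_mem[OF assms] loc_eq_refl by metis
next
  assume uv: "loc_eq f u k v l"
  show "frac f u k = frac f v l"
  proof (rule Set.set_eqI, clarify)
    fix b j
    show "(b, j) \<in> frac f u k \<longleftrightarrow> (b, j) \<in> frac f v l"
    proof (cases "b \<in> carrier quot")
      case True
      then obtain w where "w \<in> P" "b = residue_class w" by (auto simp: quot_carrier)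
      then show ?thesis
        using loc_eq_trans[OF uv _ assms(1), of w j] loc_eq_trans[OF loc_eq_sym[OF uv] _ assms(1), of w j]
        by (auto simp: frac_mem[OF assms(1)])
    next
      case False
      then show ?thesis by (simp add: frac_def loc_frac_def)
    qed
  qed
qed

lemma frac_scale:
  assumes "f \<in> P" "u \<in> P"
  shows "frac f (f ^ N * u) (k + N) = frac f u k"
  using assms by (simp add: frac_eq_iff loc_eq_def power_add mult_ac ideal_zero[OF ideal_I])

text \<open>
  The operations on a localisation are unions over all representatives. Such a union is
  evaluated by showing that each representative gives the same value.
\<close>

lemma frac_UN:
  assumes "f \<in> P" "u \<in> P"
    and "\<And>v l. v \<in> P \<Longrightarrow> loc_eq f u k v l \<Longrightarrow> F (residue_class v) l = C"
  shows "(\<Union>(b, l)\<in>frac f u k. F b l) = C"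
proof -
  have "F b l = C" if "(b, l) \<in> frac f u k" for b l
    using that assms by (auto elim: frac_memE)
  moreover have "(residue_class u, k) \<in> frac f u k" using assms by (simp add: frac_mem loc_eq_refl)
  ultimately show ?thesis by blast
qed

abbreviation loc :: "'a \<Rightarrow> ('a, ('a set \<times> nat) set) module" where
  "loc f \<equiv> localization base_ring quot f"

lemma loc_carrier: "carrier (loc f) = {frac f u k | u k. u \<in> P}"
  by (auto simp: localization_def quot_carrier frac_def)

lemma loc_zero: "\<zero>\<^bsub>loc f\<^esub> = frac f 0 0"
  by (simp add: localization_def quot_zero frac_def)

lemma loc_add:
  assumes P: "f \<in> P" "u \<in> P" "v \<in> P"
  shows "frac f u k \<oplus>\<^bsub>loc f\<^esub> frac f v l = frac f (f ^ l * u + f ^ k * v) (k + l)"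
proof -
  let ?C = "frac f (f ^ l * u + f ^ k * v) (k + l)"
  have "frac f u k \<oplus>\<^bsub>loc f\<^esub> frac f v l = (\<Union>(a, k')\<in>frac f u k. \<Union>(b, l')\<in>frac f v l.
      loc_frac base_ring quot f ((f ^ l') \<odot>\<^bsub>quot\<^esub> a \<oplus>\<^bsub>quot\<^esub> (f ^ k') \<odot>\<^bsub>quot\<^esub> b) (k' + l'))"
    by (simp add: localization_def)
  also have "\<dots> = ?C"
  proof (rule frac_UN[OF P(1,2)], rule frac_UN[OF P(1,3)])
    fix u' k' v' l'
    assume P': "u' \<in> P" "v' \<in> P" and "loc_eq f u k u' k'" "loc_eq f v l v' l'"
    then obtain q p where q: "f ^ (q + k') * u - f ^ (q + k) * u' \<in> I"
      and p: "f ^ (p + l') * v - f ^ (p + l) * v' \<in> I" by (auto simp: loc_eq_def)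
    have "f ^ (q + p + (k + l)) * (f ^ l' * u' + f ^ k' * v') - f ^ (q + p + (k' + l')) * (f ^ l * u +
      f ^ k * v) =
       - (f ^ (p + l + l') * (f ^ (q + k') * u - f ^ (q + k) * u') +
        f ^ (q + k + k') * (f ^ (p + l') * v - f ^ (p + l) * v'))"
      by (simp add: power_add algebra_simps)
    also have "\<dots> \<in> I"
      by (intro ideal_uminus[OF ideal_I] ideal_add[OF ideal_I] ideal_mult[OF ideal_I] p q) (use P in auto)
    finally have "loc_eq f (f ^ l' * u' + f ^ k' * v') (k' + l') (f ^ l * u + f ^ k * v) (k + l)"
      unfolding loc_eq_def by blast
    then show "loc_frac base_ring quot f ((f ^ l') \<odot>\<^bsub>quot\<^esub> residue_class u' \<oplus>\<^bsub>quot\<^esub> (f ^ k') \<odot>\<^bsub>quot\<^esub> residue_class v') (k' + l') = ?C"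
      using P P' by (simp add: quot_smult quot_add frac_eq_iff flip: frac_def)
  qed
  finally show ?thesis .
qed

lemma loc_add_same:
  assumes P: "f \<in> P" "u \<in> P" "v \<in> P"
  shows "frac f u k \<oplus>\<^bsub>loc f\<^esub> frac f v k = frac f (u + v) k"
proof -
  have "frac f u k \<oplus>\<^bsub>loc f\<^esub> frac f v k = frac f (f ^ k * (u + v)) (k + k)"
    using P by (simp add: loc_add distrib_left)
  also have "\<dots> = frac f (u + v) k" using P by (intro frac_scale) auto
  finally show ?thesis .
qed

lemma loc_smult:
  assumes P: "f \<in> P" "u \<in> P" "s \<in> P"
  shows "s \<odot>\<^bsub>loc f\<^esub> frac f u k = frac f (s * u) k"
proof -
  have "s \<odot>\<^bsub>loc f\<^esub> frac f u k = (\<Union>(a, k')\<in>frac f u k. loc_frac base_ring quot f (s \<odot>\<^bsub>quot\<^esub> a) k')"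
    by (simp add: localization_def)
  also have "\<dots> = frac f (s * u) k"
  proof (rule frac_UN[OF P(1,2)])
    fix v l assume v: "v \<in> P" and uv: "loc_eq f u k v l"
    obtain q where q: "f ^ (q + k) * v - f ^ (q + l) * u \<in> I"
      using loc_eq_sym[OF uv] by (auto simp: loc_eq_def)
    have "f ^ (q + k) * (s * v) - f ^ (q + l) * (s * u) = s * (f ^ (q + k) * v - f ^ (q + l) * u)"
      by (simp add: algebra_simps)
    also have "\<dots> \<in> I" by (rule ideal_mult[OF ideal_I P(3) q])
    finally show "loc_frac base_ring quot f (s \<odot>\<^bsub>quot\<^esub> residue_class v) l = frac f (s * u) k"
      using P v by (auto simp: quot_smult frac_eq_iff loc_eq_def simp flip: frac_def)
  qed
  finally show ?thesis .
qed

lemma localization_map_frac: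
  assumes P: "f \<in> P" "g \<in> P" "u \<in> P"
  shows "localization_map base_ring quot f g (frac f u k) = frac (f * g) (g ^ k * u) k"
proof -
  have "localization_map base_ring quot f g (frac f u k) =
    (\<Union>(a, k')\<in>frac f u k. loc_frac base_ring quot (f * g) ((g ^ k') \<odot>\<^bsub>quot\<^esub> a) k')"
    by (simp add: localization_map_def)
  also have "\<dots> = frac (f * g) (g ^ k * u) k"
  proof (rule frac_UN[OF P(1,3)])
    fix v l assume v: "v \<in> P" and uv: "loc_eq f u k v l"
    obtain q where q: "f ^ (q + k) * v - f ^ (q + l) * u \<in> I"
      using loc_eq_sym[OF uv] by (auto simp: loc_eq_def)
    have "(f * g) ^ (q + k) * (g ^ l * v) - (f * g) ^ (q + l) * (g ^ k * u) =
       g ^ (q + k + l) * (f ^ (q + k) * v - f ^ (q + l) * u)"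
      by (simp add: algebra_simps power_mult_distrib power_add)
    also have "\<dots> \<in> I" by (rule ideal_mult[OF ideal_I _ q]) (use P in auto)
    finally show "loc_frac base_ring quot (f * g) ((g ^ l) \<odot>\<^bsub>quot\<^esub> residue_class v) l =
      frac (f * g) (g ^ k * u) k"
      using P v by (auto simp: quot_smult frac_eq_iff loc_eq_def simp flip: frac_def)
  qed
  finally show ?thesis .
qed

text \<open>Finite sums in a record structure are only meaningful once it is known to be a commutative monoid.\<close>

lemma loc_abelian_monoid:
  assumes f: "f \<in> P"
  shows "abelian_monoid (loc f)"
proof (rule abelian_monoidI)
  fix a b c assume "a \<in> carrier (loc f)" "b \<in> carrier (loc f)" "c \<in> carrier (loc f)"
  then obtain u k v l w j where P: "u \<in> P" "v \<in> P" "w \<in> P"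
    and eq: "a = frac f u k" "b = frac f v l" "c = frac f w j" by (auto simp: loc_carrier)
  show "a \<oplus>\<^bsub>loc f\<^esub> b \<oplus>\<^bsub>loc f\<^esub> c = a \<oplus>\<^bsub>loc f\<^esub> (b \<oplus>\<^bsub>loc f\<^esub> c)"
    using f P by (simp add: eq loc_add power_add algebra_simps)
next
  fix a b assume "a \<in> carrier (loc f)" "b \<in> carrier (loc f)"
  then obtain u k v l where P: "u \<in> P" "v \<in> P"
    and eq: "a = frac f u k" "b = frac f v l" by (auto simp: loc_carrier)
  show "a \<oplus>\<^bsub>loc f\<^esub> b \<in> carrier (loc f)"
    using f P by (auto simp: eq loc_add loc_carrier)
  show "a \<oplus>\<^bsub>loc f\<^esub> b = b \<oplus>\<^bsub>loc f\<^esub> a"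
    using f P by (simp add: eq loc_add add.commute)
next
  show "\<zero>\<^bsub>loc f\<^esub> \<in> carrier (loc f)" by (auto simp: loc_carrier loc_zero)
next
  fix a assume "a \<in> carrier (loc f)"
  then obtain u k where P: "u \<in> P" and eq: "a = frac f u k" by (auto simp: loc_carrier)
  show "\<zero>\<^bsub>loc f\<^esub> \<oplus>\<^bsub>loc f\<^esub> a = a"
    using f P by (simp add: eq loc_add loc_zero)
qed

lemma frac_zero: "f \<in> P \<Longrightarrow> frac f 0 k = frac f 0 0"
  by (simp add: frac_eq_iff loc_eq_def ideal_zero[OF ideal_I])

lemma loc_finsum:
  assumes f: "f \<in> P" and A: "finite A" and u: "\<And>i. i \<in> A \<Longrightarrow> u i \<in> P"
  shows "(\<Oplus>\<^bsub>loc f\<^esub>i\<in>A. frac f (u i) k) = frac f (\<Sum>i\<in>A. u i) k"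
  using A u
proof (induction A)
  case empty
  then show ?case using abelian_monoid.finsum_empty[OF loc_abelian_monoid[OF f]] f
    by (simp add: loc_zero frac_zero[OF f, of k])
next
  case (insert i A)
  have "(\<Oplus>\<^bsub>loc f\<^esub>i\<in>insert i A. frac f (u i) k) = frac f (u i) k \<oplus>\<^bsub>loc f\<^esub> (\<Oplus>\<^bsub>loc f\<^esub>i\<in>A. frac f (u i) k)"
    using insert by (intro abelian_monoid.finsum_insert[OF loc_abelian_monoid[OF f]]) (auto simp: loc_carrier)
  also have "\<dots> = frac f (u i) k \<oplus>\<^bsub>loc f\<^esub> frac f (\<Sum>i\<in>A. u i) k"
    using insert by simp
  also have "\<dots> = frac f (\<Sum>i\<in>insert i A. u i) k"
    using insert f by (subst loc_add_same) (auto intro: sum_P)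
  finally show ?case .
qed

end

locale cech_coord = quot_coord +
  fixes xs :: "'a list"
  assumes len_xs: "length xs = r" and nth_xs: "\<And>i. i < r \<Longrightarrow> xs ! i = x i"
begin

interpretation cring base_ring by (rule cring_base_ring)

abbreviation y :: "nat set \<Rightarrow> 'a" where
  "y A \<equiv> (\<Prod>i\<in>A. x i)"

abbreviation X :: "nat \<Rightarrow> nat set set" where
  "X \<equiv> index_sets xs"

lemma X_iff: "A \<in> X p \<longleftrightarrow> A \<subseteq> {..<r} \<and> card A = p"
  by (simp add: index_sets_def len_xs)

lemma ball_X: "(\<forall>A\<in>X p. Q A) \<longleftrightarrow> (\<forall>A\<subseteq>{..<r}. card A = p \<longrightarrow> Q A)"
  by (auto simp: X_iff)

lemma X_finite: "finite (X p)" "A \<in> X p \<Longrightarrow> finite A"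
  by (auto simp: index_sets_def intro: finite_subset)

lemma y_P: "y A \<in> P" by (auto intro: prod_P)

lemma subset_prod_y: "A \<subseteq> {..<r} \<Longrightarrow> subset_prod base_ring xs A = y A"
proof -
  assume A: "A \<subseteq> {..<r}"
  then have "finite A" using finite_subset by blast
  then show ?thesis
    using A unfolding subset_prod_def
  proof (induction A rule: finite_induct)
    case (insert i A)
    then show ?case by (simp add: nth_xs subset_iff Pi_iff)
  qed auto
qed

text \<open>The Cech cochain with entries \<open>a A / (\<Prod>i\<in>A. x i) ^ k\<close>.\<close>

definition cech_family :: "nat \<Rightarrow> nat \<Rightarrow> (nat set \<Rightarrow> 'a) \<Rightarrow> nat set \<Rightarrow> ('a set \<times> nat) set" where
  "cech_family p k a = (\<lambda>A\<in>X p. frac (y A) (a A) k)"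

lemma cech_family_cong: "(\<And>A. A \<in> X p \<Longrightarrow> a A = b A) \<Longrightarrow> cech_family p k a = cech_family p k b"
  by (auto simp: cech_family_def intro!: restrict_ext)

lemma cech_carrier_family: "(\<And>A. a A \<in> P) \<Longrightarrow> cech_family p k a \<in> carrier (cech_module base_ring xs quot p)"
  by (auto simp: cech_family_def cech_module_def Let_def X_iff subset_prod_y loc_carrier intro!: exI)

text \<open>There are finitely many entries, so they have a common exponent in the denominator.\<close>

lemma cech_carrierE:
  assumes "c \<in> carrier (cech_module base_ring xs quot p)"
  obtains k a where "\<And>A. a A \<in> P" "c = cech_family p k a"
proof -
  have "\<exists>u k. u \<in> P \<and> (A \<in> X p \<longrightarrow> c A = frac (y A) u k)" for A
  proof (cases "A \<in> X p")
    case True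
    then have "c A \<in> carrier (loc (y A))"
      using assms by (auto simp: cech_module_def Let_def X_iff subset_prod_y PiE_iff)
    then show ?thesis by (auto simp: loc_carrier)
  qed auto
  then obtain u k where u: "\<And>A. u A \<in> P" and c: "\<And>A. A \<in> X p \<Longrightarrow> c A = frac (y A) (u A) (k A)"
    by metis
  define K where "K = Max (insert 0 (k ` X p))"
  have K: "k A \<le> K" if "A \<in> X p" for A
    unfolding K_def using that X_finite by (intro Max_ge) auto
  let ?a = "\<lambda>A. y A ^ (K - k A) * u A"
  have "c = cech_family p K ?a"
  proof (rule ext)
    fix A
    show "c A = cech_family p K ?a A"
    proof (cases "A \<in> X p")
      case True
      then have "k A + (K - k A) = K" using K by auto
      with frac_scale[OF y_P u, of A "K - k A" A "k A"] True c show ?thesis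
        by (simp add: cech_family_def)
    next
      case False
      then show ?thesis using assms by
        (auto simp: cech_family_def cech_module_def Let_def PiE_iff extensional_def)
    qed
  qed
  moreover have "?a A \<in> P" for A using y_P u by auto
  ultimately show ?thesis by (intro that)
qed

lemma cech_family_ktrans:
  assumes "\<And>A. a A \<in> P"
  shows "cech_family p (k + N) (ktrans x N a) = cech_family p k a"
  using frac_scale[OF y_P assms] by (simp add: cech_family_def ktrans_def restrict_def fun_eq_iff)

text \<open>
  The restriction of \<open>u / (\<Prod>j\<in>A-{i}. x j) ^ k\<close> to \<open>A\<close> has numerator \<open>x\<^sub>i\<^sup>k u\<close>; so the Cech differential
  is the Koszul differential for the powers \<open>x\<^sub>i\<^sup>k\<close>.
\<close>

lemma cech_diff_family:
  assumes a: "\<And>A. a A \<in> P"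
  shows "cech_diff base_ring xs quot p (cech_family p k a) = cech_family (Suc p) k (kdiff x k a)"
proof (rule ext)
  fix A
  show "cech_diff base_ring xs quot p (cech_family p k a) A = cech_family (Suc p) k (kdiff x k a) A"
  proof (cases "A \<in> X (Suc p)")
    case True
    then have A: "A \<subseteq> {..<r}" "card A = Suc p" and fA: "finite A" using X_finite by (auto simp: X_iff)
    have summand: "((\<ominus>\<^bsub>base_ring\<^esub> \<one>\<^bsub>base_ring\<^esub>) [^]\<^bsub>base_ring\<^esub> card {j \<in> A. j < i}) \<odot>\<^bsub>loc (y A)\<^esub>
       localization_map base_ring quot (subset_prod base_ring xs (A - {i})) (xs ! i) (cech_family p k a (A - {i})) =
       frac (y A) (ksign i A * x i ^ k * a (A - {i})) k" if i: "i \<in> A" for i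
    proof -
      have Ai: "A - {i} \<in> X p" "A - {i} \<subseteq> {..<r}" using card_remove[OF A i] by (auto simp: X_iff)
      have yA: "y (A - {i}) * x i = y A" using prod.remove[OF fA i, of x] by (simp add: mult.commute)
      have "localization_map base_ring quot (subset_prod base_ring xs (A -
        {i})) (xs ! i) (cech_family p k a (A - {i})) =
        frac (y A) (x i ^ k * a (A - {i})) k"
        using Ai i A nth_xs[of i] localization_map_frac[OF y_P x_P a, of "A - {i}" i] yA
        by (auto simp: subset_prod_y cech_family_def subset_iff)
      then show ?thesis
        using loc_smult[OF y_P, of "x i ^ k * a (A - {i})" "ksign i A" A k] a
        by (simp add: ksign_def mult.assoc)
    qed
    have "cech_diff base_ring xs quot p (cech_family p k a) A =
      (\<Oplus>\<^bsub>loc (y A)\<^esub>i\<in>A. frac (y A) (ksign i A * x i ^ k * a (A - {i})) k)"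
      using True A unfolding cech_diff_def Let_def restrict_apply
      apply (simp only: if_True subset_prod_y)
      apply (rule abelian_monoid.finsum_cong'[OF loc_abelian_monoid[OF y_P]])
      using summand a by (auto simp: loc_carrier subset_prod_y)
    also have "\<dots> = frac (y A) (kdiff x k a A) k"
      unfolding kdiff_def using fA a by (intro loc_finsum y_P) auto
    finally show ?thesis using True by (simp add: cech_family_def)
  next
    case False
    then show ?thesis by (simp add: cech_diff_def cech_family_def)
  qed
qed

lemma cech_zero: "\<zero>\<^bsub>cech_module base_ring xs quot p\<^esub> = cech_family p k (\<lambda>_. 0)"
  by (auto simp: cech_module_def Let_def cech_family_def X_iff subset_prod_y loc_zero frac_zero[OF y_P, of _ k] restrict_def fun_eq_iff)

lemma cech_add:
  assumes "\<And>A. a A \<in> P" "\<And>A. b A \<in> P"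
  shows "cech_family p k a \<oplus>\<^bsub>cech_module base_ring xs quot p\<^esub> cech_family p k b = cech_family p k (\<lambda>A. a A +
    b A)"
  using assms by (auto simp: cech_module_def Let_def cech_family_def X_iff subset_prod_y loc_add_same[OF y_P] restrict_def fun_eq_iff)

lemma cech_family_eq_iff:
  assumes "\<And>A. b A \<in> P"
  shows "cech_family p k a = cech_family p k b \<longleftrightarrow> (\<exists>q. \<forall>A\<subseteq>{..<r}. card A = p \<longrightarrow> ktrans x q a A - ktrans x q b A \<in>
    I)"
proof -
  have "cech_family p k a = cech_family p k b \<longleftrightarrow> (\<forall>A\<in>X p. loc_eq (y A) (a A) k (b A) k)"
    using frac_eq_iff[OF y_P assms] by (auto simp: cech_family_def restrict_def fun_eq_iff)
  also have "\<dots> \<longleftrightarrow> (\<forall>A\<in>X p. \<exists>q. y A ^ (q + k) * a A - y A ^ (q + k) * b A \<in> I)"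
    by (simp add: loc_eq_def)
  also have "\<dots> \<longleftrightarrow> (\<exists>q. \<forall>A\<in>X p. ktrans x q a A - ktrans x q b A \<in> I)"
  proof
    assume "\<forall>A\<in>X p. \<exists>q. y A ^ (q + k) * a A - y A ^ (q + k) * b A \<in> I"
    then obtain q where q: "\<And>A. A \<in> X p \<Longrightarrow> y A ^ (q A + k) * a A - y A ^ (q A + k) * b A \<in> I" by metis
    define Q where "Q = Max (insert 0 (q ` X p))"
    have "ktrans x (Q + k) a A - ktrans x (Q + k) b A \<in> I" if A: "A \<in> X p" for A
    proof -
      have "q A \<le> Q" unfolding Q_def using that X_finite by (intro Max_ge) auto
      then have "y A ^ (Q + k) = y A ^ (Q - q A) * y A ^ (q A + k)"
        by (simp flip: power_add)
      then have "ktrans x (Q + k) a A - ktrans x (Q + k) b A =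
          y A ^ (Q - q A) * (y A ^ (q A + k) * a A - y A ^ (q A + k) * b A)"
        by (simp add: ktrans_def algebra_simps)
      then show ?thesis using ideal_mult[OF ideal_I power_P[OF y_P] q[OF A]] by simp
    qed
    then show "\<exists>q. \<forall>A\<in>X p. ktrans x q a A - ktrans x q b A \<in> I" by blast
  next
    assume "\<exists>q. \<forall>A\<in>X p. ktrans x q a A - ktrans x q b A \<in> I"
    then obtain q where q: "\<And>A. A \<in> X p \<Longrightarrow> ktrans x q a A - ktrans x q b A \<in> I" by blast
    have "y A ^ (q + k) * a A - y A ^ (q + k) * b A = y A ^ k * (ktrans x q a A - ktrans x q b A)" for A
      by (simp add: ktrans_def algebra_simps power_add)
    then show "\<forall>A\<in>X p. \<exists>q. y A ^ (q + k) * a A - y A ^ (q + k) * b A \<in> I"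
      using ideal_mult[OF ideal_I power_P[OF y_P] q] by metis
  qed
  finally show ?thesis unfolding ball_X .
qed

text \<open>
  That the Cech differential of a family is zero means only that some transition map kills it. After
  applying this map the family is a Koszul cocycle on the nose.
\<close>

lemma cocycle_is_coboundary:
  assumes v: "koszul_vanish I p" and c: "c \<in> cech_cocycles base_ring xs quot p"
  shows "\<exists>k b. (\<forall>A. b A \<in> P) \<and> c = cech_family p k (kdiff x k b)"
proof -
  have "c \<in> carrier (cech_module base_ring xs quot p)" using c by (simp add: cech_cocycles_def)
  then obtain k a where a: "\<And>A. a A \<in> P" and ca: "c = cech_family p k a"
    by (rule cech_carrierE) (rule that)
  have "cech_family (Suc p) k (kdiff x k a) = cech_family (Suc p) k (\<lambda>_. 0)"
    using c cech_diff_family[OF a] by (simp add: cech_cocycles_def ca cech_zero[of _ k])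
  then obtain q where q: "\<And>A. A \<subseteq> {..<r} \<Longrightarrow> card A = Suc p \<Longrightarrow> ktrans x q (kdiff x k a) A \<in> I"
    by (subst (asm) cech_family_eq_iff) (auto simp: ktrans_def)
  have coc: "kdiff x (k + q) (ktrans x q a) A \<in> I" if "A \<subseteq> {..<r}" "card A = Suc p" for A
  proof -
    have "finite A" using that finite_subset by blast
    then show ?thesis using q[OF that] by (simp add: kdiff_trans)
  qed
  obtain N b where b: "\<And>A. b A \<in> P"
    and e: "\<And>A. A \<subseteq> {..<r} \<Longrightarrow> card A = p \<Longrightarrow> ktrans x N (ktrans x q a) A - kdiff x (k + q + N) b A \<in> I"
    by (rule koszul_vanishE[OF v ktrans_P[OF a]], erule (1) coc, rule that, assumption+)
  have "cech_family p (k + q + N) (ktrans x N (ktrans x q a)) = cech_family p (k + q + N) (kdiff x (k + q +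
    N) b)"
    by (subst cech_family_eq_iff) (use b e in \<open>auto intro!: kdiff_P exI[of _ 0] simp: ktrans_def\<close>)
  then have "c = cech_family p (k + q + N) (kdiff x (k + q + N) b)"
    using a by (simp add: ca cech_family_ktrans ktrans_P)
  then show ?thesis using b by blast
qed

text \<open>In degree zero the right-hand side describes the zero cochain, as the Koszul differential is an empty sum there.\<close>

lemma coboundary_iff:
  "n \<in> cech_coboundaries base_ring xs quot p \<longleftrightarrow> (\<exists>k b. (\<forall>A. b A \<in> P) \<and> n = cech_family p k (kdiff x k b))"
proof (cases p)
  case 0
  have "cech_family 0 k (kdiff x k b) = cech_family 0 0 (\<lambda>_. 0)" for k b
  proof -
    have e: "A = {}" if "A \<in> X 0" for A using X_finite(2)[OF that] that by (auto simp: X_iff)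
    have "cech_family 0 k (kdiff x k b) = cech_family 0 k (\<lambda>_. 0)"
      by (intro cech_family_cong) (auto simp: kdiff_def dest!: e)
    then show ?thesis using cech_zero[of 0] by metis
  qed
  then show ?thesis using 0 cech_zero[of 0 0]
    by (auto simp: cech_coboundaries_def intro!: exI[of _ "\<lambda>_. 0"])
next
  case (Suc q)
  have "n \<in> cech_coboundaries base_ring xs quot p \<longleftrightarrow> (\<exists>c \<in> carrier (cech_module base_ring xs quot q). n =
    cech_diff base_ring xs quot q c)"
    using Suc by (auto simp: cech_coboundaries_def)
  also have "\<dots> \<longleftrightarrow> (\<exists>k b. (\<forall>A. b A \<in> P) \<and> n = cech_family p k (kdiff x k b))"
  proof
    assume "\<exists>c \<in> carrier (cech_module base_ring xs quot q). n = cech_diff base_ring xs quot q c"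
    then obtain c where c: "c \<in> carrier (cech_module base_ring xs quot q)" "n =
      cech_diff base_ring xs quot q c" by blast
    obtain k b where "\<And>A. b A \<in> P" "c = cech_family q k b"
      by (rule cech_carrierE[OF c(1)]) (rule that)
    then show "\<exists>k b. (\<forall>A. b A \<in> P) \<and> n = cech_family p k (kdiff x k b)"
      using c Suc by (auto simp: cech_diff_family)
  next
    assume "\<exists>k b. (\<forall>A. b A \<in> P) \<and> n = cech_family p k (kdiff x k b)"
    then obtain k b where b: "\<And>A. b A \<in> P" "n = cech_family p k (kdiff x k b)" by blast
    show "\<exists>c \<in> carrier (cech_module base_ring xs quot q). n = cech_diff base_ring xs quot q c"
      using Suc b(2) by (intro bexI[OF _ cech_carrier_family[OF b(1)]]) (simp add: cech_diff_family[OF b(1)])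
  qed
  finally show ?thesis .
qed

lemma coboundary_shift:
  assumes b: "\<And>A. b A \<in> P" and b': "\<And>A. b' A \<in> P"
  shows "\<exists>j d. (\<forall>A. d A \<in> P) \<and>
    cech_family p k (kdiff x k b) \<oplus>\<^bsub>cech_module base_ring xs quot p\<^esub> cech_family p l (kdiff x l b') = cech_family p j (kdiff x j d)"
proof -
  have lift: "cech_family p k (kdiff x k b) = cech_family p (k + N) (kdiff x (k + N) (ktrans x N b))"
    if "\<And>A. b A \<in> P" for k N b
  proof -
    have "cech_family p (k + N) (kdiff x (k + N) (ktrans x N b)) = cech_family p (k +
      N) (ktrans x N (kdiff x k b))"
      by (intro cech_family_cong kdiff_trans X_finite(2))
    then show ?thesis using cech_family_ktrans[OF kdiff_P[OF that]] by simp
  qed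
  let ?u = "ktrans x l b" and ?w = "ktrans x k b'"
  have "cech_family p k (kdiff x k b) = cech_family p (k + l) (kdiff x (k + l) ?u)" by (rule lift[OF b])
  moreover have "cech_family p l (kdiff x l b') = cech_family p (k + l) (kdiff x (k + l) ?w)"
    using lift[OF b', where k=l and N=k] by (simp add: add.commute)
  moreover have "cech_family p (k + l) (kdiff x (k +
    l) ?u) \<oplus>\<^bsub>cech_module base_ring xs quot p\<^esub> cech_family p (k + l) (kdiff x (k + l) ?w)
      = cech_family p (k + l) (kdiff x (k + l) (\<lambda>A. ?u A + ?w A))"
    using b b' by (subst cech_add) (auto intro: kdiff_P ktrans_P simp: cech_family_def kdiff_add)
  ultimately show ?thesis using b b' by (intro exI conjI) (auto intro: ktrans_P)
qed

lemma cech_family_uminus_cancel: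
  assumes a: "\<And>A. a A \<in> P" and b: "\<And>A. b A \<in> P"
  shows "(cech_family p k a \<oplus>\<^bsub>cech_module base_ring xs quot p\<^esub> cech_family p l (\<lambda>A. -
    b A)) \<oplus>\<^bsub>cech_module base_ring xs quot p\<^esub> cech_family p l b = cech_family p k a"
proof -
  have 1: "cech_family p k a = cech_family p (k + l) (ktrans x l a)" using a by (simp add: cech_family_ktrans)
  have 2: "cech_family p l c = cech_family p (k + l) (ktrans x k c)" if "\<And>A. c A \<in> P" for c
    using cech_family_ktrans[OF that, of p l k] by (simp add: add.commute)
  have 3: "cech_family p l (\<lambda>A. - b A) = cech_family p (k + l) (ktrans x k (\<lambda>A. - b A))" using b
    by (intro 2) auto
  show ?thesis unfolding 1 3 2[OF b]
    using a b by (simp add: cech_add ktrans_P) (simp add: ktrans_def[abs_def])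
qed

text \<open>All cocycles are coboundaries, so the only coset is the set of coboundaries.\<close>

theorem local_cohomology_trivial:
  assumes v: "koszul_vanish I p"
  shows "carrier (local_cohomology base_ring xs quot p) = {\<zero>\<^bsub>local_cohomology base_ring xs quot p\<^esub>}"
proof -
  let ?M = "(cech_module base_ring xs quot p)\<lparr>carrier := cech_cocycles base_ring xs quot p\<rparr>"
  let ?N = "cech_coboundaries base_ring xs quot p"
  have shift: "?N +>\<^bsub>?M\<^esub> c = ?N" if c: "c \<in> cech_cocycles base_ring xs quot p" for c
  proof -
    obtain k b where b: "\<And>A. b A \<in> P" and cb: "c = cech_family p k (kdiff x k b)"
      using cocycle_is_coboundary[OF v c] by blast
    have "?N +>\<^bsub>?M\<^esub> c = (\<lambda>n. n \<oplus>\<^bsub>cech_module base_ring xs quot p\<^esub> c) ` ?N"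
      by (auto simp: a_r_coset_def r_coset_def)
    also have "\<dots> = ?N"
    proof (intro Set.set_eqI iffI)
      fix n assume "n \<in> (\<lambda>n. n \<oplus>\<^bsub>cech_module base_ring xs quot p\<^esub> c) ` ?N"
      then show "n \<in> ?N" using coboundary_shift b by (auto simp: coboundary_iff cb)
    next
      fix n assume "n \<in> ?N"
      then obtain l d where d: "\<And>A. d A \<in> P" and n: "n = cech_family p l (kdiff x l d)" by
        (auto simp: coboundary_iff)
      \<comment> \<open>The negative of \<open>c\<close>, again a coboundary.\<close>
      let ?e = "cech_family p k (kdiff x k (\<lambda>A. - b A))"
      have neg: "kdiff x k (\<lambda>A. - b A) = (\<lambda>A. - kdiff x k b A)" by (auto simp: kdiff_def sum_negf)
      have "n = (n \<oplus>\<^bsub>cech_module base_ring xs quot p\<^esub> ?e) \<oplus>\<^bsub>cech_module base_ring xs quot p\<^esub> c"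
        unfolding n cb neg using cech_family_uminus_cancel[OF kdiff_P[OF d] kdiff_P[OF b]] by simp
      moreover have "n \<oplus>\<^bsub>cech_module base_ring xs quot p\<^esub> ?e \<in> ?N"
        unfolding n coboundary_iff by (rule coboundary_shift) (use b d in auto)
      ultimately show "n \<in> (\<lambda>n. n \<oplus>\<^bsub>cech_module base_ring xs quot p\<^esub> c) ` ?N" by blast
    qed
    finally show ?thesis .
  qed
  have "\<zero>\<^bsub>cech_module base_ring xs quot p\<^esub> \<in> cech_cocycles base_ring xs quot p"
    using cech_carrier_family[of "\<lambda>_. 0" p 0] cech_diff_family[of "\<lambda>_. 0" p 0]
    by (simp add: cech_cocycles_def cech_zero[of _ 0] kdiff_def[abs_def])
  moreover have "carrier (local_cohomology base_ring xs quot p) =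
    (\<lambda>c. ?N +>\<^bsub>?M\<^esub> c) ` cech_cocycles base_ring xs quot p"
    by (auto simp: local_cohomology_def quot_module_def A_RCOSETS_def RCOSETS_def a_r_coset_def)
  moreover have "\<zero>\<^bsub>local_cohomology base_ring xs quot p\<^esub> = ?N"
    by (simp add: local_cohomology_def quot_module_def)
  ultimately show ?thesis using shift by force
qed

theorem depth_ge_imp_depth:
  assumes "depth_ge I d"
  shows "enat d \<le> depth base_ring xs quot"
  unfolding depth_def
proof (rule Inf_greatest, clarify)
  fix p assume "carrier (local_cohomology base_ring xs quot p) \<noteq> {\<zero>\<^bsub>local_cohomology base_ring xs quot p\<^esub>}"
  with assms local_cohomology_trivial[of p] have "\<not> p < d" by (auto simp: depth_ge_def)
  then show "enat d \<le> enat p" by simp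
qed

end

section \<open>Generated ideals and partial evaluation at zero\<close>

context coord_ring begin

text \<open>
  The ideal of \<open>P\<close> generated by \<open>X\<close>. The inductive form provides an induction over the summands of a
  linear combination.
\<close>

inductive_set ideal_gen :: "'a set \<Rightarrow> 'a set" for X where
  ideal_gen_zero: "0 \<in> ideal_gen X"
| ideal_gen_step: "p \<in> P \<Longrightarrow> g \<in> X \<Longrightarrow> f \<in> ideal_gen X \<Longrightarrow> p * g + f \<in> ideal_gen X"

lemma ideal_gen_sub_P: "f \<in> ideal_gen X \<Longrightarrow> X \<subseteq> P \<Longrightarrow> f \<in> P"
  by (induction rule: ideal_gen.induct) auto

lemma ideal_gen_base: "g \<in> X \<Longrightarrow> g \<in> ideal_gen X"
  using ideal_gen_step[OF one_P _ ideal_gen_zero] by simp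

lemma ideal_gen_add: "f \<in> ideal_gen X \<Longrightarrow> g \<in> ideal_gen X \<Longrightarrow> f + g \<in> ideal_gen X"
  by (induction rule: ideal_gen.induct) (auto simp: add.assoc intro: ideal_gen_step)

lemma ideal_gen_mult: "f \<in> ideal_gen X \<Longrightarrow> q \<in> P \<Longrightarrow> q * f \<in> ideal_gen X"
proof (induction rule: ideal_gen.induct)
  case (ideal_gen_step p g f)
  then have "q * p * g + q * f \<in> ideal_gen X" by (intro ideal_gen.ideal_gen_step) auto
  then show ?case by (simp add: algebra_simps)
qed (simp add: ideal_gen.ideal_gen_zero)

lemma ideal_gen_ideal: "X \<subseteq> P \<Longrightarrow> ideal_in (ideal_gen X)"
  by (auto simp: ideal_in_def ideal_gen_zero ideal_gen_add ideal_gen_mult ideal_gen_sub_P)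

lemma ideal_gen_least:
  assumes "ideal_in J" "X \<subseteq> J"
  shows "ideal_gen X \<subseteq> J"
proof
  fix f assume "f \<in> ideal_gen X"
  then show "f \<in> J"
  proof (induction rule: ideal_gen.induct)
    case ideal_gen_zero
    then show ?case by (rule ideal_zero[OF assms(1)])
  next
    case (ideal_gen_step p g f)
    then show ?case using assms by (auto intro!: ideal_add[OF assms(1)] ideal_mult[OF assms(1)])
  qed
qed

lemma ideal_gen_subset: "Y \<subseteq> P \<Longrightarrow> X \<subseteq> ideal_gen Y \<Longrightarrow> ideal_gen X \<subseteq> ideal_gen Y"
  by (rule ideal_gen_least[OF ideal_gen_ideal])

lemma ideal_gen_mono: "X \<subseteq> Y \<Longrightarrow> Y \<subseteq> P \<Longrightarrow> ideal_gen X \<subseteq> ideal_gen Y"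
  using ideal_gen_base by (intro ideal_gen_subset) auto

lemma ideal_gen_eqI: "X \<subseteq> P \<Longrightarrow> Y \<subseteq> P \<Longrightarrow> X \<subseteq> ideal_gen Y \<Longrightarrow> Y \<subseteq> ideal_gen X \<Longrightarrow> ideal_gen X = ideal_gen Y"
  by (intro equalityI ideal_gen_subset)

lemma ideal_plus_ideal: "ideal_in I \<Longrightarrow> ideal_in J \<Longrightarrow> ideal_in (ideal_plus I J)"
  unfolding ideal_in_def ideal_plus_def
proof (intro conjI ballI)
  assume I: "I \<subseteq> P \<and> 0 \<in> I \<and> (\<forall>a\<in>I. \<forall>b\<in>I. a + b \<in> I) \<and> (\<forall>p\<in>P. \<forall>a\<in>I. p * a \<in> I)"
    and J: "J \<subseteq> P \<and> 0 \<in> J \<and> (\<forall>a\<in>J. \<forall>b\<in>J. a + b \<in> J) \<and> (\<forall>p\<in>P. \<forall>a\<in>J. p * a \<in> J)"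
  show "{a + b |a b. a \<in> I \<and> b \<in> J} \<subseteq> P" using I J by auto
  show "0 \<in> {a + b |a b. a \<in> I \<and> b \<in> J}" using I J by (intro CollectI exI[of _ 0]) auto
  fix u assume "u \<in> {a + b |a b. a \<in> I \<and> b \<in> J}"
  then obtain a b where ab: "a \<in> I" "b \<in> J" "u = a + b" by blast
  {
    fix w assume "w \<in> {a + b |a b. a \<in> I \<and> b \<in> J}"
    then obtain c d where cd: "c \<in> I" "d \<in> J" "w = c + d" by blast
    show "u + w \<in> {a + b |a b. a \<in> I \<and> b \<in> J}"
      using I J ab cd by (intro CollectI exI[of _ "a + c"] exI[of _ "b + d"]) (auto simp: algebra_simps)
  }
  fix p assume "p \<in> P"
  then show "p * u \<in> {a + b |a b. a \<in> I \<and> b \<in> J}"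
    using I J ab by (intro CollectI exI[of _ "p * a"] exI[of _ "p * b"]) (auto simp: algebra_simps)
qed

text \<open>Only generating sets are compared from here on; sums of ideals become unions of generators.\<close>

lemma ideal_gen_plus:
  assumes "X \<subseteq> P" "Y \<subseteq> P"
  shows "ideal_plus (ideal_gen X) (ideal_gen Y) = ideal_gen (X \<union> Y)"
proof
  have XY: "X \<union> Y \<subseteq> P" using assms by auto
  show "ideal_plus (ideal_gen X) (ideal_gen Y) \<subseteq> ideal_gen (X \<union> Y)"
    using ideal_gen_mono[OF _ XY, of X] ideal_gen_mono[OF _ XY, of Y]
    by (auto simp: ideal_plus_def intro!: ideal_gen_add)
  have "X \<subseteq> ideal_plus (ideal_gen X) (ideal_gen Y)"
    unfolding ideal_plus_def by (force intro: ideal_gen_base ideal_gen_zero)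
  moreover have "Y \<subseteq> ideal_plus (ideal_gen X) (ideal_gen Y)"
    unfolding ideal_plus_def by (force intro: ideal_gen_base ideal_gen_zero)
  ultimately show "ideal_gen (X \<union> Y) \<subseteq> ideal_plus (ideal_gen X) (ideal_gen Y)"
    using assms by (intro ideal_gen_least ideal_plus_ideal ideal_gen_ideal) auto
qed

lemma ideal_gen_singleton: "ideal_gen {y} = (*) y ` P"
proof
  show "ideal_gen {y} \<subseteq> (*) y ` P"
  proof
    fix f assume "f \<in> ideal_gen {y}"
    then show "f \<in> (*) y ` P"
    proof (induction rule: ideal_gen.induct)
      case ideal_gen_zero
      then show ?case by (intro image_eqI[of _ _ 0]) auto
    next
      case (ideal_gen_step p g f)
      then obtain q where "q \<in> P" "f = y * q" by auto
      then show ?case using ideal_gen_step by (intro image_eqI[of _ _ "p + q"]) (auto simp: algebra_simps)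
    qed
  qed
  show "(*) y ` P \<subseteq> ideal_gen {y}"
    using ideal_gen_step[OF _ _ ideal_gen_zero, of _ y "{y}"] by (auto simp: mult.commute)
qed

lemma depth_ge_ideal_gen_nzd:
  assumes "X \<subseteq> P" "\<And>f. f \<in> P \<Longrightarrow> x j * f \<in> ideal_gen X \<Longrightarrow> f \<in> ideal_gen X" "j < r"
    "depth_ge (ideal_gen (insert (x j) X)) (d - 1)"
  shows "depth_ge (ideal_gen X) d"
proof (rule depth_ge_nzd[OF ideal_gen_ideal[OF assms(1)] assms(2,3)])
  show "depth_ge (ideal_plus (ideal_gen X) ((*) (x j) ` P)) (d - 1)"
    using assms(1,4) ideal_gen_plus[of X "{x j}"] by (simp add: ideal_gen_singleton flip: insert_is_Un)
qed

end

context quot_coord begin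

lemma ideal_in_imp_ideal:
  assumes "ideal_in J"
  shows "ideal J base_ring"
proof (rule idealI)
  show "ring base_ring" using cring_base_ring by (rule cring.axioms)
  have inv: "inv\<^bsub>add_monoid base_ring\<^esub> a = - a" if "a \<in> P" for a
    using abelian_group.minus_equality[OF ring.is_abelian_group[OF \<open>ring base_ring\<close>], of "- a" a] that
    by (simp add: a_inv_def)
  show "subgroup J (add_monoid base_ring)"
    using assms by unfold_locales
      (auto simp: inv[simplified] ideal_P intro: ideal_add ideal_zero ideal_uminus)
next
  fix a x assume "a \<in> J" "x \<in> carrier base_ring"
  then have "x * a \<in> J" using ideal_mult[OF assms] by simp
  then show "x \<otimes>\<^bsub>base_ring\<^esub> a \<in> J" "a \<otimes>\<^bsub>base_ring\<^esub> x \<in> J" by (simp_all add: mult.commute)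
qed

lemma ideal_imp_ideal_in:
  assumes "ideal J base_ring"
  shows "ideal_in J"
proof -
  interpret J: ideal J base_ring by fact
  show ?thesis
    unfolding ideal_in_def
    using J.a_subset additive_subgroup.zero_closed[OF J.additive_subgroup_axioms]
      additive_subgroup.a_closed[OF J.additive_subgroup_axioms] J.I_l_closed by simp
qed

lemma genideal_ideal_gen:
  assumes "X \<subseteq> P"
  shows "Idl\<^bsub>base_ring\<^esub> X = ideal_gen X"
proof
  show "Idl\<^bsub>base_ring\<^esub> X \<subseteq> ideal_gen X"
    unfolding genideal_def using ideal_in_imp_ideal[OF ideal_gen_ideal[OF assms]] ideal_gen_base by blast
  show "ideal_gen X \<subseteq> Idl\<^bsub>base_ring\<^esub> X"
    unfolding genideal_def using ideal_gen_least[OF ideal_imp_ideal_in] by blast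
qed

end

lemma poly_mapping_sum_singles: "f =
  (\<Sum>t\<in>Poly_Mapping.keys f. Poly_Mapping.single t (Poly_Mapping.lookup f t))"
proof (rule poly_mapping_eqI)
  fix s
  have "Poly_Mapping.lookup (\<Sum>t\<in>Poly_Mapping.keys f. Poly_Mapping.single t (Poly_Mapping.lookup f t)) s =
      (\<Sum>t\<in>Poly_Mapping.keys f. if t = s then Poly_Mapping.lookup f s else 0)"
    unfolding lookup_sum by (rule sum.cong) (auto simp: lookup_single)
  then show "Poly_Mapping.lookup f s =
    Poly_Mapping.lookup (\<Sum>t\<in>Poly_Mapping.keys f. Poly_Mapping.single t (Poly_Mapping.lookup f t)) s"
    by (simp add: in_keys_iff)
qed

lemma keys_plus_nat: "Poly_Mapping.keys (s + t) = Poly_Mapping.keys s \<union> Poly_Mapping.keys (t :: 'b \<Rightarrow>\<^sub>0 nat)"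
  by (auto simp: in_keys_iff lookup_add)

lemma keys_split_single:
  assumes "q \<in> Poly_Mapping.keys (t :: 'b \<Rightarrow>\<^sub>0 nat)"
  obtains t' where "t = Poly_Mapping.single q 1 + t'"
proof
  show "t = Poly_Mapping.single q 1 + (t - Poly_Mapping.single q 1)"
    using assms by (intro poly_mapping_eqI)
      (auto simp: lookup_add lookup_minus lookup_single when_def in_keys_iff)
qed

definition var_exp :: "nat \<Rightarrow> nat \<Rightarrow> (nat \<times> nat) \<Rightarrow>\<^sub>0 nat" where
  "var_exp i j = Poly_Mapping.single (i, j) 1"

lemma Xvar_single: "Xvar i j = Poly_Mapping.single (var_exp i j) 1"
  by (simp add: Xvar_def var_exp_def)

lemma keys_var_exp [simp]: "Poly_Mapping.keys (var_exp i j) = {(i, j)}"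
  by (simp add: var_exp_def)

definition minor :: "nat \<Rightarrow> nat \<Rightarrow> nat \<Rightarrow> nat \<Rightarrow> 'k::field mpoly2" where
  "minor i j k l = Xvar i k * Xvar j l - Xvar i l * Xvar j k"

text \<open>The ring endomorphism that sets the variables with index in \<open>Z\<close> to zero and fixes the others.\<close>

definition kill :: "(nat \<times> nat) set \<Rightarrow> 'k::field mpoly2 \<Rightarrow> 'k mpoly2" where
  "kill Z f = (\<Sum>t\<in>Poly_Mapping.keys f. if Poly_Mapping.keys t \<inter> Z =
    {} then Poly_Mapping.single t (Poly_Mapping.lookup f t) else 0)"

lemma kill_add: "kill Z (f + g) = kill Z f + kill Z g"
  unfolding kill_def by (rule setsum_keys_plus_distrib) (auto simp: single_add)

lemma kill_single: "kill Z (Poly_Mapping.single t c) = (if Poly_Mapping.keys t \<inter> Z =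
  {} then Poly_Mapping.single t c else 0)"
  by (simp add: kill_def)

lemma kill_zero [simp]: "kill Z 0 = 0"
  by (simp add: kill_def)

lemma kill_diff: "kill Z (f - g) = kill Z f - kill Z g"
  using kill_add[of Z "f - g" g] by simp

lemma kill_Xvar: "kill Z (Xvar i j) = (if (i, j) \<in> Z then 0 else Xvar i j)"
  by (simp add: Xvar_single kill_single)

lemma mpoly_induct [case_names single add]:
  fixes f :: "'b \<Rightarrow>\<^sub>0 'c::comm_monoid_add"
  assumes "\<And>t c. Q (Poly_Mapping.single t c)" "\<And>f g. Q f \<Longrightarrow> Q g \<Longrightarrow> Q (f + g)"
  shows "Q f"
proof -
  have "Q (\<Sum>t\<in>A. Poly_Mapping.single t (Poly_Mapping.lookup f t))" for A
    using assms(1)[of undefined 0] by (induction A rule: infinite_finite_induct) (auto intro: assms)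
  then show ?thesis by (subst poly_mapping_sum_singles)
qed

lemma kill_mult: "kill Z (f * g) = kill Z f * kill Z g"
proof (induction f rule: mpoly_induct)
  case (single t c)
  show ?case
  proof (induction g rule: mpoly_induct)
    case (single s d)
    then show ?case by (auto simp: mult_single kill_single keys_plus_nat)
  next
    case (add f g)
    then show ?case by (simp add: distrib_left kill_add)
  qed
next
  case (add f g)
  then show ?case by (simp add: distrib_right kill_add)
qed

lemma kill_kill: "kill Z (kill Z f) = kill Z f"
  by (induction f rule: mpoly_induct) (auto simp: kill_single kill_add)

lemma kill_minor:
  "kill Z (minor i j k l) = (if (i,k) \<in> Z \<or> (j,l) \<in> Z then 0 else Xvar i k * Xvar j l) -
     (if (i,l) \<in> Z \<or> (j,k) \<in> Z then 0 else Xvar i l * Xvar j k)"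
  by (simp add: minor_def kill_diff kill_mult kill_Xvar)

text \<open>Naming the carrier fixes the coefficient field for the whole locale.\<close>

locale poly_mat =
  fixes m n :: nat and P :: "'k::field mpoly2 set"
  assumes P_eq: "P = carrier (poly_ring m n)"
begin

definition coord :: "nat \<Rightarrow> 'k mpoly2" where
  "coord i = (if i < length (poly_vars m n :: 'k mpoly2 list) then poly_vars m n ! i else 0)"

definition mons :: "((nat \<times> nat) \<Rightarrow>\<^sub>0 nat) set" where
  "mons = {t. Poly_Mapping.keys t \<subseteq> {1..m} \<times> {1..n}}"

lemma P_iff: "f \<in> P \<longleftrightarrow> Poly_Mapping.keys f \<subseteq> mons"
  by (auto simp: P_eq poly_ring_def mons_def)

lemma mons_add: "s + t \<in> mons \<longleftrightarrow> s \<in> mons \<and> t \<in> mons"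
  by (auto simp: mons_def keys_plus_nat)

lemma single_P: "t \<in> mons \<Longrightarrow> Poly_Mapping.single t c \<in> P"
  by (auto simp: P_iff)

lemma Xvar_P: "i \<in> {1..m} \<Longrightarrow> j \<in> {1..n} \<Longrightarrow> Xvar i j \<in> P"
  by (auto simp: Xvar_single P_iff mons_def)

lemma set_poly_vars: "set (poly_vars m n) = {Xvar i j | i j. i \<in> {1..m} \<and> j \<in> {1..n}}"
  by (auto simp: poly_vars_def atLeastLessThanSuc_atLeastAtMost simp del: upt_Suc) blast

sublocale coord_ring P coord "length (poly_vars m n :: 'k mpoly2 list)"
proof
  fix a b assume ab: "a \<in> P" "b \<in> P"
  then show "a + b \<in> P" using keys_add[of a b] by (auto simp: P_iff)
  show "a * b \<in> P" unfolding P_iff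
  proof
    fix t assume "t \<in> Poly_Mapping.keys (a * b)"
    then obtain u w where "t = u + w" "u \<in> Poly_Mapping.keys a" "w \<in> Poly_Mapping.keys b"
      using keys_mult[of a b] by blast
    then show "t \<in> mons" using ab by (auto simp: P_iff mons_add)
  qed
next
  fix a assume "a \<in> P"
  then show "- a \<in> P" by (auto simp: P_iff in_keys_iff)
next
  fix i
  have "coord i \<in> insert 0 (set (poly_vars m n))" by (auto simp: coord_def)
  then consider "coord i = 0" | a b where "coord i = Xvar a b" "a \<in> {1..m}" "b \<in> {1..n}"
    unfolding set_poly_vars by blast
  then show "coord i \<in> P"
  proof cases
    case 1
    then show ?thesis by (simp add: P_iff)
  next
    case 2
    then show ?thesis using Xvar_P[of a b] by simp
  qed
qed (auto simp: P_iff mons_def)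

lemma Xvar_index:
  assumes "i \<in> {1..m}" "j \<in> {1..n}"
  obtains q where "q < length (poly_vars m n :: 'k mpoly2 list)" "coord q = Xvar i j"
proof -
  have "Xvar i j \<in> set (poly_vars m n :: 'k mpoly2 list)" using assms by (auto simp: set_poly_vars)
  then show ?thesis using that by (auto simp: in_set_conv_nth coord_def)
qed

lemma minor_P: "i \<in> {1..m} \<Longrightarrow> j \<in> {1..m} \<Longrightarrow> k \<in> {1..n} \<Longrightarrow> l \<in> {1..n} \<Longrightarrow> minor i j k l \<in> P"
  by (simp add: minor_def Xvar_P)

lemma P_induct [consumes 1, case_names single add]:
  assumes "f \<in> P" and "\<And>t c. t \<in> mons \<Longrightarrow> Q (Poly_Mapping.single t c)"
    and "\<And>f g. f \<in> P \<Longrightarrow> g \<in> P \<Longrightarrow> Q f \<Longrightarrow> Q g \<Longrightarrow> Q (f + g)"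
  shows "Q f"
proof -
  have "(\<Sum>t\<in>A. Poly_Mapping.single t (Poly_Mapping.lookup f t)) \<in> P \<and>
    Q (\<Sum>t\<in>A. Poly_Mapping.single t (Poly_Mapping.lookup f t))"
    if "A \<subseteq> Poly_Mapping.keys f" for A
    using finite_subset[OF that finite_keys] that
  proof (induction A rule: finite_induct)
    case empty
    then show ?case using assms(2)[of 0 0] by (simp add: mons_def)
  next
    case (insert t A)
    then have "t \<in> mons" using assms(1) by (auto simp: P_iff)
    then show ?case using insert assms(2)[of t] single_P[of t] by (auto intro!: assms(3))
  qed
  then show ?thesis by (subst poly_mapping_sum_singles) auto
qed

lemma kill_P: "f \<in> P \<Longrightarrow> kill Z f \<in> P"
  by (induction rule: P_induct) (auto simp: kill_single kill_add single_P)

definition vars :: "(nat \<times> nat) set \<Rightarrow> 'k mpoly2 set" where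
  "vars Z = {Xvar i j | i j. (i, j) \<in> Z}"

lemma vars_P: "Z \<subseteq> {1..m} \<times> {1..n} \<Longrightarrow> vars Z \<subseteq> P"
  by (auto simp: vars_def intro!: Xvar_P)

lemma diff_kill:
  assumes f: "f \<in> P"
  shows "f - kill Z f \<in> ideal_gen (vars Z)"
  using f
proof (induction rule: P_induct)
  case (single t c)
  show ?case
  proof (cases "Poly_Mapping.keys t \<inter> Z = {}")
    case True
    then show ?thesis by (simp add: kill_single ideal_gen_zero)
  next
    case False
    then obtain i j where ij: "(i, j) \<in> Poly_Mapping.keys t" "(i, j) \<in> Z" by auto
    obtain t' where t': "t = var_exp i j + t'" using keys_split_single[OF ij(1)] unfolding var_exp_def
      by blast
    then have "t' \<in> mons" using single by (simp add: mons_add)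
    then have "Poly_Mapping.single t' c * Xvar i j + 0 \<in> ideal_gen (vars Z)"
      using ij by (intro ideal_gen_step single_P ideal_gen_zero) (auto simp: vars_def)
    then show ?thesis using False by (simp add: kill_single t' Xvar_single mult_single add.commute)
  qed
next
  case (add f g)
  then show ?case using ideal_gen_add by (fastforce simp: kill_add algebra_simps)
qed

text \<open>
  An element of \<open>(X \<union> \<Gamma>)\<close> is congruent modulo \<open>(X)\<close> to a combination of \<open>\<Gamma>\<close> whose coefficients do not
  involve the variables in \<open>Z\<close>, hence to an \<open>f'\<close> fixed by \<open>kill Z\<close>. If it also lies in \<open>(X \<union> vars Z)\<close>,
  then so does \<open>f'\<close>, and \<open>f' = kill Z f'\<close> lies in \<open>(X)\<close>.
\<close>

lemma ideal_gen_split_Int: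
  assumes XP: "X \<subseteq> P" and GP: "\<Gamma> \<subseteq> P" and Z: "Z \<subseteq> {1..m} \<times> {1..n}"
    and killX: "\<And>g. g \<in> X \<Longrightarrow> kill Z g \<in> ideal_gen X"
    and killG: "\<And>g. g \<in> \<Gamma> \<Longrightarrow> kill Z g = g"
    and ZG: "\<And>i j g. (i, j) \<in> Z \<Longrightarrow> g \<in> \<Gamma> \<Longrightarrow> Xvar i j * g \<in> ideal_gen X"
  shows "ideal_gen (X \<union> \<Gamma>) \<inter> ideal_gen (X \<union> vars Z) = ideal_gen X"
proof
  have mult: "h * g \<in> ideal_gen X" if "h \<in> ideal_gen (vars Z)" "g \<in> \<Gamma>" for h g
    using that(1)
  proof (induction rule: ideal_gen.induct)
    case (ideal_gen_step p z f)
    then have "z * g \<in> ideal_gen X" using that(2) ZG by (auto simp: vars_def)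
    then have "p * (z * g) + f * g \<in> ideal_gen X"
      using ideal_gen_step by (simp add: ideal_gen_add ideal_gen_mult)
    then show ?case by (simp add: algebra_simps)
  qed (simp add: ideal_gen_zero)
  have 1: "\<exists>f'. f - f' \<in> ideal_gen X \<and> kill Z f' = f'" if "f \<in> ideal_gen (X \<union> \<Gamma>)" for f
    using that
  proof (induction rule: ideal_gen.induct)
    case ideal_gen_zero
    show ?case by (intro exI[of _ 0]) (simp add: ideal_gen.ideal_gen_zero)
  next
    case (ideal_gen_step p g f)
    then obtain f' where f': "f - f' \<in> ideal_gen X" "kill Z f' = f'" by blast
    show ?case
    proof (cases "g \<in> X")
      case True
      then show ?thesis using f' ideal_gen_step by (intro exI[of _ f'])
        (auto simp: add_diff_eq[symmetric] intro: ideal_gen.ideal_gen_step)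
    next
      case False
      then have g: "g \<in> \<Gamma>" using ideal_gen_step by auto
      have "(p - kill Z p) * g + (f - f') \<in> ideal_gen X"
        using g f' ideal_gen_step by (intro ideal_gen_add mult diff_kill)
      then have "p * g + f - (kill Z p * g + f') \<in> ideal_gen X" by (simp add: algebra_simps)
      then show ?thesis using f' killG[OF g]
        by (intro exI[of _ "kill Z p * g + f'"]) (simp add: kill_add kill_mult kill_kill)
    qed
  qed
  have 2: "kill Z h \<in> ideal_gen X" if "h \<in> ideal_gen (X \<union> vars Z)" for h
    using that
  proof (induction rule: ideal_gen.induct)
    case (ideal_gen_step p g f)
    have "kill Z g \<in> ideal_gen X" using ideal_gen_step killX by (auto simp: vars_def kill_Xvar ideal_gen_zero)
    then show ?case using ideal_gen_step by
      (auto simp: kill_add kill_mult intro!: ideal_gen_add ideal_gen_mult kill_P)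
  qed (simp add: ideal_gen_zero)
  show "ideal_gen (X \<union> \<Gamma>) \<inter> ideal_gen (X \<union> vars Z) \<subseteq> ideal_gen X"
  proof
    fix f assume f: "f \<in> ideal_gen (X \<union> \<Gamma>) \<inter> ideal_gen (X \<union> vars Z)"
    then obtain f' where f': "f - f' \<in> ideal_gen X" "kill Z f' = f'" using 1 by blast
    have "kill Z (f - f') \<in> ideal_gen X"
      using f'(1) ideal_gen_mono[of X "X \<union> vars Z"] XP vars_P[OF Z] by (intro 2) auto
    then have "kill Z f - f' \<in> ideal_gen X" by (simp add: kill_diff f')
    moreover have "kill Z f \<in> ideal_gen X" using f by (intro 2) auto
    ultimately have "f' \<in> ideal_gen X"
      using ideal_diff[OF ideal_gen_ideal[OF XP], of "kill Z f" "kill Z f - f'"] by simp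
    then show "f \<in> ideal_gen X" using ideal_gen_add[OF f'(1), of f'] by simp
  qed
  show "ideal_gen X \<subseteq> ideal_gen (X \<union> \<Gamma>) \<inter> ideal_gen (X \<union> vars Z)"
    using XP GP vars_P[OF Z] ideal_gen_mono[of X "X \<union> \<Gamma>"] ideal_gen_mono[of X "X \<union> vars Z"] by auto
qed

text \<open>The form in which the splitting is used, both for blocks of minors and for graphs.\<close>

theorem depth_ge_split:
  assumes XP: "X \<subseteq> P" and GP: "\<Gamma> \<subseteq> P" and Z: "Z \<subseteq> {1..m} \<times> {1..n}"
    and "\<And>g. g \<in> X \<Longrightarrow> kill Z g \<in> ideal_gen X"
    and "\<And>g. g \<in> \<Gamma> \<Longrightarrow> kill Z g = g"
    and "\<And>i j g. (i, j) \<in> Z \<Longrightarrow> g \<in> \<Gamma> \<Longrightarrow> Xvar i j * g \<in> ideal_gen X"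
    and d: "depth_ge (ideal_gen (X \<union> \<Gamma>)) d" "depth_ge (ideal_gen (X \<union> vars Z)) d" "depth_ge (ideal_gen (X \<union> \<Gamma> \<union> vars Z)) (d - 1)"
  shows "depth_ge (ideal_gen X) d"
proof -
  have P: "X \<union> \<Gamma> \<subseteq> P" "X \<union> vars Z \<subseteq> P" using XP GP vars_P[OF Z] by auto
  have "ideal_plus (ideal_gen (X \<union> \<Gamma>)) (ideal_gen (X \<union> vars Z)) = ideal_gen (X \<union> \<Gamma> \<union> vars Z)"
    unfolding ideal_gen_plus[OF P] by (rule arg_cong[of _ _ ideal_gen]) auto
  then have "depth_ge (ideal_gen (X \<union> \<Gamma>) \<inter> ideal_gen (X \<union> vars Z)) d"
    using P d by (intro depth_ge_Int ideal_gen_ideal) auto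
  then show ?thesis using ideal_gen_split_Int[OF assms(1-6)] by simp
qed

text \<open>
  Generators of the common form of all ideals in this proof: the variables outside a set \<open>T\<close> of
  surviving positions, and the \<open>2\<close>-minors on related columns. Minors with equal columns are zero, so a
  reflexive and an irreflexive \<open>rel\<close> can give the same ideal.
\<close>

definition gens :: "(nat \<times> nat) set \<Rightarrow> (nat \<Rightarrow> nat \<Rightarrow> bool) \<Rightarrow> 'k mpoly2 set" where
  "gens T rel = vars ({1..m} \<times> {1..n} - T) \<union>
     {minor i j k l | i j k l. i \<in> {1..m} \<and> j \<in> {1..m} \<and> k \<in> {1..n} \<and> l \<in> {1..n} \<and> rel k l}"

lemma gens_P: "gens T rel \<subseteq> P"
  using vars_P[of "{1..m} \<times> {1..n} - T"] by (auto simp: gens_def minor_P)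

lemma gens_var: "i \<in> {1..m} \<Longrightarrow> j \<in> {1..n} \<Longrightarrow> (i, j) \<notin> T \<Longrightarrow> Xvar i j \<in> gens T rel"
  by (auto simp: gens_def vars_def)

lemma gens_minor: "i \<in> {1..m} \<Longrightarrow> j \<in> {1..m} \<Longrightarrow> k \<in> {1..n} \<Longrightarrow> l \<in> {1..n} \<Longrightarrow> rel k l \<Longrightarrow>
    minor i j k l \<in> gens T rel"
  by (auto simp: gens_def)

lemma gensE:
  assumes "g \<in> gens T rel"
  obtains i j where "i \<in> {1..m}" "j \<in> {1..n}" "(i, j) \<notin> T" "g = Xvar i j"
  | i j k l where "i \<in> {1..m}" "j \<in> {1..m}" "k \<in> {1..n}" "l \<in> {1..n}" "rel k l" "g = minor i j k l"
  using assms by (auto simp: gens_def vars_def)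

end

section \<open>Two-minors of disjoint blocks\<close>

lemma lookup_var_exp: "Poly_Mapping.lookup (var_exp i j) q = (if q = (i, j) then 1 else 0)"
  by (auto simp: var_exp_def lookup_single when_def)

context poly_mat begin

lemma gens_remove:
  assumes "Z \<subseteq> T" "T \<subseteq> {1..m} \<times> {1..n}"
  shows "gens (T - Z) rel = gens T rel \<union> vars Z"
proof -
  have "{1..m} \<times> {1..n} - (T - Z) = ({1..m} \<times> {1..n} - T) \<union> Z" using assms by blast
  moreover have "vars (A \<union> B) = vars A \<union> vars B" for A B by (auto simp: vars_def)
  ultimately show ?thesis unfolding gens_def by auto
qed

lemma depth_ge_0: "depth_ge I 0"
  by (simp add: depth_ge_def)

lemma depth_ge_mono: "depth_ge I d \<Longrightarrow> e \<le> d \<Longrightarrow> depth_ge I e"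
  by (simp add: depth_ge_def)

end

text \<open>
  \<open>c\<close> labels the columns by blocks, \<open>R b\<close> is the set of surviving rows of block \<open>b\<close>, and \<open>C\<close> is the
  set of surviving columns. Rows are removed blockwise, columns globally.
\<close>

definition block_supp :: "(nat \<Rightarrow> 'l) \<Rightarrow> ('l \<Rightarrow> nat set) \<Rightarrow> nat set \<Rightarrow> (nat \<times> nat) set" where
  "block_supp c R C = {(i, j). j \<in> C \<and> i \<in> R (c j)}"

locale block_mat = poly_mat +
  fixes c :: "nat \<Rightarrow> 'l" and R :: "'l \<Rightarrow> nat set" and C :: "nat set"
  assumes R_sub: "\<And>b. R b \<subseteq> {1..m}" and C_sub: "C \<subseteq> {1..n}"
begin

abbreviation supp :: "(nat \<times> nat) set" where
  "supp \<equiv> block_supp c R C"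

definition rdeg :: "((nat \<times> nat) \<Rightarrow>\<^sub>0 nat) \<Rightarrow> 'l \<Rightarrow> nat \<Rightarrow> nat" where
  "rdeg t b i = (\<Sum>j\<in>{1..n}. if c j = b then Poly_Mapping.lookup t (i, j) else 0)"

definition cdeg :: "((nat \<times> nat) \<Rightarrow>\<^sub>0 nat) \<Rightarrow> nat \<Rightarrow> nat" where
  "cdeg t j = (\<Sum>i\<in>{1..m}. Poly_Mapping.lookup t (i, j))"

text \<open>
  Equality of the row degrees in each block and of the column degrees: these are the exponents of
  \<open>\<Prod> (s\<^sub>b\<^sub>i t\<^sub>j)\<close> under the Segre parametrisation \<open>x\<^sub>i\<^sub>j \<mapsto> s\<^sub>b\<^sub>i t\<^sub>j\<close>.
\<close>

definition same_deg :: "((nat \<times> nat) \<Rightarrow>\<^sub>0 nat) \<Rightarrow> ((nat \<times> nat) \<Rightarrow>\<^sub>0 nat) \<Rightarrow> bool" where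
  "same_deg s t \<longleftrightarrow> rdeg s = rdeg t \<and> cdeg s = cdeg t"

abbreviation J :: "'a mpoly2 set" where
  "J \<equiv> ideal_gen (gens supp (\<lambda>k l. c k = c l))"

lemma supp_sub: "supp \<subseteq> {1..m} \<times> {1..n}"
  using R_sub C_sub by (auto simp: block_supp_def)

lemma supp_mons: "Poly_Mapping.keys t \<subseteq> supp \<Longrightarrow> t \<in> mons"
  using supp_sub by (auto simp: mons_def)

lemma rdeg_add: "rdeg (s + t) b i = rdeg s b i + rdeg t b i"
  unfolding rdeg_def sum.distrib[symmetric] by (rule sum.cong) (auto simp: lookup_add)

lemma cdeg_add: "cdeg (s + t) j = cdeg s j + cdeg t j"
  by (simp add: cdeg_def lookup_add sum.distrib)

lemma rdeg_var_exp: "j \<in> {1..n} \<Longrightarrow> rdeg (var_exp i j) b i' = (if i = i' \<and> c j = b then 1 else 0)"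
proof -
  assume j: "j \<in> {1..n}"
  have "rdeg (var_exp i j) b i' = (\<Sum>j'\<in>{1..n}. if j' = j then (if i = i' \<and> c j = b then 1 else 0) else 0)"
    unfolding rdeg_def by (rule sum.cong) (auto simp: lookup_var_exp)
  then show ?thesis using j by simp
qed

lemma cdeg_var_exp: "i \<in> {1..m} \<Longrightarrow> cdeg (var_exp i j) j' = (if j = j' then 1 else 0)"
proof -
  assume i: "i \<in> {1..m}"
  have "cdeg (var_exp i j) j' = (\<Sum>i'\<in>{1..m}. if i' = i then (if j = j' then 1 else 0) else 0)"
    unfolding cdeg_def by (rule sum.cong) (auto simp: lookup_var_exp)
  then show ?thesis using i by simp
qed

lemma same_deg_add: "same_deg (u + s) (u + t) \<longleftrightarrow> same_deg s t"
  by (auto simp: same_deg_def fun_eq_iff rdeg_add cdeg_add)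

lemma same_deg_trans: "same_deg s t \<Longrightarrow> same_deg s u \<longleftrightarrow> same_deg t u"
  by (auto simp: same_deg_def)

lemma same_deg_exchange:
  assumes "i \<in> {1..m}" "j \<in> {1..m}" "k \<in> {1..n}" "l \<in> {1..n}" "c k = c l"
  shows "same_deg (var_exp i k + var_exp j l + t) (var_exp i l + var_exp j k + t)"
  using assms by (auto simp: same_deg_def fun_eq_iff rdeg_add cdeg_add rdeg_var_exp cdeg_var_exp)

lemma minor_single:
  "Poly_Mapping.single t a * minor i j k l =
     Poly_Mapping.single (var_exp i k + var_exp j l + t) a - Poly_Mapping.single (var_exp i l + var_exp j k + t) a"
  by (simp add: minor_def Xvar_single mult_single right_diff_distrib add_ac)

text \<open>
  Induction on the total degree. If \<open>x\<^sub>i\<^sub>j\<close> divides \<open>t\<close>, then by equality of degrees some \<open>x\<^sub>i\<^sub>q\<close> in the same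
  block and some \<open>x\<^sub>p\<^sub>j\<close> divide \<open>s\<close>; exchanging them by a minor makes \<open>x\<^sub>i\<^sub>j\<close> divide
  \<open>s\<close> too, and it can be split off from both.
\<close>

lemma same_deg_congruent:
  assumes "Poly_Mapping.keys t \<subseteq> supp" "Poly_Mapping.keys s \<subseteq> supp" "same_deg t s"
  shows "Poly_Mapping.single t 1 - Poly_Mapping.single s 1 \<in> J"
  using assms
proof (induction "\<Sum>j\<in>{1..n}. cdeg t j" arbitrary: t s rule: less_induct)
  case less
  note supp = less.prems(1,2) and same = less.prems(3)
  have rd: "rdeg s b i = rdeg t b i" and cd: "cdeg s j = cdeg t j" for b i j
    using same by (auto simp: same_deg_def)
  show ?case
  proof (cases "t = 0")
    case True
    have "s = 0"
    proof (rule ccontr)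
      assume "s \<noteq> 0"
      then obtain i j where ij: "(i, j) \<in> Poly_Mapping.keys s"
        by (metis keys_eq_empty equals0I surj_pair)
      have "i \<in> {1..m}" using ij supp supp_sub by auto
      then have "Poly_Mapping.lookup s (i, j) \<le> cdeg s j"
        unfolding cdeg_def by (intro member_le_sum) auto
      moreover have "cdeg s j = 0" using cd True by (simp add: cdeg_def)
      ultimately show False using ij by (simp add: in_keys_iff)
    qed
    then show ?thesis using True by (simp add: ideal_gen_zero)
  next
    case False
    then obtain i j where ij: "(i, j) \<in> Poly_Mapping.keys t"
      by (metis keys_eq_empty equals0I surj_pair)
    then have ijs: "(i, j) \<in> supp" "i \<in> {1..m}" "j \<in> {1..n}" using supp supp_sub by auto
    obtain t' where t': "t = var_exp i j + t'" using keys_split_single[OF ij] unfolding var_exp_def by blast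
    have sum_lt: "(\<Sum>j\<in>{1..n}. cdeg t' j) < (\<Sum>j\<in>{1..n}. cdeg t j)"
      using ijs by (auto simp: t' cdeg_add cdeg_var_exp intro!: sum_strict_mono_ex1)
    have kt': "Poly_Mapping.keys t' \<subseteq> supp" using supp by (auto simp: t' keys_plus_nat)
    have step: "Poly_Mapping.single t 1 - Poly_Mapping.single (var_exp i j + s') 1 \<in> J"
      if "Poly_Mapping.keys s' \<subseteq> supp" "same_deg t' s'" for s'
    proof -
      have "Xvar i j * (Poly_Mapping.single t' 1 - Poly_Mapping.single s' 1) \<in> J"
        using less.hyps[OF sum_lt kt' that] ijs by (intro ideal_gen_mult Xvar_P)
      then show ?thesis by (simp add: t' Xvar_single mult_single right_diff_distrib)
    qed
    show ?thesis
    proof (cases "(i, j) \<in> Poly_Mapping.keys s")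
      case True
      obtain s' where s': "s = var_exp i j + s'" using keys_split_single[OF True] unfolding var_exp_def
        by blast
      have "same_deg t' s'" using same by (simp add: t' s' same_deg_add)
      moreover have "Poly_Mapping.keys s' \<subseteq> supp" using supp by (auto simp: s' keys_plus_nat)
      ultimately show ?thesis using step s' by simp
    next
      case nij: False
      have "rdeg s (c j) i \<noteq> 0" using ijs by (simp add: rd t' rdeg_add rdeg_var_exp)
      then obtain j' where "j' \<in> {1..n}" "(if c j' = c j then Poly_Mapping.lookup s (i, j') else 0) \<noteq> 0"
        unfolding rdeg_def by (rule sum.not_neutral_contains_not_neutral)
      then have j': "j' \<in> {1..n}" "c j' = c j" "(i, j') \<in> Poly_Mapping.keys s"
        by (simp_all add: in_keys_iff split: if_splits)
      have "cdeg s j \<noteq> 0" using ijs by (simp add: cd t' cdeg_add cdeg_var_exp)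
      then obtain i' where "i' \<in> {1..m}" "Poly_Mapping.lookup s (i', j) \<noteq> 0"
        unfolding cdeg_def by (rule sum.not_neutral_contains_not_neutral)
      then have i': "i' \<in> {1..m}" "(i', j) \<in> Poly_Mapping.keys s"
        by (simp_all add: in_keys_iff)
      have ne: "(i', j) \<noteq> (i, j')" using nij j' by auto
      obtain s1 where s1: "s = var_exp i j' + s1" using keys_split_single[OF j'(3)] unfolding var_exp_def
        by blast
      then have "(i', j) \<in> Poly_Mapping.keys s1" using i' ne by (auto simp: keys_plus_nat)
      then obtain s2 where s2: "s1 = var_exp i' j + s2" unfolding var_exp_def by (rule keys_split_single)
      have s: "s = var_exp i j' + var_exp i' j + s2" by (simp add: s1 s2 add.assoc)
      define s' where "s' = var_exp i' j' + s2"
      have ks: "(i, j') \<in> supp" "(i', j) \<in> supp" "Poly_Mapping.keys s2 \<subseteq> supp"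
        using supp by (auto simp: s keys_plus_nat)
      then have ks': "Poly_Mapping.keys s' \<subseteq> supp"
        using j'(2) by (auto simp: s'_def keys_plus_nat block_supp_def)
      have eq: "var_exp i j + s' = var_exp i j + var_exp i' j' + s2" by (simp add: s'_def add.assoc)
      have "same_deg (var_exp i j + s') s"
        unfolding eq s using ijs i' j' by (intro same_deg_exchange) auto
      then have "same_deg (var_exp i j + t') (var_exp i j + s')" using same unfolding t' by
        (simp add: same_deg_def)
      then have 1: "Poly_Mapping.single t 1 - Poly_Mapping.single (var_exp i j + s') 1 \<in> J"
        using step[OF ks'] by (simp add: same_deg_add)
      have "Poly_Mapping.single s2 1 * minor i i' j j' \<in> J"
        using ijs i' j' supp_mons[OF ks(3)] by (intro ideal_gen_mult ideal_gen_base gens_minor single_P) auto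
      then have "Poly_Mapping.single (var_exp i j + s') 1 - Poly_Mapping.single s 1 \<in> J"
        by (simp only: minor_single eq s)
      from ideal_gen_add[OF 1 this] show ?thesis by simp
    qed
  qed
qed

text \<open>
  The coefficient of one monomial in the image of \<open>f\<close> under the Segre parametrisation, where variables
  outside the support go to zero.
\<close>

definition degsum :: "((nat \<times> nat) \<Rightarrow>\<^sub>0 nat) \<Rightarrow> 'a mpoly2 \<Rightarrow> 'a" where
  "degsum s f = (\<Sum>t\<in>Poly_Mapping.keys f.
     if Poly_Mapping.keys t \<subseteq> supp \<and> same_deg t s then Poly_Mapping.lookup f t else 0)"

lemma degsum_add: "degsum s (f + g) = degsum s f + degsum s g"
  unfolding degsum_def by (rule setsum_keys_plus_distrib) auto

lemma degsum_single: "degsum s (Poly_Mapping.single t a) = (if Poly_Mapping.keys t \<subseteq> supp \<and>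
  same_deg t s then a else 0)"
  by (simp add: degsum_def)

lemma degsum_zero [simp]: "degsum s 0 = 0"
  by (simp add: degsum_def)

lemma degsum_diff: "degsum s (f - g) = degsum s f - degsum s g"
  using degsum_add[of s "f - g" g] by simp

lemma degsum_J: "f \<in> J \<Longrightarrow> degsum s f = 0"
proof (induction rule: ideal_gen.induct)
  case (ideal_gen_step p g f)
  have "degsum s (p * g) = 0"
    using ideal_gen_step(1)
  proof (induction rule: P_induct)
    case (single t a)
    show ?case using ideal_gen_step(2)
    proof (cases rule: gensE)
      case (1 i j)
      then show ?thesis by (simp add: Xvar_single mult_single degsum_single keys_plus_nat)
    next
      case (2 i j k l)
      have "same_deg (var_exp i k + var_exp j l + t) s \<longleftrightarrow> same_deg (var_exp i l + var_exp j k + t) s"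
        using 2 by (intro same_deg_trans same_deg_exchange)
      moreover have "{(i,k), (j,l)} \<subseteq> supp \<longleftrightarrow> {(i,l), (j,k)} \<subseteq> supp"
        using 2(5) by (auto simp: block_supp_def)
      ultimately show ?thesis unfolding 2(6) minor_single
        by (auto simp: degsum_diff degsum_single keys_plus_nat)
    qed
  next
    case (add f g)
    then show ?case by (simp add: distrib_right degsum_add)
  qed
  then show ?case using ideal_gen_step by (simp add: degsum_add)
qed simp

text \<open>
  Some nonzero coefficient at \<open>t\<close> is cancelled by moving it to another monomial of the same
  degree, which must exist since the coefficients of that degree add up to zero.
\<close>

lemma degsum_zero_imp_J:
  assumes "f \<in> P" "\<And>s. degsum s f = 0"
  shows "f \<in> J"
  using assms
proof (induction "card (Poly_Mapping.keys f)" arbitrary: f rule: less_induct)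
  case less
  show ?case
  proof (cases "f = 0")
    case True
    then show ?thesis by (simp add: ideal_gen_zero)
  next
    case False
    then obtain t where t: "t \<in> Poly_Mapping.keys f" by (metis keys_eq_empty equals0I)
    let ?a = "Poly_Mapping.lookup f t"
    have tm: "t \<in> mons" using t less.prems(1) by (auto simp: P_iff)
    have reduce: "f \<in> J"
      if h: "h \<in> J" "Poly_Mapping.lookup h t = ?a" "Poly_Mapping.keys h \<subseteq> Poly_Mapping.keys f" for h
    proof -
      have sub: "Poly_Mapping.keys (f - h) \<subset> Poly_Mapping.keys f"
      proof
        show "Poly_Mapping.keys (f - h) \<subseteq> Poly_Mapping.keys f"
        proof
          fix u assume "u \<in> Poly_Mapping.keys (f - h)"
          then have "u \<in> Poly_Mapping.keys f \<or> u \<in> Poly_Mapping.keys h" by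
            (auto simp: in_keys_iff lookup_minus)
          then show "u \<in> Poly_Mapping.keys f" using h(3) by auto
        qed
        show "Poly_Mapping.keys (f - h) \<noteq> Poly_Mapping.keys f"
        proof -
          have "t \<notin> Poly_Mapping.keys (f - h)" using h(2) by (simp add: in_keys_iff lookup_minus)
          then show ?thesis using t by auto
        qed
      qed
      have "f - h \<in> J"
      proof (rule less.hyps)
        show "card (Poly_Mapping.keys (f - h)) < card (Poly_Mapping.keys f)"
          using sub by (intro psubset_card_mono) auto
        show "f - h \<in> P" using less.prems(1) ideal_gen_sub_P[OF h(1) gens_P] by auto
        show "degsum s (f - h) = 0" for s using less.prems(2) degsum_J[OF h(1)] by (simp add: degsum_diff)
      qed
      from ideal_gen_add[OF this h(1)] show ?thesis by simp
    qed
    show ?thesis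
    proof (cases "Poly_Mapping.keys t \<subseteq> supp")
      case False
      then obtain i j where ij: "(i, j) \<in> Poly_Mapping.keys t" "(i, j) \<notin> supp" by auto
      then have ijm: "i \<in> {1..m}" "j \<in> {1..n}" using tm by (auto simp: mons_def)
      obtain t' where t': "t = var_exp i j + t'" using keys_split_single[OF ij(1)] unfolding var_exp_def
        by blast
      have "Poly_Mapping.single t' ?a * Xvar i j \<in> J"
        using ij ijm tm by (intro ideal_gen_mult ideal_gen_base gens_var single_P) (auto simp: t' mons_add)
      then have "Poly_Mapping.single t ?a \<in> J" by (simp add: t' Xvar_single mult_single add.commute)
      then show ?thesis by (rule reduce) (use t in \<open>auto simp: in_keys_iff\<close>)
    next
      case True
      have "\<exists>u\<in>Poly_Mapping.keys f. u \<noteq> t \<and> Poly_Mapping.keys u \<subseteq> supp \<and> same_deg u t"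
      proof (rule ccontr)
        assume neg: "\<not> ?thesis"
        have "degsum t f = (\<Sum>u\<in>Poly_Mapping.keys f. if u = t then ?a else 0)"
          unfolding degsum_def using neg True by (intro sum.cong) (auto simp: same_deg_def)
        then have "degsum t f = ?a" using t by simp
        then show False using less.prems(2) t by (simp add: in_keys_iff)
      qed
      then obtain u where u: "u \<in> Poly_Mapping.keys f" "u \<noteq> t" "Poly_Mapping.keys u \<subseteq> supp" "same_deg u t"
        by blast
      have "Poly_Mapping.single 0 ?a * (Poly_Mapping.single t 1 - Poly_Mapping.single u 1) \<in> J"
        using True u by (intro ideal_gen_mult same_deg_congruent single_P) (auto simp: same_deg_def mons_def)
      then have "Poly_Mapping.single t ?a - Poly_Mapping.single u ?a \<in> J"
        by (simp add: mult_single right_diff_distrib)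
      then show ?thesis
        by (rule reduce) (use t u in \<open>auto simp: in_keys_iff lookup_minus lookup_single when_def split: if_splits\<close>)
    qed
  qed
qed

text \<open>Multiplication by a variable is injective on degrees.\<close>

lemma Xvar_nzd:
  assumes ij: "(i, j) \<in> supp" and f: "f \<in> P" and "Xvar i j * f \<in> J"
  shows "f \<in> J"
proof (rule degsum_zero_imp_J[OF f])
  fix s
  have "degsum s f = degsum (var_exp i j + s) (Xvar i j * f)"
    using f
  proof (induction rule: P_induct)
    case (single t a)
    then show ?case using ij by (simp add: Xvar_single mult_single degsum_single keys_plus_nat same_deg_add)
  next
    case (add f g)
    then show ?case by (simp add: distrib_left degsum_add)
  qed
  then show "degsum s f = 0" using degsum_J[OF assms(3)] by simp
qed

end

text \<open>The dimension of the ring of a \<open>p \<times> q\<close> matrix modulo its \<open>2\<close>-minors, and \<open>0\<close> for an empty block.\<close>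

definition block_dep :: "nat \<Rightarrow> nat \<Rightarrow> nat" where
  "block_dep p q = (if p = 0 \<or> q = 0 then 0 else p + q - 1)"

context poly_mat begin

text \<open>
  A minor that involves column \<open>j0\<close> becomes a combination of products that each contain
  an entry of this column: such an entry is either set to zero or is itself a generator.
\<close>

lemma kill_column_gens:
  assumes R: "\<And>b. R b \<subseteq> {1..m}" and C: "C \<subseteq> {1..n}" and j0: "j0 \<in> C"
    and g: "g \<in> gens (block_supp c R C) (\<lambda>k l. c k = c l)"
  shows "kill (R (c j0) \<times> {j0}) g \<in> ideal_gen (gens (block_supp c R C) (\<lambda>k l. c k = c l))" (is "kill ?Z g \<in>
    ideal_gen ?X")
  using g
proof (cases rule: gensE)
  case (1 i j)
  then show ?thesis using g by (auto simp: kill_Xvar intro: ideal_gen_base ideal_gen_zero)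
next
  case (2 i j k l)
  have column: "(if (i, j0) \<in> ?Z \<or> Q then 0 else Xvar i j0 * h) \<in> ideal_gen ?X" if "i \<in> {1..m}" "h \<in> P"
    for i h Q
  proof (cases "i \<in> R (c j0)")
    case False
    then have "Xvar i j0 \<in> ?X" using that C j0 by (intro gens_var) (auto simp: block_supp_def)
    then have "h * Xvar i j0 \<in> ideal_gen ?X" using that by (intro ideal_gen_mult ideal_gen_base)
    then show ?thesis by (simp add: mult.commute ideal_gen_zero)
  qed (simp add: ideal_gen_zero)
  have j0n: "j0 \<in> {1..n}" using C j0 by auto
  show ?thesis
  proof (cases "k = j0 \<or> l = j0")
    case False
    then show ?thesis using g 2 by (simp add: kill_minor ideal_gen_base flip: minor_def)
  next
    case True
    have prod: "(if (i, k) \<in> ?Z \<or> (j, l) \<in> ?Z then 0 else Xvar i k * Xvar j l) \<in> ideal_gen ?X"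
      if "i \<in> {1..m}" "j \<in> {1..m}" "k \<in> {1..n}" "l \<in> {1..n}" "k = j0 \<or> l = j0" for i j k l
    proof (cases "k = j0")
      case True
      then show ?thesis using column[OF that(1), of "Xvar j l" "(j, l) \<in> ?Z"] that
        by (auto simp: Xvar_P ideal_gen_zero split: if_splits)
    next
      case False
      then have "l = j0" using that by auto
      then show ?thesis using column[OF that(2), of "Xvar i k" "(i, k) \<in> ?Z"] that
        by (auto simp: Xvar_P ideal_gen_zero mult.commute[of "Xvar i k"] split: if_splits)
    qed
    show ?thesis unfolding 2(6) kill_minor
      by (intro ideal_diff[OF ideal_gen_ideal[OF gens_P]] prod) (use 2 True in auto)
  qed
qed

text \<open>
  Induction on the number of surviving rows and columns, using the nonzerodivisor \<open>x\<^sub>a\<^sub>j\<^sub>0\<close>. With at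
  least two rows and two columns, the ideal together with \<open>x\<^sub>a\<^sub>j\<^sub>0\<close> is the intersection of the
  ideals without row \<open>a\<close> and without column \<open>j0\<close>: the product of an entry of the column with an
  entry of the row is, up to a minor, a multiple of \<open>x\<^sub>a\<^sub>j\<^sub>0\<close>. A block with one row or one column carries
  no minors, and \<open>x\<^sub>a\<^sub>j\<^sub>0\<close> alone removes a column or a row.
\<close>

theorem block_depth:
  assumes L: "finite L" "c ` C \<subseteq> L"
    and R: "\<And>b. R b \<subseteq> {1..m}" and C: "C \<subseteq> {1..n}"
  shows "depth_ge (ideal_gen (gens (block_supp c R C) (\<lambda>k l. c k = c l)))
    (\<Sum>b\<in>L. block_dep (card (R b)) (card {j \<in> C. c j = b}))"
  using L(2) R C
proof (induction "card C + (\<Sum>b\<in>L. card (R b))" arbitrary: R C rule: less_induct)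
  case less
  note R = less.prems(2) and C = less.prems(3)
  let ?rel = "\<lambda>k l. c k = c l"
  let ?d = "\<lambda>R C. \<Sum>b\<in>L. block_dep (card (R b)) (card {j \<in> C. c j = b})"
  let ?T = "block_supp c R C"
  have fC: "finite C" using C finite_subset by blast
  have fR: "finite (R b)" for b using R finite_subset by blast
  show ?case
  proof (cases "?T = {}")
    case True
    have "block_dep (card (R b)) (card {j \<in> C. c j = b}) = 0" for b
    proof -
      have "R b = {} \<or> {j \<in> C. c j = b} = {}" using True by (auto simp: block_supp_def)
      then show ?thesis unfolding block_dep_def by (metis card.empty)
    qed
    then show ?thesis by (simp add: depth_ge_0)
  next
    case False
    then obtain a j0 where aj: "(a, j0) \<in> ?T" by auto
    define b where "b = c j0"
    have a: "a \<in> R b" and j0: "j0 \<in> C" using aj by (auto simp: block_supp_def b_def)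
    have bL: "b \<in> L" using less.prems(1) j0 by (auto simp: b_def)
    define p q where "p = card (R b)" and "q = card {j \<in> C. c j = b}"
    define rest where "rest = (\<Sum>b'\<in>L - {b}. block_dep (card (R b')) (card {j \<in> C. c j = b'}))"
    define R' where "R' = R(b := R b - {a})"
    define C' where "C' = C - {j0}"
    have p0: "p > 0" using a fR by (auto simp: p_def card_gt_0_iff)
    have q0: "q > 0" using j0 fC by (auto simp: q_def b_def card_gt_0_iff)
    have cR': "card (R' b) = p - 1" using a fR by (simp add: R'_def p_def)
    have eqC': "{j \<in> C'. c j = b} = {j \<in> C. c j = b} - {j0}" by (auto simp: C'_def)
    have cC': "card {j \<in> C'. c j = b} = q - 1"
      unfolding eqC' using j0 fC by (simp add: q_def b_def)
    have other: "R' b' = R b'" "{j \<in> C'. c j = b'} = {j \<in> C. c j = b'}" if "b' \<noteq> b" for b'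
      using that by (auto simp: R'_def C'_def b_def)
    have d: "?d R C = block_dep p q + rest"
      unfolding sum.remove[OF L(1) bL] by (simp add: p_def q_def rest_def)
    have dR: "?d R' C = block_dep (p - 1) q + rest"
      unfolding sum.remove[OF L(1) bL] by (simp add: cR' q_def rest_def other)
    have dC: "?d R C' = block_dep p (q - 1) + rest"
      unfolding sum.remove[OF L(1) bL] by (simp add: cC' p_def rest_def other)
    have dRC: "?d R' C' = block_dep (p - 1) (q - 1) + rest"
      unfolding sum.remove[OF L(1) bL] by (simp add: cR' cC' rest_def other)
    have ltC: "card C' < card C" unfolding C'_def by (rule card_Diff1_less[OF fC j0])
    have ltR: "(\<Sum>b\<in>L. card (R' b)) < (\<Sum>b\<in>L. card (R b))"
      unfolding sum.remove[OF L(1) bL] using p0 by (simp add: cR' other p_def)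
    have subR': "R' b' \<subseteq> {1..m}" for b' using R[of b'] R[of b] by (auto simp: R'_def)
    have subC': "C' \<subseteq> {1..n}" "c ` C' \<subseteq> L" using C less.prems(1) by (auto simp: C'_def)
    have IH_R: "depth_ge (ideal_gen (gens (block_supp c R' C) ?rel)) (?d R' C)"
      using ltR by (intro less.hyps less.prems(1) subR' C) auto
    have IH_C: "depth_ge (ideal_gen (gens (block_supp c R C') ?rel)) (?d R C')"
      using ltC by (intro less.hyps subC' R) auto
    have IH_RC: "depth_ge (ideal_gen (gens (block_supp c R' C') ?rel)) (?d R' C')"
      using ltC ltR by (intro less.hyps subC' subR') auto
    define Zr where "Zr = {a} \<times> {j \<in> C. c j = b}"
    define Zc where "Zc = R b \<times> {j0}"
    have T: "?T \<subseteq> {1..m} \<times> {1..n}" using R C by (auto simp: block_supp_def)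
    have Z: "Zr \<subseteq> ?T" "Zc \<subseteq> ?T" using a j0 by (auto simp: Zr_def Zc_def block_supp_def b_def)
    have supps: "block_supp c R' C = ?T - Zr" "block_supp c R C' = ?T - Zc" "block_supp c R' C' = ?T -
      (Zr \<union> Zc)"
      by (auto simp: block_supp_def R'_def C'_def Zr_def Zc_def b_def split: if_splits)
    let ?X = "gens ?T ?rel"
    have gR: "gens (block_supp c R' C) ?rel = ?X \<union> vars Zr"
      unfolding supps using Z T by (intro gens_remove)
    have gC: "gens (block_supp c R C') ?rel = ?X \<union> vars Zc"
      unfolding supps using Z T by (intro gens_remove)
    have gRC: "gens (block_supp c R' C') ?rel = ?X \<union> vars (Zr \<union> Zc)"
      unfolding supps using Z T by (intro gens_remove) auto
    have ajP: "a \<in> {1..m}" "j0 \<in> {1..n}" using T aj by auto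
    let ?Y = "insert (Xvar a j0) ?X"
    have YP: "?Y \<subseteq> P" using gens_P Xvar_P[OF ajP] by auto
    have main: "depth_ge (ideal_gen ?Y) (?d R C - 1)"
    proof (cases "p = 1 \<or> q = 1")
      case True
      then show ?thesis
      proof
        assume p: "p = 1"
        then have "R b = {a}" using a by (auto simp: p_def card_1_singleton_iff)
        then have "vars Zc = {Xvar a j0}" by (auto simp: Zc_def vars_def)
        then have "depth_ge (ideal_gen ?Y) (?d R C')" using IH_C gC by simp
        then show ?thesis unfolding d dC using p q0 by (elim depth_ge_mono) (auto simp: block_dep_def)
      next
        assume q: "q = 1"
        then obtain z where z: "{j \<in> C. c j = b} = {z}" unfolding q_def by (rule card_1_singletonE)
        have "j0 \<in> {j \<in> C. c j = b}" using j0 by (simp add: b_def)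
        then have "{j \<in> C. c j = b} = {j0}" unfolding z by simp
        then have "vars Zr = {Xvar a j0}" by (auto simp: Zr_def vars_def)
        then have "depth_ge (ideal_gen ?Y) (?d R' C)" using IH_R gR by simp
        then show ?thesis unfolding d dR using q p0 by (elim depth_ge_mono) (auto simp: block_dep_def)
      qed
    next
      case False
      then have pq: "p \<ge> 2" "q \<ge> 2" using p0 q0 by auto
      let ?G = "vars (Zr - {(a, j0)})"
      have ajZ: "(a, j0) \<in> Zr" "(a, j0) \<in> Zc" using a j0 by (auto simp: Zr_def Zc_def b_def)
      have insR: "vars Zr = insert (Xvar a j0) ?G" using ajZ by (auto simp: vars_def)
      show ?thesis
      proof (rule depth_ge_split[where X = ?Y and \<Gamma> = ?G and Z = Zc])
        show "?Y \<subseteq> P" by (rule YP)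
        show "?G \<subseteq> P" using Z(1) T by (intro vars_P) auto
        show "Zc \<subseteq> {1..m} \<times> {1..n}" using Z(2) T by auto
        show "kill Zc g \<in> ideal_gen ?Y" if "g \<in> ?Y" for g
        proof (cases "g = Xvar a j0")
          case True
          then show ?thesis using ajZ by (simp add: kill_Xvar ideal_gen_zero)
        next
          case False
          then have "kill Zc g \<in> ideal_gen ?X"
            using that kill_column_gens[OF R C j0, of g c] by (simp add: Zc_def b_def)
          then show ?thesis using ideal_gen_mono[OF _ YP, of ?X] by auto
        qed
        show "kill Zc g = g" if "g \<in> ?G" for g
          using that by (auto simp: vars_def kill_Xvar Zr_def Zc_def)
        show "Xvar i j * g \<in> ideal_gen ?Y" if zg: "(i, j) \<in> Zc" "g \<in> ?G" for i j g
        proof -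
          obtain l where l: "l \<in> C" "c l = b" "g = Xvar a l" using zg by (auto simp: vars_def Zr_def)
          have i: "i \<in> {1..m}" "j = j0" using zg R[of b] by (auto simp: Zc_def)
          have "minor i a j0 l \<in> ?Y"
            using i l ajP C by (intro insertI2 gens_minor) (auto simp: b_def)
          moreover have "Xvar i l \<in> P" using i l C by (intro Xvar_P) auto
          ultimately have "Xvar i l * Xvar a j0 + minor i a j0 l \<in> ideal_gen ?Y"
            by (intro ideal_gen_add ideal_gen_mult ideal_gen_base) auto
          then show ?thesis by (simp add: minor_def i l)
        qed
        have "?Y \<union> ?G = gens (block_supp c R' C) ?rel" unfolding gR insR by auto
        then show "depth_ge (ideal_gen (?Y \<union> ?G)) (?d R C - 1)"
          using IH_R unfolding d dR by (elim ssubst depth_ge_mono) (use pq in \<open>auto simp: block_dep_def\<close>)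
        have "Xvar a j0 \<in> vars Zc" using ajZ by (auto simp: vars_def)
        then have "?Y \<union> vars Zc = gens (block_supp c R C') ?rel" unfolding gC by auto
        then show "depth_ge (ideal_gen (?Y \<union> vars Zc)) (?d R C - 1)"
          using IH_C unfolding d dC by (elim ssubst depth_ge_mono) (use pq in \<open>auto simp: block_dep_def\<close>)
        have "vars (Zr \<union> Zc) = vars Zr \<union> vars Zc" by (auto simp: vars_def)
        then have "?Y \<union> ?G \<union> vars Zc = gens (block_supp c R' C') ?rel" unfolding gRC insR by auto
        then show "depth_ge (ideal_gen (?Y \<union> ?G \<union> vars Zc)) (?d R C - 1 - 1)"
          using IH_RC unfolding d dRC by (elim ssubst depth_ge_mono) (use pq in \<open>auto simp: block_dep_def\<close>)
      qed
    qed
    interpret block_mat m n P c R C by unfold_locales (rule R, rule C)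
    obtain k where k: "k < length (poly_vars m n :: 'k mpoly2 list)" "coord k = (Xvar a j0 :: 'k mpoly2)"
      using Xvar_index[OF ajP] by blast
    show ?thesis
      by (rule depth_ge_ideal_gen_nzd[OF gens_P _ k(1)]) (use Xvar_nzd[OF aj] main k(2) in auto)
  qed
qed

end

section \<open>Deleting a vertex and completing its neighbourhood\<close>

lemma all_pairs_iff [simp]: "{u, w} \<in> all_pairs A \<longleftrightarrow> u \<in> A \<and> w \<in> A \<and> u \<noteq> w"
  by (auto simp: all_pairs_def doubleton_eq_iff)

lemma all_pairsE:
  assumes "e \<in> all_pairs A"
  obtains u w where "e = {u, w}" "u \<in> A" "w \<in> A" "u \<noteq> w"
  using assms by (auto simp: all_pairs_def)

lemma finite_all_pairs: "finite A \<Longrightarrow> finite (all_pairs A)"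
  by (rule finite_subset[of _ "Pow A"]) (auto simp: all_pairs_def)

lemma graphsD:
  assumes "G \<in> graphs"
  shows "finite (verts G)" "verts G \<noteq> {}" "edges G \<subseteq> all_pairs (verts G)"
  using assms by (auto simp: graphs_def)

lemma edge_verts:
  assumes "G \<in> graphs" "{u, w} \<in> edges G"
  shows "u \<in> verts G" "w \<in> verts G" "u \<noteq> w"
proof -
  have "{u, w} \<in> all_pairs (verts G)" using assms graphsD(3) by blast
  then show "u \<in> verts G" "w \<in> verts G" "u \<noteq> w" by simp_all
qed

lemma neighbours_iff: "G \<in> graphs \<Longrightarrow> u \<in> neighbours G v \<longleftrightarrow> {u, v} \<in> edges G"
  using edge_verts by (auto simp: neighbours_def)

lemma free_vertex_iff:
  assumes "G \<in> graphs"
  shows "free_vertex G v \<longleftrightarrow> v \<in> verts G \<and>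
    (\<forall>u w. {u, v} \<in> edges G \<longrightarrow> {w, v} \<in> edges G \<longrightarrow> u \<noteq> w \<longrightarrow> {u, w} \<in> edges G)"
proof -
  let ?N = "neighbours G v"
  have sub: "verts G \<inter> ?N = ?N" by (auto simp: neighbours_def)
  have "is_complete (induced G ?N) \<longleftrightarrow> {e \<in> edges G. e \<subseteq> ?N} = all_pairs ?N"
    by (simp add: is_complete_def induced_def sub)
  also have "\<dots> \<longleftrightarrow> all_pairs ?N \<subseteq> edges G"
  proof -
    have "e \<in> all_pairs ?N" if "e \<in> edges G" "e \<subseteq> ?N" for e
    proof -
      have "e \<in> all_pairs (verts G)" using that graphsD(3)[OF assms] by blast
      then show ?thesis using that(2) by (auto elim!: all_pairsE)
    qed
    moreover have "e \<subseteq> ?N" if "e \<in> all_pairs ?N" for e using that by (auto elim!: all_pairsE)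
    ultimately show ?thesis by blast
  qed
  also have "\<dots> \<longleftrightarrow> (\<forall>u w. {u, v} \<in> edges G \<longrightarrow> {w, v} \<in> edges G \<longrightarrow> u \<noteq> w \<longrightarrow> {u, w} \<in> edges G)"
    unfolding all_pairs_def neighbours_iff[OF assms] by blast
  finally show ?thesis by (auto simp: free_vertex_def)
qed

lemma nonfreeE:
  assumes "G \<in> graphs" "v \<in> verts G" "\<not> free_vertex G v"
  obtains u w where "{u, v} \<in> edges G" "{w, v} \<in> edges G" "u \<noteq> w" "{u, w} \<notin> edges G"
  using assms by (auto simp: free_vertex_iff)

lemma verts_delete [simp]: "verts (delete_vertex G v) = verts G - {v}"
  by (auto simp: delete_vertex_def induced_def)

lemma edges_delete: "G \<in> graphs \<Longrightarrow> {u, w} \<in> edges (delete_vertex G v) \<longleftrightarrow> {u, w} \<in> edges G \<and> u \<noteq> v \<and> w \<noteq> v"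
  using edge_verts[of G u w] by (auto simp: delete_vertex_def induced_def)

lemma verts_complete_at [simp]: "verts (complete_at G v) = verts G"
  by (simp add: complete_at_def)

lemma edges_complete_at:
  assumes "G \<in> graphs"
  shows "{u, w} \<in> edges (complete_at G v) \<longleftrightarrow>
    {u, w} \<in> edges G \<or> {u, v} \<in> edges G \<and> {w, v} \<in> edges G \<and> u \<noteq> w"
  using neighbours_iff[OF assms] by (auto simp: complete_at_def)

lemma complete_at_graphs:
  assumes "G \<in> graphs"
  shows "complete_at G v \<in> graphs"
proof -
  have "neighbours G v \<subseteq> verts G" by (auto simp: neighbours_def)
  then have "all_pairs (neighbours G v) \<subseteq> all_pairs (verts G)" by (auto simp: all_pairs_def)
  then show ?thesis using assms by (auto simp: graphs_def complete_at_def)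
qed

lemma delete_vertex_graphs:
  assumes "G \<in> graphs" "verts G \<noteq> {v}"
  shows "delete_vertex G v \<in> graphs"
proof -
  have "edges (delete_vertex G v) \<subseteq> all_pairs (verts G - {v})"
    using graphsD(3)[OF assms(1)] by (force simp: delete_vertex_def induced_def elim!: all_pairsE)
  then show ?thesis using assms by (auto simp: graphs_def)
qed

lemma complete_at_more_edges:
  assumes "G \<in> graphs" "v \<in> verts G" "\<not> free_vertex G v"
  shows "all_pairs (verts G) - edges (complete_at G v) \<subset> all_pairs (verts G) - edges G"
proof -
  obtain u w where uw: "{u, v} \<in> edges G" "{w, v} \<in> edges G" "u \<noteq> w" "{u, w} \<notin> edges G"
    using nonfreeE[OF assms] .
  have "{u, w} \<in> all_pairs (verts G) - edges G"
    using uw edge_verts(1)[OF assms(1)] by auto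
  moreover have "{u, w} \<in> edges (complete_at G v)" using uw by (simp add: edges_complete_at[OF assms(1)])
  moreover have "edges G \<subseteq> edges (complete_at G v)" by (simp add: complete_at_def)
  ultimately show ?thesis by blast
qed

lemma nonfree_not_singleton:
  assumes "G \<in> graphs" "v \<in> verts G" "\<not> free_vertex G v"
  shows "verts G \<noteq> {v}"
  using nonfreeE[OF assms] edge_verts[OF assms(1)] by (metis singletonD)

section \<open>Generalized binomial edge ideals\<close>

lemma minor_swap_rows: "minor j i k l = - (minor i j k l :: 'k::field mpoly2)"
  by (simp add: minor_def mult.commute)

lemma minor_swap_cols: "minor i j l k = - (minor i j k l :: 'k::field mpoly2)"
  by (simp add: minor_def)

lemma minor_same_row [simp]: "minor i i k l = (0 :: 'k::field mpoly2)"
  by (simp add: minor_def mult.commute)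

lemma minor_same_col [simp]: "minor i j k k = (0 :: 'k::field mpoly2)"
  by (simp add: minor_def)

text \<open>
  Two expansions of the determinant with rows \<open>i, j, j'\<close> and columns \<open>v, k, l\<close>: on the right all minors
  involve column \<open>v\<close>.
\<close>

lemma minor_plucker:
  "Xvar i v * minor j j' k l =
     Xvar i k * minor j j' v l + (- Xvar j l) * minor i j' v k + Xvar j' l * (minor i j v k :: 'k::field mpoly2)"
  by (simp add: minor_def algebra_simps)

context poly_mat begin

text \<open>A minor that uses a column without surviving entries already lies in the ideal of the variables.\<close>

lemma gens_cong_dead_sub:
  assumes "\<And>k l. k \<in> {1..n} \<Longrightarrow> l \<in> {1..n} \<Longrightarrow> rel k l \<Longrightarrow>
      rel' k l \<or> k = l \<or> (\<forall>i\<in>{1..m}. (i, k) \<notin> T) \<or> (\<forall>i\<in>{1..m}. (i, l) \<notin> T)"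
  shows "gens T rel \<subseteq> ideal_gen (gens T rel')"
proof
  fix g assume "g \<in> gens T rel"
  then show "g \<in> ideal_gen (gens T rel')"
  proof (cases rule: gensE)
    case (1 i j)
    then show ?thesis by (auto intro!: ideal_gen_base gens_var)
  next
    case (2 i j k l)
    have dead: "Xvar i k * q \<in> ideal_gen (gens T rel')"
      if "i \<in> {1..m}" "k \<in> {1..n}" "\<forall>i\<in>{1..m}. (i, k) \<notin> T" "q \<in> P" for i k q
    proof -
      have "Xvar i k \<in> gens T rel'" using that by (intro gens_var) auto
      then have "q * Xvar i k \<in> ideal_gen (gens T rel')" using that by (intro ideal_gen_mult ideal_gen_base)
      then show ?thesis by (simp add: mult.commute)
    qed
    note id = ideal_gen_ideal[OF gens_P]
    consider "rel' k l" | "k = l" | "\<forall>i\<in>{1..m}. (i, k) \<notin> T" | "\<forall>i\<in>{1..m}. (i, l) \<notin> T"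
      using assms[of k l] 2 by blast
    then show ?thesis
    proof cases
      case 1
      then show ?thesis using 2 by (auto intro!: ideal_gen_base gens_minor)
    next
      case k: 2
      then show ?thesis using 2 by (simp add: ideal_gen_zero)
    next
      case 3
      have "Xvar i k * Xvar j l - Xvar j k * Xvar i l \<in> ideal_gen (gens T rel')"
        by (intro ideal_diff[OF id] dead) (use 2 3 Xvar_P in auto)
      then show ?thesis by (simp add: 2(6) minor_def mult.commute)
    next
      case 4
      have "Xvar j l * Xvar i k - Xvar i l * Xvar j k \<in> ideal_gen (gens T rel')"
        by (intro ideal_diff[OF id] dead) (use 2 4 Xvar_P in auto)
      then show ?thesis by (simp add: 2(6) minor_def mult.commute)
    qed
  qed
qed

text \<open>
  Generators of the ideal of a graph on a subset of \<open>[n]\<close>. The variables of the missing columns are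
  included, which keeps all quotients over the same ring.
\<close>

definition graph_gens :: "ugraph \<Rightarrow> 'k mpoly2 set" where
  "graph_gens H = gens ({1..m} \<times> verts H) (\<lambda>k l. {k, l} \<in> edges H)"

lemma graph_gens_P: "graph_gens H \<subseteq> P"
  by (simp add: graph_gens_def gens_P)

lemma graph_gens_complete_at:
  assumes H: "H \<in> graphs" "verts H \<subseteq> {1..n}"
  shows "graph_gens (complete_at H v) = graph_gens H \<union>
    {minor i j k l | i j k l. i \<in> {1..m} \<and> j \<in> {1..m} \<and> {k, v} \<in> edges H \<and> {l, v} \<in> edges H \<and> k \<noteq> l}"
proof -
  have "k \<in> {1..n}" if "{k, v} \<in> edges H" for k using edge_verts(1)[OF H(1) that] H(2) by auto
  then show ?thesis
    unfolding graph_gens_def gens_def edges_complete_at[OF H(1)] verts_complete_at by blast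
qed

lemma graph_gens_delete:
  assumes H: "H \<in> graphs" "verts H \<subseteq> {1..n}" "v \<in> verts H"
  shows "ideal_gen (graph_gens H \<union> vars ({1..m} \<times> {v})) = ideal_gen (graph_gens (delete_vertex H v))"
proof -
  let ?T = "{1..m} \<times> verts H - {1..m} \<times> {v}"
  have T: "?T = {1..m} \<times> verts (delete_vertex H v)" by auto
  have "graph_gens H \<union> vars ({1..m} \<times> {v}) = gens ?T (\<lambda>k l. {k, l} \<in> edges H)"
    unfolding graph_gens_def using H by (subst gens_remove) auto
  also have "ideal_gen \<dots> = ideal_gen (gens ?T (\<lambda>k l. {k, l} \<in> edges (delete_vertex H v)))"
    by (intro ideal_gen_eqI gens_P gens_cong_dead_sub) (auto simp: edges_delete[OF H(1)])
  finally show ?thesis unfolding T graph_gens_def .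
qed

text \<open>
  The splitting with \<open>\<Gamma>\<close> the minors on two neighbours of \<open>v\<close>, which are the new generators for \<open>G\<^sub>v\<close>, and \<open>Z\<close>
  the column of \<open>v\<close>.
\<close>

theorem graph_depth_step:
  assumes H: "H \<in> graphs" "verts H \<subseteq> {1..n}" and v: "v \<in> verts H"
    and d: "depth_ge (ideal_gen (graph_gens (complete_at H v))) d" "depth_ge (ideal_gen (graph_gens (delete_vertex H v))) d"
      "depth_ge (ideal_gen (graph_gens (delete_vertex (complete_at H v) v))) (d - 1)"
  shows "depth_ge (ideal_gen (graph_gens H)) d"
proof -
  let ?Z = "{1..m} \<times> {v}"
  let ?G = "{minor i j k l | i j k l. i \<in> {1..m} \<and> j \<in> {1..m} \<and> {k, v} \<in> edges H \<and> {l, v} \<in> edges H \<and> k \<noteq> l}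
    :: 'k mpoly2 set"
  have nv: "k \<in> {1..n}" "k \<noteq> v" if "{k, v} \<in> edges H" for k
    using edge_verts[OF H(1) that] H(2) by auto
  have vn: "v \<in> {1..n}" using v H by auto
  have G: "graph_gens H \<union> ?G = graph_gens (complete_at H v)" using graph_gens_complete_at[OF H] by simp
  show ?thesis
  proof (rule depth_ge_split[where X = "graph_gens H" and \<Gamma> = ?G and Z = ?Z])
    show "graph_gens H \<subseteq> P" by (rule graph_gens_P)
    show "?G \<subseteq> P" using G graph_gens_P by blast
    show "?Z \<subseteq> {1..m} \<times> {1..n}" using vn by auto
    show "kill ?Z g \<in> ideal_gen (graph_gens H)" if "g \<in> graph_gens H" for g
    proof -
      have "kill ?Z g = g \<or> kill ?Z g = 0"
        using that unfolding graph_gens_def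
      proof (cases rule: gensE)
        case (1 i j)
        then show ?thesis by (simp add: kill_Xvar)
      next
        case (2 i j k l)
        show ?thesis unfolding 2(6) kill_minor using 2(1,2) by (auto simp: minor_def)
      qed
      then show ?thesis using that by (auto intro: ideal_gen_base ideal_gen_zero)
    qed
    show "kill ?Z g = g" if "g \<in> ?G" for g
      using that nv(2) by (auto simp: kill_minor simp flip: minor_def)
    show "Xvar a b * g \<in> ideal_gen (graph_gens H)" if "(a, b) \<in> ?Z" and g: "g \<in> ?G" for a b g
    proof -
      have a: "a \<in> {1..m}" "b = v" using that(1) by auto
      from g obtain i j k l where ij: "i \<in> {1..m}" "j \<in> {1..m}" and kl: "{k, v} \<in> edges H" "{l, v} \<in> edges H"
        and g: "g = minor i j k l" by blast
      have mem: "minor p q v u \<in> ideal_gen (graph_gens H)" if "p \<in> {1..m}" "q \<in> {1..m}" "{u, v} \<in> edges H"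
        for p q u
        unfolding graph_gens_def using that nv(1)[OF that(3)] vn by (intro ideal_gen_base gens_minor)
          (auto simp: insert_commute)
      show ?thesis
        unfolding a(2) g
        by (subst minor_plucker, intro ideal_gen_add ideal_gen_mult mem minus_P Xvar_P)
          (use a ij kl nv in auto)
    qed
    show "depth_ge (ideal_gen (graph_gens H \<union> ?G)) d" unfolding G by (rule d)
    show "depth_ge (ideal_gen (graph_gens H \<union> vars ?Z)) d" using d(2) unfolding graph_gens_delete[OF H v] .
    show "depth_ge (ideal_gen (graph_gens H \<union> ?G \<union> vars ?Z)) (d - 1)"
    proof -
      have "ideal_gen (graph_gens (complete_at H v) \<union> vars ?Z) =
        ideal_gen (graph_gens (delete_vertex (complete_at H v) v))"
        using H v by (intro graph_gens_delete complete_at_graphs) auto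
      then show ?thesis unfolding G using d(3) by metis
    qed
  qed
qed

theorem complete_depth:
  assumes H: "H \<in> graphs" "verts H \<subseteq> {1..n}" and m: "1 \<le> m"
    and Q: "disjoint_union_of_complete H Q"
  shows "depth_ge (ideal_gen (graph_gens H)) (card Q * (m - 1) + (\<Sum>B\<in>Q. card B))"
proof -
  have part: "partition_on (verts H) Q" and E: "edges H = (\<Union>B\<in>Q. all_pairs B)"
    using Q by (auto simp: disjoint_union_of_complete_def)
  have fV: "finite (verts H)" using H graphsD by auto
  have fQ: "finite Q" using finite_elements[OF fV part] .
  define c where "c = (\<lambda>j. THE B. B \<in> Q \<and> j \<in> B)"
  have uniq: "B' = B" if "B \<in> Q" "j \<in> B" "B' \<in> Q" "j \<in> B'" for j B B'
    using that part unfolding partition_on_def disjoint_def by blast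
  have c: "c j = B" if "B \<in> Q" "j \<in> B" for j B
    unfolding c_def using that uniq by (intro the_equality) auto
  have cV: "c j \<in> Q" "j \<in> c j" if j: "j \<in> verts H" for j
  proof -
    obtain B where "B \<in> Q" "j \<in> B" using part j by (auto simp: partition_on_def)
    then show "c j \<in> Q" "j \<in> c j" using c by auto
  qed
  have fibre: "{j \<in> verts H. c j = B} = B" if "B \<in> Q" for B
    using that c cV part by (auto simp: partition_on_def)
  have "depth_ge (ideal_gen (gens (block_supp c (\<lambda>_. {1..m}) (verts H)) (\<lambda>k l. c k = c l)))
    (\<Sum>B\<in>Q. block_dep (card {1..m}) (card {j \<in> verts H. c j = B}))"
    using fQ cV H(2) by (intro block_depth) auto
  moreover have "(\<Sum>B\<in>Q. block_dep (card {1..m}) (card {j \<in> verts H. c j = B})) = card Q * (m - 1) +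
    (\<Sum>B\<in>Q. card B)"
  proof -
    have "block_dep (card {1..m}) (card {j \<in> verts H. c j = B}) = (m - 1) + card B" if "B \<in> Q" for B
    proof -
      have "B \<noteq> {}" "finite B" using that part fV finite_subset[of B "verts H"] by
        (auto simp: partition_on_def)
      then have "card B > 0" by (simp add: card_gt_0_iff)
      then show ?thesis using fibre[OF that] m by (simp add: block_dep_def)
    qed
    then show ?thesis by (simp add: sum.distrib)
  qed
  moreover have "ideal_gen (gens (block_supp c (\<lambda>_. {1..m}) (verts H)) (\<lambda>k l. c k = c l)) =
    ideal_gen (graph_gens H)"
  proof -
    have T: "block_supp c (\<lambda>_. {1..m}) (verts H) = {1..m} \<times> verts H" by (auto simp: block_supp_def)
    have e: "{k, l} \<in> edges H \<longleftrightarrow> k \<noteq> l \<and> c k = c l" if "k \<in> verts H" "l \<in> verts H" for k l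
    proof -
      have "{k, l} \<in> edges H \<longleftrightarrow> (\<exists>B\<in>Q. k \<in> B \<and> l \<in> B \<and> k \<noteq> l)" by (simp add: E)
      also have "\<dots> \<longleftrightarrow> k \<noteq> l \<and> c k = c l"
        using c[of _ k] c[of _ l] cV[OF that(1)] cV[OF that(2)] by metis
      finally show ?thesis .
    qed
    have "{k, l} \<in> edges H \<or> k = l \<or> (\<forall>i\<in>{1..m}. (i, k) \<notin> {1..m} \<times> verts H) \<or>
        (\<forall>i\<in>{1..m}. (i, l) \<notin> {1..m} \<times> verts H)" if "c k = c l" for k l
      using e[of k l] that by blast
    moreover have "c k = c l" if "{k, l} \<in> edges H" for k l
      using e[of k l] that edge_verts(1,2)[OF H(1) that] by blast
    ultimately show ?thesis
      unfolding T graph_gens_def by (intro ideal_gen_eqI gens_P gens_cong_dead_sub) blast+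
  qed
  ultimately show ?thesis by simp
qed

text \<open>Deleting \<open>v\<close> removes a vertex, and completing at a non-free vertex fills a non-edge.\<close>

theorem d_compatible_depth:
  assumes \<Psi>: "d_compatible \<Psi>" and m: "2 \<le> m"
    and H: "H \<in> graphs" "verts H \<subseteq> {1..n}"
  shows "depth_ge (ideal_gen (graph_gens H)) (\<Psi> (complete_graph m) H)"
  using H
proof (induction H rule: wf_induct_rule[OF wf_measures[of "[\<lambda>H. card (verts H), \<lambda>H. card (all_pairs (verts H) -
  edges H)]"]])
  case (1 H)
  note H = 1(2,3) and IH = 1(1)
  let ?K = "complete_graph m"
  have compat: "(\<forall>Q. disjoint_union_of_complete H Q \<longrightarrow>
        \<Psi> ?K H \<le> card Q * (m - 1) + (\<Sum>B\<in>Q. card B)) \<and>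
     ((\<nexists>Q. disjoint_union_of_complete H Q) \<longrightarrow>
        (\<exists>v\<in>verts H. \<not> free_vertex H v \<and>
           \<Psi> ?K (delete_vertex H v) \<ge> \<Psi> ?K H \<and>
           \<Psi> ?K (complete_at H v) \<ge> \<Psi> ?K H \<and>
           \<Psi> ?K (delete_vertex (complete_at H v) v) + 1 \<ge> \<Psi> ?K H))"
    using \<Psi> m H(1) unfolding d_compatible_def Let_def by blast
  show ?case
  proof (cases "\<exists>Q. disjoint_union_of_complete H Q")
    case True
    then obtain Q where Q: "disjoint_union_of_complete H Q" by blast
    show ?thesis
      by (rule depth_ge_mono[OF complete_depth[OF H _ Q]]) (use compat Q m in auto)
  next
    case False
    then obtain v where v: "v \<in> verts H" "\<not> free_vertex H v"
      and le: "\<Psi> ?K (delete_vertex H v) \<ge> \<Psi> ?K H" "\<Psi> ?K (complete_at H v) \<ge> \<Psi> ?K H"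
        "\<Psi> ?K (delete_vertex (complete_at H v) v) + 1 \<ge> \<Psi> ?K H"
      using compat by blast
    note ns = nonfree_not_singleton[OF H(1) v]
    have gr: "delete_vertex H v \<in> graphs" "complete_at H v \<in> graphs"
      by (rule delete_vertex_graphs[OF H(1) ns], rule complete_at_graphs[OF H(1)])
    moreover have "delete_vertex (complete_at H v) v \<in> graphs"
      using ns by (intro delete_vertex_graphs gr) simp
    ultimately have gr: "delete_vertex H v \<in> graphs" "complete_at H v \<in>
      graphs" "delete_vertex (complete_at H v) v \<in> graphs"
      by simp_all
    have lt: "card (verts H - {v}) < card (verts H)"
      using v(1) graphsD(1)[OF H(1)] by (rule card_Diff1_less[rotated])
    have lt2: "card (all_pairs (verts H) - edges (complete_at H v)) < card (all_pairs (verts H) - edges H)"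
      using complete_at_more_edges[OF H(1) v] graphsD(1)[OF H(1)]
      by (intro psubset_card_mono) (auto simp: finite_all_pairs)
    have I1: "depth_ge (ideal_gen (graph_gens (delete_vertex H v))) (\<Psi> ?K (delete_vertex H v))"
      by (rule IH) (use H(2) lt gr in \<open>simp_all add: in_measures subset_iff\<close>)
    have I2: "depth_ge (ideal_gen (graph_gens (complete_at H v))) (\<Psi> ?K (complete_at H v))"
      by (rule IH) (use H(2) lt2 gr in \<open>simp_all add: in_measures subset_iff\<close>)
    have I3: "depth_ge (ideal_gen (graph_gens (delete_vertex (complete_at H v) v))) (\<Psi> ?K (delete_vertex (complete_at H v) v))"
      by (rule IH) (use H(2) lt gr in \<open>simp_all add: in_measures subset_iff\<close>)
    show ?thesis
    proof (rule graph_depth_step[OF H v(1)])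
      show "depth_ge (ideal_gen (graph_gens (complete_at H v))) (\<Psi> ?K H)" using I2 le(2)
        by (rule depth_ge_mono)
      show "depth_ge (ideal_gen (graph_gens (delete_vertex H v))) (\<Psi> ?K H)" using I1 le(1)
        by (rule depth_ge_mono)
      show "depth_ge (ideal_gen (graph_gens (delete_vertex (complete_at H v) v))) (\<Psi> ?K H - 1)"
        by (rule depth_ge_mono[OF I3]) (use le in auto)
    qed
  qed
qed

theorem depth_S_ge:
  assumes G: "G \<in> graphs" "verts G = {1..n}" and d: "depth_ge (ideal_gen (graph_gens G)) d"
  shows "enat d \<le> depth_S m n (gen_binomial_edge_quotient m n G :: ('k mpoly2, 'k mpoly2 set) module)"
proof -
  interpret cech_coord P coord "length (poly_vars m n :: 'k mpoly2 list)" "ideal_gen (graph_gens G)" "poly_vars m n"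
    by unfold_locales (auto simp: ideal_gen_ideal graph_gens_P coord_def)
  have base_ring: "base_ring = poly_ring m n" unfolding base_ring_def by (simp add: P_eq poly_ring_def)
  let ?X = "{Xvar i k * Xvar j l - Xvar i l * Xvar j k | i j k l.
        1 \<le> i \<and> i < j \<and> j \<le> m \<and> {k, l} \<in> edges G \<and> k < l} :: 'k mpoly2 set"
  have X_minor: "?X = {minor i j k l | i j k l. 1 \<le> i \<and> i < j \<and> j \<le> m \<and> {k, l} \<in> edges G \<and> k < l}"
    by (simp add: minor_def)
  have V: "k \<in> {1..n}" "l \<in> {1..n}" if "{k, l} \<in> edges G" for k l
    using edge_verts[OF G(1) that] G(2) by auto
  have XP: "?X \<subseteq> P" unfolding X_minor using V by (auto intro!: minor_P)
  have XG: "?X \<subseteq> graph_gens G"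
    unfolding X_minor graph_gens_def using V by (auto intro!: gens_minor)
  have GX: "graph_gens G \<subseteq> ideal_gen ?X"
  proof
    fix g assume "g \<in> graph_gens G"
    then show "g \<in> ideal_gen ?X"
      unfolding graph_gens_def
    proof (cases rule: gensE)
      case (1 i j)
      then show ?thesis using G(2) by simp
    next
      case (2 i j k l)
      have base: "minor i j k l \<in> ideal_gen ?X"
        if "i \<in> {1..m}" "j \<in> {1..m}" "i < j" "{k, l} \<in> edges G" "k < l" for i j k l
        unfolding X_minor using that by (intro ideal_gen_base) auto
      have neg: "- f \<in> ideal_gen ?X" if "f \<in> ideal_gen ?X" for f
        using that by (rule ideal_uminus[OF ideal_gen_ideal[OF XP]])
      have ordered: "minor i j k l \<in> ideal_gen ?X" if "i \<in> {1..m}" "j \<in> {1..m}" "i < j" "{k, l} \<in> edges G"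
        for i j k l
      proof (cases k l rule: linorder_cases)
        case less
        then show ?thesis using that by (intro base)
      next
        case equal
        then show ?thesis by (simp add: ideal_gen_zero)
      next
        case greater
        then have "minor i j l k \<in> ideal_gen ?X" using that by (intro base) (auto simp: insert_commute)
        then show ?thesis by (subst minor_swap_cols) (rule neg)
      qed
      show ?thesis unfolding 2(6)
      proof (cases i j rule: linorder_cases)
        case less
        then show "minor i j k l \<in> ideal_gen ?X" using 2 by (intro ordered)
      next
        case equal
        then show "minor i j k l \<in> ideal_gen ?X" by (simp add: ideal_gen_zero)
      next
        case greater
        then have "minor j i k l \<in> ideal_gen ?X" using 2 by (intro ordered)
        then show "minor i j k l \<in> ideal_gen ?X" by (subst minor_swap_rows) (rule neg)
      qed
    qed
  qed
  have "gen_binomial_edge_ideal m n G = ideal_gen ?X"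
    unfolding gen_binomial_edge_ideal_def base_ring[symmetric] by (rule genideal_ideal_gen[OF XP])
  also have "\<dots> = ideal_gen (graph_gens G)"
    by (intro ideal_gen_eqI XP graph_gens_P GX subset_trans[OF XG] subsetI ideal_gen_base)
  finally have "gen_binomial_edge_quotient m n G = quot"
    by (simp add: gen_binomial_edge_quotient_def quot_def base_ring)
  then show ?thesis using depth_ge_imp_depth[OF d] by (simp add: depth_S_def base_ring)
qed

end

section \<open>Distances and connected components\<close>

definition adj :: "ugraph \<Rightarrow> (nat \<times> nat) set" where
  "adj G = {(a, b). {a, b} \<in> edges G}"

definition conn :: "ugraph \<Rightarrow> nat \<Rightarrow> nat \<Rightarrow> bool" where
  "conn G a b \<longleftrightarrow> (a, b) \<in> (adj G)\<^sup>*"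

definition component :: "ugraph \<Rightarrow> nat \<Rightarrow> nat set" where
  "component G a = {b. conn G a b}"

definition gdist :: "ugraph \<Rightarrow> nat \<Rightarrow> nat \<Rightarrow> nat" where
  "gdist G a b = (LEAST k. (a, b) \<in> adj G ^^ k)"

definition class_diam :: "ugraph \<Rightarrow> nat set \<Rightarrow> nat" where
  "class_diam G C = Max {gdist G a b | a b. a \<in> C \<and> b \<in> C}"

lemma adj_iff: "(a, b) \<in> adj G \<longleftrightarrow> {a, b} \<in> edges G"
  by (simp add: adj_def)

lemma sym_adj: "sym (adj G)"
  by (auto simp: sym_def adj_def insert_commute)

lemma conn_refl [simp]: "conn G a a"
  by (simp add: conn_def)

lemma conn_sym: "conn G a b \<Longrightarrow> conn G b a"
  using sym_rtrancl[OF sym_adj] by (auto simp: conn_def sym_def)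

lemma conn_trans: "conn G a b \<Longrightarrow> conn G b c \<Longrightarrow> conn G a c"
  by (auto simp: conn_def)

lemma conn_edge: "{a, b} \<in> edges G \<Longrightarrow> conn G a b"
  by (auto simp: conn_def adj_def)

lemma conn_iff_relpow: "conn G a b \<longleftrightarrow> (\<exists>k. (a, b) \<in> adj G ^^ k)"
  by (simp add: conn_def rtrancl_is_UN_relpow)

lemma conn_mono: "adj H \<subseteq> adj G \<Longrightarrow> conn H a b \<Longrightarrow> conn G a b"
  unfolding conn_def using rtrancl_mono by blast

lemma conn_verts:
  assumes "G \<in> graphs" "conn G a b" "a \<in> verts G"
  shows "b \<in> verts G"
  using assms(2)[unfolded conn_def]
  by (induction rule: rtrancl_induct) (auto simp: adj_iff assms(3) edge_verts(2)[OF assms(1)])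

lemma component_eq: "conn G a b \<Longrightarrow> component G a = component G b"
  by (auto simp: component_def intro: conn_trans conn_sym)

lemma component_sub: "G \<in> graphs \<Longrightarrow> a \<in> verts G \<Longrightarrow> component G a \<subseteq> verts G"
  by (auto simp: component_def conn_verts)

lemma component_self [simp]: "a \<in> component G a"
  by (simp add: component_def)

lemma gdist_walk: "conn G a b \<Longrightarrow> (a, b) \<in> adj G ^^ gdist G a b"
  unfolding gdist_def conn_iff_relpow by (rule LeastI_ex)

lemma gdist_le: "(a, b) \<in> adj G ^^ k \<Longrightarrow> gdist G a b \<le> k"
  unfolding gdist_def by (rule Least_le)

lemma gdist_triangle: "conn G a b \<Longrightarrow> conn G b c \<Longrightarrow> gdist G a c \<le> gdist G a b + gdist G b c"
  by (rule gdist_le) (auto simp: relpow_add intro: gdist_walk)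

lemma relpow_subset: "(R :: ('a \<times> 'a) set) \<subseteq> S \<Longrightarrow> (a, b) \<in> R ^^ k \<Longrightarrow> (a, b) \<in> S ^^ k"
  by (induction k arbitrary: b) auto

lemma gdist_mono: "adj H \<subseteq> adj G \<Longrightarrow> conn H a b \<Longrightarrow> gdist G a b \<le> gdist H a b"
  by (rule gdist_le) (auto intro: relpow_subset gdist_walk)

lemma gdist_self [simp]: "gdist G a a = 0"
  using gdist_le[where k = 0 and a = a and b = a] by simp

lemma gdist_eq_0: "conn G a b \<Longrightarrow> gdist G a b = 0 \<longleftrightarrow> a = b"
  using gdist_walk[of G a b] by auto

lemma gdist_eq_1: "conn G a b \<Longrightarrow> gdist G a b = 1 \<Longrightarrow> {a, b} \<in> edges G"
  using gdist_walk[of G a b] by (auto simp: adj_iff)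

lemma gdist_ge_2:
  assumes "conn G a b" "a \<noteq> b" "{a, b} \<notin> edges G"
  shows "2 \<le> gdist G a b"
  using gdist_eq_0[OF assms(1)] gdist_eq_1[OF assms(1)] assms(2,3)
    by (cases "gdist G a b = 0 \<or> gdist G a b = 1") auto

lemma gdist_edge: "{a, b} \<in> edges G \<Longrightarrow> gdist G a b \<le> 1"
  by (rule gdist_le) (simp add: adj_iff)

lemma class_diam_ge:
  assumes "finite C" "a \<in> C" "b \<in> C"
  shows "gdist G a b \<le> class_diam G C"
proof -
  have "{gdist G a b | a b. a \<in> C \<and> b \<in> C} = (\<lambda>(a, b). gdist G a b) ` (C \<times> C)" by auto
  then have "finite {gdist G a b | a b. a \<in> C \<and> b \<in> C}" using assms by simp
  then show ?thesis unfolding class_diam_def using assms by (intro Max_ge) auto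
qed

lemma class_diam_attained:
  assumes "finite C" "C \<noteq> {}"
  obtains a b where "a \<in> C" "b \<in> C" "gdist G a b = class_diam G C"
proof -
  have eq: "{gdist G a b | a b. a \<in> C \<and> b \<in> C} = (\<lambda>(a, b). gdist G a b) ` (C \<times> C)" by auto
  have "class_diam G C \<in> {gdist G a b | a b. a \<in> C \<and> b \<in> C}"
    unfolding class_diam_def by (rule Max_in) (use assms in \<open>auto simp: eq\<close>)
  then show ?thesis using that by auto
qed

lemma successively_walk:
  assumes "successively (\<lambda>a b. {a, b} \<in> edges G) p" "p \<noteq> []"
  shows "(hd p, last p) \<in> adj G ^^ (length p - 1)"
  using assms
proof (induction p)
  case (Cons x p)
  show ?case
  proof (cases "p = []")
    case False
    then have "(x, hd p) \<in> adj G" "(hd p, last p) \<in> adj G ^^ (length p - 1)"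
      using Cons by (auto simp: successively_Cons adj_iff)
    then have "(x, last p) \<in> adj G ^^ Suc (length p - 1)" by (rule relpow_Suc_I2)
    then show ?thesis using False by (simp add: Suc_diff_1)
  qed simp
qed simp

text \<open>A repeated vertex would allow a shorter walk.\<close>

lemma shortest_walk_path:
  assumes "G \<in> graphs" "u \<in> verts G" "(u, w) \<in> adj G ^^ k" "\<And>j. j < k \<Longrightarrow> (u, w) \<notin> adj G ^^ j"
  shows "\<exists>p. is_path G u p w \<and> length p = k + 1"
  using assms(2-)
proof (induction k arbitrary: u)
  case 0
  then show ?case by (intro exI[of _ "[u]"]) (auto simp: is_path_def)
next
  case (Suc k)
  obtain x where x: "(u, x) \<in> adj G" "(x, w) \<in> adj G ^^ k"
    using relpow_Suc_D2[OF Suc.prems(2)] by blast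
  have "(x, w) \<notin> adj G ^^ j" if "j < k" for j
    using Suc.prems(3)[of "Suc j"] that relpow_Suc_I2[OF x(1)] by auto
  moreover have "x \<in> verts G" using x edge_verts[OF assms(1)] by (auto simp: adj_iff)
  ultimately obtain p where p: "is_path G x p w" "length p = k + 1" using Suc.IH x by blast
  have succ: "successively (\<lambda>a b. {a, b} \<in> edges G) (u # p)"
    using p x by (auto simp: is_path_def successively_Cons adj_iff)
  have "u \<notin> set p"
  proof
    assume "u \<in> set p"
    then obtain ys zs where yz: "p = ys @ u # zs" by (auto simp: in_set_conv_decomp)
    then have "successively (\<lambda>a b. {a, b} \<in> edges G) (u # zs)"
      using succ by (auto simp: successively_append_iff successively_Cons)
    then have "(hd (u # zs), last (u # zs)) \<in> adj G ^^ (length (u # zs) - 1)"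
      by (rule successively_walk) simp
    moreover have "last (u # zs) = w" using p yz by (auto simp: is_path_def)
    ultimately have "(u, w) \<in> adj G ^^ length zs" by simp
    moreover have "length zs < Suc k" using p yz by simp
    ultimately show False using Suc.prems(3) by blast
  qed
  then have "is_path G u (u # p) w"
    using p succ Suc.prems(1) by (auto simp: is_path_def)
  then show ?case using p by (intro exI[of _ "u # p"]) simp
qed

lemma path_conn: "is_path G u p w \<Longrightarrow> conn G u w"
  using successively_walk[of G p] by (auto simp: is_path_def conn_iff_relpow)

lemma conn_path:
  assumes "G \<in> graphs" "u \<in> verts G" "conn G u w"
  obtains p where "is_path G u p w" "length p = gdist G u w + 1"
proof -
  have "(u, w) \<notin> adj G ^^ j" if "j < gdist G u w" for j
    using gdist_le[where k = j and a = u and b = w and G = G] that by auto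
  then show ?thesis using shortest_walk_path[OF assms(1,2) gdist_walk[OF assms(3)]] that by blast
qed

lemma path_in_component:
  assumes "successively (\<lambda>a b. {a, b} \<in> edges G) p" "p \<noteq> []" "hd p \<in> component G u"
  shows "set p \<subseteq> component G u"
  using assms
proof (induction p)
  case (Cons x p)
  show ?case
  proof (cases "p = []")
    case False
    then have "{x, hd p} \<in> edges G" "successively (\<lambda>a b. {a, b} \<in> edges G) p"
      using Cons.prems by (auto simp: successively_Cons)
    moreover have "conn G u x" using Cons.prems by (simp add: component_def)
    ultimately have "hd p \<in> component G u" by (auto simp: component_def intro: conn_trans conn_edge)
    then show ?thesis using Cons False by (auto simp: successively_Cons)
  qed (use Cons in simp)
qed simp

lemma path_component:
  assumes "G \<in> graphs" "u \<in> verts G"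
  shows "{w. \<exists>p. is_path G u p w} = component G u"
  using conn_path[OF assms] by (auto simp: component_def dest: path_conn)

lemma verts_induced_component: "G \<in> graphs \<Longrightarrow> u \<in> verts G \<Longrightarrow> verts (induced G (component G u)) = component G u"
  using component_sub[of G u] by (auto simp: induced_def)

text \<open>A path that starts in a component stays there, so distances in the component are distances in the graph.\<close>

lemma graph_dist_induced:
  assumes G: "G \<in> graphs" "u \<in> verts G" and ab: "a \<in> component G u" "b \<in> component G u"
  shows "graph_dist (induced G (component G u)) a b = gdist G a b"
proof -
  let ?H = "induced G (component G u)"
  have cab: "conn G a b" using ab by (auto simp: component_def intro: conn_trans conn_sym)
  have aV: "a \<in> verts G" using ab component_sub[OF G] by auto
  have "successively (\<lambda>a b. {a, b} \<in> edges ?H) p \<longleftrightarrow> successively (\<lambda>a b. {a, b} \<in> edges G) p"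
    if "set p \<subseteq> component G u" for p
    by (rule successively_cong) (use that in \<open>auto simp: induced_def\<close>)
  moreover have "successively (\<lambda>a b. {a, b} \<in> edges G) p" if "successively (\<lambda>a b. {a, b} \<in> edges ?H) p" for p
    using that by (rule successively_mono) (auto simp: induced_def)
  ultimately have path: "is_path ?H a p b \<longleftrightarrow> is_path G a p b" for p
    unfolding is_path_def verts_induced_component[OF G]
    using path_in_component[of G p u] ab component_sub[OF G] by blast
  show ?thesis
    unfolding graph_dist_def path
  proof (rule Least_equality)
    show "\<exists>p. is_path G a p b \<and> length p = gdist G a b + 1" using conn_path[OF G(1) aV cab] by blast
  next
    fix k assume "\<exists>p. is_path G a p b \<and> length p = k + 1"
    then obtain p where "is_path G a p b" "length p = k + 1" by blast
    then have "(a, b) \<in> adj G ^^ k" using successively_walk[of G p] by (auto simp: is_path_def)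
    then show "gdist G a b \<le> k" by (rule gdist_le)
  qed
qed

definition components :: "ugraph \<Rightarrow> nat set set" where
  "components G = component G ` verts G"

lemma diam_induced:
  assumes "G \<in> graphs" "C \<in> components G"
  shows "diam (induced G C) = class_diam G C"
proof -
  obtain u where u: "u \<in> verts G" "C = component G u" using assms by (auto simp: components_def)
  have "{graph_dist (induced G C) a b | a b. a \<in> verts (induced G C) \<and> b \<in> verts (induced G C)} =
      {gdist G a b | a b. a \<in> C \<and> b \<in> C}"
    unfolding u(2) verts_induced_component[OF assms(1) u(1)]
    using graph_dist_induced[OF assms(1) u(1)] by (intro Collect_cong) metis
  then show ?thesis by (simp add: diam_def class_diam_def)
qed

lemma graph_components_eq: "G \<in> graphs \<Longrightarrow> graph_components G = induced G ` components G"
  unfolding graph_components_def components_def image_image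
  by (rule image_cong) (auto simp: path_component)

lemma inj_induced: "G \<in> graphs \<Longrightarrow> inj_on (induced G) (components G)"
  by (rule inj_on_inverseI[of _ verts]) (auto simp: components_def verts_induced_component)

lemma num_components_eq: "G \<in> graphs \<Longrightarrow> num_components G = card (components G)"
  unfolding num_components_def graph_components_eq by (rule card_image[OF inj_induced])

lemma d_inv_eq: "G \<in> graphs \<Longrightarrow> d_inv G = num_isolated G + (\<Sum>C\<in>components G. class_diam G C)"
  by (simp add: d_inv_def graph_components_eq sum.reindex[OF inj_induced] diam_induced)

definition isolated_vertices :: "ugraph \<Rightarrow> nat set" where
  "isolated_vertices G = {v \<in> verts G. neighbours G v = {}}"

definition free_vertices :: "ugraph \<Rightarrow> nat set" where
  "free_vertices G = {v. free_vertex G v}"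

lemma Psi0_eq: "G \<in> graphs \<Longrightarrow> Psi0 (complete_graph m) G =
    (m - 2) * card (components G) + card (free_vertices G) + card (isolated_vertices G) + (\<Sum>C\<in>components G. class_diam G C)"
  by (simp add: Psi0_def num_components_eq d_inv_eq num_free_def num_isolated_def isolated_vertices_def
      free_vertices_def complete_graph_def)

lemma free_vertices_sub: "free_vertices G \<subseteq> verts G"
  by (auto simp: free_vertices_def free_vertex_def)

lemma isolated_vertices_iff: "G \<in> graphs \<Longrightarrow> u \<in> isolated_vertices G \<longleftrightarrow> u \<in> verts G \<and> (\<forall>x. {x, u} \<notin> edges G)"
  using neighbours_iff by (auto simp: isolated_vertices_def)

lemma finite_component: "G \<in> graphs \<Longrightarrow> u \<in> verts G \<Longrightarrow> finite (component G u)"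
  using component_sub graphsD(1) finite_subset by blast

lemma finite_components: "G \<in> graphs \<Longrightarrow> finite (components G)"
  by (simp add: components_def graphsD)

section \<open>Changing one component\<close>

lemma adj_delete: "G \<in> graphs \<Longrightarrow> adj (delete_vertex G v) = {(a, b) \<in> adj G. a \<noteq> v \<and> b \<noteq> v}"
  by (auto simp: adj_def edges_delete)

lemma adj_delete_sub: "G \<in> graphs \<Longrightarrow> adj (delete_vertex G v) \<subseteq> adj G"
  by (auto simp: adj_delete)

lemma adj_complete_at: "G \<in> graphs \<Longrightarrow> adj (complete_at G v) =
    adj G \<union> {(a, b). {a, v} \<in> edges G \<and> {b, v} \<in> edges G \<and> a \<noteq> b}"
  by (auto simp: adj_def edges_complete_at)

lemma adj_complete_at_sup: "G \<in> graphs \<Longrightarrow> adj G \<subseteq> adj (complete_at G v)"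
  by (auto simp: adj_complete_at)

lemma conn_complete_at:
  assumes "G \<in> graphs"
  shows "conn (complete_at G v) a b \<longleftrightarrow> conn G a b"
proof
  assume "conn (complete_at G v) a b"
  then show "conn G a b"
    unfolding conn_def
  proof (induction rule: rtrancl_induct)
    case (step c b)
    have "{c, b} \<in> edges G \<or> {c, v} \<in> edges G \<and> {b, v} \<in> edges G"
      using step(2) by (auto simp: adj_iff edges_complete_at[OF assms])
    then have "conn G c b"
      using conn_edge[of c b G] conn_trans[OF conn_edge[of c v G] conn_sym[OF conn_edge[of b v G]]] by blast
    then show ?case using step(3) by (auto simp: conn_def)
  qed simp
next
  assume "conn G a b"
  then show "conn (complete_at G v) a b" by (rule conn_mono[OF adj_complete_at_sup[OF assms]])
qed

text \<open>
  A walk in \<open>G\<^sub>v\<close> that uses new edges can be cut at its first and its last visit to a neighbour of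
  \<open>v\<close> by such an edge; in between, the detour over \<open>v\<close> has length two.
\<close>

lemma complete_at_walk:
  assumes G: "G \<in> graphs" and "(a, b) \<in> adj (complete_at G v) ^^ k"
  shows "(a, b) \<in> adj G ^^ k \<or> (\<exists>s t x y. s + t + 1 \<le> k \<and> (a, x) \<in> adj G ^^ s \<and> {x, v} \<in> edges G \<and>
     {y, v} \<in> edges G \<and> (y, b) \<in> adj G ^^ t)"
  using assms(2)
proof (induction k arbitrary: b)
  case (Suc k)
  then obtain c where c: "(a, c) \<in> adj (complete_at G v) ^^ k" "(c, b) \<in> adj (complete_at G v)" by auto
  show ?case
  proof (cases "(c, b) \<in> adj G")
    case True
    from Suc.IH[OF c(1)] show ?thesis
    proof
      assume "\<exists>s t x y. s + t + 1 \<le> k \<and> (a, x) \<in> adj G ^^ s \<and> {x, v} \<in> edges G \<and>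
         {y, v} \<in> edges G \<and> (y, c) \<in> adj G ^^ t"
      then obtain s t x y where st: "s + t + 1 \<le> k" "(a, x) \<in> adj G ^^ s" "{x, v} \<in> edges G"
         "{y, v} \<in> edges G" "(y, c) \<in> adj G ^^ t" by blast
      have "(y, b) \<in> adj G ^^ Suc t" using st(5) True by auto
      then show ?thesis using st by (intro disjI2 exI[of _ s] exI[of _ "Suc t"] exI[of _ x] exI[of _ y]) auto
    qed (use True in auto)
  next
    case False
    then have n: "{c, v} \<in> edges G" "{b, v} \<in> edges G" using c(2) by (auto simp: adj_complete_at[OF G])
    from Suc.IH[OF c(1)] show ?thesis
    proof
      assume "(a, c) \<in> adj G ^^ k"
      then show ?thesis using n by (intro disjI2 exI[of _ k] exI[of _ 0] exI[of _ c] exI[of _ b]) auto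
    next
      assume "\<exists>s t x y. s + t + 1 \<le> k \<and> (a, x) \<in> adj G ^^ s \<and> {x, v} \<in> edges G \<and>
         {y, v} \<in> edges G \<and> (y, c) \<in> adj G ^^ t"
      then obtain s t x y where st: "s + t + 1 \<le> k" "(a, x) \<in> adj G ^^ s" "{x, v} \<in> edges G" by blast
      then show ?thesis using n by (intro disjI2 exI[of _ s] exI[of _ 0] exI[of _ x] exI[of _ b]) auto
    qed
  qed
qed auto

lemma gdist_complete_at:
  assumes G: "G \<in> graphs" and ab: "conn G a b"
  shows "gdist G a b \<le> gdist (complete_at G v) a b + 1"
proof -
  let ?k = "gdist (complete_at G v) a b"
  have "conn (complete_at G v) a b" using ab by (simp add: conn_complete_at[OF G])
  from complete_at_walk[OF G gdist_walk[OF this]] show ?thesis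
  proof
    assume "(a, b) \<in> adj G ^^ ?k"
    then show ?thesis using gdist_le by fastforce
  next
    assume "\<exists>s t x y. s + t + 1 \<le> ?k \<and> (a, x) \<in> adj G ^^ s \<and> {x, v} \<in> edges G \<and>
     {y, v} \<in> edges G \<and> (y, b) \<in> adj G ^^ t"
    then obtain s t x y where st: "s + t + 1 \<le> ?k" "(a, x) \<in> adj G ^^ s" "{x, v} \<in> edges G"
         "{y, v} \<in> edges G" "(y, b) \<in> adj G ^^ t" by blast
    have "(x, v) \<in> adj G" "(v, y) \<in> adj G" using st by (auto simp: adj_iff insert_commute)
    then have "(a, b) \<in> adj G ^^ (s + (1 + (1 + t)))"
      using st by (subst relpow_add, subst relpow_add, subst relpow_add) auto
    then have "gdist G a b \<le> s + (1 + (1 + t))" by (rule gdist_le)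
    then show ?thesis using st(1) by simp
  qed
qed

lemma free_complete_at:
  assumes G: "G \<in> graphs" and u: "free_vertex G u"
  shows "free_vertex (complete_at G v) u"
  unfolding free_vertex_iff[OF complete_at_graphs[OF G]] edges_complete_at[OF G] verts_complete_at
proof (intro conjI allI impI)
  show "u \<in> verts G" using u by (simp add: free_vertex_iff[OF G])
  have nb: "{x, y} \<in> edges G" if "{x, u} \<in> edges G" "{y, u} \<in> edges G" "x \<noteq> y" for x y
    using u that by (simp add: free_vertex_iff[OF G])
  fix x y
  assume x: "{x, u} \<in> edges G \<or> {x, v} \<in> edges G \<and> {u, v} \<in> edges G \<and> x \<noteq> u"
    and y: "{y, u} \<in> edges G \<or> {y, v} \<in> edges G \<and> {u, v} \<in> edges G \<and> y \<noteq> u" and xy: "x \<noteq> y"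
  show "{x, y} \<in> edges G \<or> {x, v} \<in> edges G \<and> {y, v} \<in> edges G \<and> x \<noteq> y"
  proof (cases "{u, v} \<in> edges G")
    case False
    then show ?thesis using x y xy nb by blast
  next
    case True
    then have vu: "{v, u} \<in> edges G" by (simp add: insert_commute)
    have "z = v \<or> {z, v} \<in> edges G" if "{z, u} \<in> edges G \<or> {z, v} \<in> edges G" for z
      using that nb[OF _ vu] by blast
    then have "x = v \<or> {x, v} \<in> edges G" "y = v \<or> {y, v} \<in> edges G" using x y by blast+
    then show ?thesis using xy by (auto simp: insert_commute)
  qed
qed

lemma free_complete_at_self:
  assumes G: "G \<in> graphs" and v: "v \<in> verts G"
  shows "free_vertex (complete_at G v) v"
  using v unfolding free_vertex_iff[OF complete_at_graphs[OF G]] edges_complete_at[OF G] verts_complete_at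
  by blast

lemma free_delete:
  assumes G: "G \<in> graphs" and D: "delete_vertex G v \<in> graphs" and u: "free_vertex G u" "u \<noteq> v"
  shows "free_vertex (delete_vertex G v) u"
  using u unfolding free_vertex_iff[OF G] free_vertex_iff[OF D] edges_delete[OF G] by auto

lemma local_change_walk:
  assumes agree: "\<And>a b. a \<notin> component G v \<Longrightarrow> (a, b) \<in> adj G' \<longleftrightarrow> (a, b) \<in> adj G" and a: "a \<notin> component G v"
  shows "(a, b) \<in> adj G' ^^ k \<longleftrightarrow> (a, b) \<in> adj G ^^ k"
proof (induction k arbitrary: b)
  case (Suc k)
  have "c \<notin> component G v" if "(a, c) \<in> adj G ^^ k" for c
  proof
    assume "c \<in> component G v"
    moreover have "conn G a c" using that by (auto simp: conn_iff_relpow)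
    ultimately show False using a by (auto simp: component_def intro: conn_trans conn_sym)
  qed
  then show ?case using Suc agree by auto
qed simp

text \<open>
  All three modifications at \<open>v\<close> only affect the component of \<open>v\<close>: the other components stay, with
  their diameters, and \<open>N\<close> is what the component of \<open>v\<close> turns into.
\<close>

lemma local_change_components:
  assumes G: "G \<in> graphs" and G': "G' \<in> graphs"
    and agree: "\<And>a b. a \<notin> component G v \<Longrightarrow> (a, b) \<in> adj G' \<longleftrightarrow> (a, b) \<in> adj G"
    and verts: "verts G' - component G v = verts G - component G v" and v: "v \<in> verts G"
  defines "N \<equiv> component G' ` (verts G' \<inter> component G v)"
  shows "components G' = (components G - {component G v}) \<union> N"
    and "(components G - {component G v}) \<inter> N = {}"
    and "\<And>C. C \<in> components G - {component G v} \<Longrightarrow> class_diam G' C = class_diam G C"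
proof -
  have walk: "(a, b) \<in> adj G' ^^ k \<longleftrightarrow> (a, b) \<in> adj G ^^ k" if "a \<notin> component G v" for a b k
    by (rule local_change_walk[OF agree that])
  have component': "component G' a = component G a" if "a \<notin> component G v" for a
    using walk[OF that] by (auto simp: component_def conn_iff_relpow)
  have other: "C \<in> components G - {component G v} \<longleftrightarrow> (\<exists>a \<in> verts G - component G v. C = component G a)" for C
  proof
    assume C: "C \<in> components G - {component G v}"
    then obtain a where a: "a \<in> verts G" "C = component G a" by (auto simp: components_def)
    have "a \<notin> component G v"
    proof
      assume "a \<in> component G v"
      then have "component G v = component G a" by (intro component_eq) (simp add: component_def)
      then show False using C a by simp
    qed
    then show "\<exists>a \<in> verts G - component G v. C = component G a" using a by blast
  next
    assume "\<exists>a \<in> verts G - component G v. C = component G a"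
    then obtain a where a: "a \<in> verts G" "a \<notin> component G v" "C = component G a" by blast
    then have "component G a \<noteq> component G v" using component_self[of a G] by blast
    then show "C \<in> components G - {component G v}" using a by (auto simp: components_def)
  qed
  have "components G' = component G' ` (verts G' - component G v) \<union> N"
    by (auto simp: components_def N_def)
  also have "component G' ` (verts G' - component G v) = component G ` (verts G - component G v)"
    unfolding verts by (rule image_cong) (auto simp: component')
  also have "\<dots> = components G - {component G v}" using other by blast
  finally show "components G' = (components G - {component G v}) \<union> N" .
  show "(components G - {component G v}) \<inter> N = {}"
  proof (rule ccontr)
    assume "\<not> ?thesis"
    then obtain C where C: "C \<in> components G - {component G v}" "C \<in> N" by blast
    obtain a where a: "a \<in> verts G - component G v" "C = component G a" using C(1) other by blast
    obtain b where b: "b \<in> component G v" "C = component G' b" using C(2) by (auto simp: N_def)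
    have eq: "component G a = component G' b" using a b by simp
    have "b \<in> component G a" using eq by simp
    then have "conn G a b" by (simp add: component_def)
    then have "a \<in> component G v" using b by (auto simp: component_def intro: conn_trans conn_sym)
    then show False using a by blast
  qed
  fix C assume C: "C \<in> components G - {component G v}"
  then obtain c where c: "c \<in> verts G - component G v" "C = component G c" using other by blast
  have "gdist G' a b = gdist G a b" if "a \<in> C" for a b
  proof -
    have "a \<notin> component G v"
    proof
      assume "a \<in> component G v"
      then have "conn G v c" using that c by (auto simp: component_def intro: conn_trans conn_sym)
      then show False using c by (simp add: component_def)
    qed
    then show ?thesis by (simp add: gdist_def walk)
  qed
  then have "{gdist G' a b | a b. a \<in> C \<and> b \<in> C} = {gdist G a b | a b. a \<in> C \<and> b \<in> C}"
    by (intro Collect_cong) metis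
  then show "class_diam G' C = class_diam G C" by (simp add: class_diam_def)
qed

text \<open>
  The bookkeeping for all three modifications. It suffices to make up for the diameter of the component of \<open>v\<close>
  by diameters of new components, newly free vertices \<open>F\<close> and newly isolated vertices \<open>I\<close>, up to
  the allowed loss \<open>e\<close>.
\<close>

lemma Psi0_local_change:
  assumes G: "G \<in> graphs" and G': "G' \<in> graphs"
    and agree: "\<And>a b. a \<notin> component G v \<Longrightarrow> (a, b) \<in> adj G' \<longleftrightarrow> (a, b) \<in> adj G"
    and verts: "verts G' - component G v = verts G - component G v" and v: "v \<in> verts G"
    and ne: "verts G' \<inter> component G v \<noteq> {}"
    and fr: "free_vertices G \<union> F \<subseteq> free_vertices G'" "free_vertices G \<inter> F = {}"
    and iso: "isolated_vertices G \<union> I \<subseteq> isolated_vertices G'" "isolated_vertices G \<inter> I = {}"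
    and N: "N \<subseteq> component G' ` (verts G' \<inter> component G v)"
    and le: "class_diam G (component G v) \<le> (\<Sum>C\<in>N. class_diam G' C) + card F + card I + e"
  shows "Psi0 (complete_graph m) G \<le> Psi0 (complete_graph m) G' + e"
proof -
  let ?N = "component G' ` (verts G' \<inter> component G v)"
  let ?O = "components G - {component G v}"
  have lc: "components G' = ?O \<union> ?N" "?O \<inter> ?N = {}"
    by (rule local_change_components(1,2)[OF G G' _ verts v], erule agree)+
  have lc_diam: "class_diam G' C = class_diam G C" if "C \<in> ?O" for C
    by (rule local_change_components(3)[OF G G' _ verts v that], erule agree)
  have fin: "finite ?N" "finite ?O" "finite (free_vertices G')" "finite (isolated_vertices G')"
    using graphsD(1)[OF G'] finite_components[OF G] free_vertices_sub[of G'] finite_subset by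
      (auto simp: isolated_vertices_def)
  have vC: "component G v \<in> components G" using v by (auto simp: components_def)
  have "card (components G) = card ?O + 1"
    using card.remove[OF finite_components[OF G] vC] by simp
  also have "\<dots> \<le> card ?O + card ?N" using ne fin(1) by (simp add: Suc_le_eq card_gt_0_iff)
  also have "\<dots> = card (components G')" unfolding lc(1) using fin lc(2) by (simp add: card_Un_disjoint)
  finally have 1: "(m - 2) * card (components G) \<le> (m - 2) * card (components G')" by simp
  have finF: "finite (free_vertices G)" "finite F" "finite (isolated_vertices G)" "finite I"
    using fin(3,4) fr(1) iso(1) finite_subset by (metis Un_subset_iff)+
  have "card (free_vertices G) + card F = card (free_vertices G \<union> F)" using finF fr(2) by
    (simp add: card_Un_disjoint)
  also have "\<dots> \<le> card (free_vertices G')" using fr(1) fin(3) by (rule card_mono[rotated])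
  finally have 2: "card (free_vertices G) + card F \<le> card (free_vertices G')" .
  have "card (isolated_vertices G) + card I = card (isolated_vertices G \<union> I)" using finF iso(2) by
    (simp add: card_Un_disjoint)
  also have "\<dots> \<le> card (isolated_vertices G')" using iso(1) fin(4) by (rule card_mono[rotated])
  finally have 3: "card (isolated_vertices G) + card I \<le> card (isolated_vertices G')" .
  have "(\<Sum>C\<in>N. class_diam G' C) \<le> (\<Sum>C\<in>?N. class_diam G' C)" using N fin(1) by (intro sum_mono2) auto
  moreover have "(\<Sum>C\<in>components G. class_diam G C) = class_diam G (component G v) + (\<Sum>C\<in>?O. class_diam G C)"
    by (rule sum.remove[OF finite_components[OF G] vC])
  moreover have "(\<Sum>C\<in>components G'. class_diam G' C) = (\<Sum>C\<in>?O. class_diam G' C) + (\<Sum>C\<in>?N. class_diam G' C)"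
    unfolding lc(1) using fin lc(2) by (simp add: sum.union_disjoint)
  moreover have "(\<Sum>C\<in>?O. class_diam G' C) = (\<Sum>C\<in>?O. class_diam G C)" by (rule sum.cong) (auto simp: lc_diam)
  ultimately show ?thesis unfolding Psi0_eq[OF G] Psi0_eq[OF G'] using 1 2 3 le by linarith
qed

lemma agree_delete:
  assumes G: "G \<in> graphs" and a: "a \<notin> component G v"
  shows "(a, b) \<in> adj (delete_vertex G v) \<longleftrightarrow> (a, b) \<in> adj G"
proof -
  have "a \<noteq> v" using a by auto
  moreover have "b \<noteq> v" if "(a, b) \<in> adj G"
    using that a by (auto simp: component_def adj_iff intro: conn_sym conn_edge)
  ultimately show ?thesis by (auto simp: adj_delete[OF G])
qed

lemma agree_complete_at:
  assumes G: "G \<in> graphs" and a: "a \<notin> component G v"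
  shows "(a, b) \<in> adj (complete_at G v) \<longleftrightarrow> (a, b) \<in> adj G"
proof -
  have "{a, v} \<notin> edges G" using a by (auto simp: component_def intro: conn_sym conn_edge)
  then show ?thesis by (auto simp: adj_complete_at[OF G])
qed

lemma component_complete_at: "G \<in> graphs \<Longrightarrow> component (complete_at G v) a = component G a"
  by (simp add: component_def conn_complete_at)

text \<open>A non-free vertex has neighbours, so no vertex of its component is isolated.\<close>

lemma nonfree_not_isolated:
  assumes G: "G \<in> graphs" and v: "v \<in> verts G" "\<not> free_vertex G v" and u: "u \<in> isolated_vertices G"
  shows "u \<notin> component G v"
proof
  assume "u \<in> component G v"
  then have "conn G u v" by (simp add: component_def conn_sym)
  then show False
    unfolding conn_def
  proof (cases rule: converse_rtranclE)
    case base
    then show ?thesis using u nonfreeE[OF G v] by (metis isolated_vertices_iff[OF G])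
  next
    case (step y)
    then show ?thesis using u by (auto simp: isolated_vertices_iff[OF G] adj_iff insert_commute)
  qed
qed

lemma isolated_local_change:
  assumes G: "G \<in> graphs" and G': "G' \<in> graphs"
    and agree: "\<And>a b. a \<notin> component G v \<Longrightarrow> (a, b) \<in> adj G' \<longleftrightarrow> (a, b) \<in> adj G"
    and verts: "verts G' - component G v = verts G - component G v" and v: "v \<in> verts G" "\<not> free_vertex G v"
  shows "isolated_vertices G \<subseteq> isolated_vertices G'"
proof
  fix u assume u: "u \<in> isolated_vertices G"
  have n: "u \<notin> component G v" by (rule nonfree_not_isolated[OF G v u])
  then have "u \<in> verts G'" using u verts by (auto simp: isolated_vertices_iff[OF G])
  moreover have "{x, u} \<notin> edges G'" for x
    using agree[OF n, of x] u by (auto simp: isolated_vertices_iff[OF G] adj_iff insert_commute)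
  ultimately show "u \<in> isolated_vertices G'" by (simp add: isolated_vertices_iff[OF G'])
qed

text \<open>The diameter drops by at most one, and \<open>v\<close> itself becomes free.\<close>

lemma Psi0_complete_at:
  assumes G: "G \<in> graphs" and v: "v \<in> verts G" "\<not> free_vertex G v"
  shows "Psi0 (complete_graph m) G \<le> Psi0 (complete_graph m) (complete_at G v)"
proof -
  let ?G = "complete_at G v"
  have fin: "finite (component G v)" by (rule finite_component[OF G v(1)])
  obtain a b where ab: "a \<in> component G v" "b \<in> component G v" "gdist G a b = class_diam G (component G v)"
    using class_diam_attained[OF fin] component_self by (metis empty_iff)
  have "conn G a b" using ab by (auto simp: component_def intro: conn_trans conn_sym)
  then have "class_diam G (component G v) \<le> gdist ?G a b + 1" using gdist_complete_at[OF G] ab(3) by metis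
  also have "gdist ?G a b \<le> class_diam ?G (component G v)" by (rule class_diam_ge[OF fin ab(1,2)])
  finally have d: "class_diam G (component G v) \<le> class_diam ?G (component G v) + 1" by simp
  have "Psi0 (complete_graph m) G \<le> Psi0 (complete_graph m) ?G + 0"
  proof (rule Psi0_local_change[OF G complete_at_graphs[OF G] agree_complete_at[OF G] _ v(1), where F = "{v}" and I = "{}" and N = "{component G v}"])
    show "free_vertices G \<union> {v} \<subseteq> free_vertices ?G"
      using free_complete_at[OF G] free_complete_at_self[OF G v(1)] by (auto simp: free_vertices_def)
    show "free_vertices G \<inter> {v} = {}" using v by (simp add: free_vertices_def)
    show "isolated_vertices G \<union> {} \<subseteq> isolated_vertices ?G"
      using isolated_local_change[OF G complete_at_graphs[OF G] agree_complete_at[OF G] _ v] by simp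
    show "verts ?G \<inter> component G v \<noteq> {}" using v(1) component_self[of v G] by auto
    show "{component G v} \<subseteq> component ?G ` (verts ?G \<inter> component G v)"
      using v(1) component_self[of v G] by (auto simp: component_complete_at[OF G])
    show "class_diam G (component G v) \<le> (\<Sum>C\<in>{component G v}. class_diam ?G C) + card {v} + card {} + 0"
      using d by simp
  qed auto
  then show ?thesis by simp
qed

text \<open>
  A walk through \<open>v\<close> enters and leaves \<open>v\<close> by neighbours, which are adjacent in \<open>G\<^sub>v\<close>. The induction
  keeps the last neighbour before \<open>v\<close> while the walk is at \<open>v\<close>.
\<close>

lemma conn_complete_delete:
  assumes G: "G \<in> graphs" and ab: "conn G a b" "a \<noteq> v" "b \<noteq> v"
  shows "conn (delete_vertex (complete_at G v) v) a b"
proof -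
  let ?G = "delete_vertex (complete_at G v) v"
  have edge: "{c, d} \<in> edges ?G \<longleftrightarrow> {c, d} \<in> edges (complete_at G v) \<and> c \<noteq> v \<and> d \<noteq> v" for c d
    by (rule edges_delete[OF complete_at_graphs[OF G]])
  have "(b \<noteq> v \<longrightarrow> conn ?G a b) \<and> (b = v \<longrightarrow> (\<exists>x. {x, v} \<in> edges G \<and> conn ?G a x))"
    using ab(1) unfolding conn_def[of G]
  proof (induction rule: rtrancl_induct)
    case base
    then show ?case using ab(2) by simp
  next
    case (step c b)
    have cb: "{c, b} \<in> edges G" "c \<noteq> b" using step(2) edge_verts(3)[OF G] by (auto simp: adj_iff)
    show ?case
    proof (cases "c = v")
      case True
      then obtain x where x: "{x, v} \<in> edges G" "conn ?G a x" using step by blast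
      have bv: "{b, v} \<in> edges G" "b \<noteq> v" using cb True by (auto simp: insert_commute)
      have "conn ?G x b"
      proof (cases "x = b")
        case False
        then have "{x, b} \<in> edges ?G"
          using x bv edge_verts(3)[OF G x(1)] by (simp add: edge edges_complete_at[OF G])
        then show ?thesis by (rule conn_edge)
      qed simp
      then show ?thesis using x bv by (auto intro: conn_trans)
    next
      case False
      then have c: "conn ?G a c" using step by blast
      show ?thesis
      proof (cases "b = v")
        case True
        then show ?thesis using c cb by auto
      next
        case b: False
        then have "{c, b} \<in> edges ?G" using cb False by (simp add: edge edges_complete_at[OF G])
        then show ?thesis using c b by (auto intro: conn_trans conn_edge)
      qed
    qed
  qed
  then show ?thesis using ab(3) by blast
qed

text \<open>Completing at \<open>v\<close> shortens a distance by at most one, and deleting \<open>v\<close> shortens none.\<close>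

lemma Psi0_complete_delete:
  assumes G: "G \<in> graphs" and v: "v \<in> verts G" "\<not> free_vertex G v"
    and uw: "u \<in> component G v" "w \<in> component G v" "u \<noteq> v" "w \<noteq> v" "gdist G u w =
      class_diam G (component G v)"
  shows "Psi0 (complete_graph m) G \<le> Psi0 (complete_graph m) (delete_vertex (complete_at G v) v) + 1"
proof -
  let ?H = "complete_at G v" let ?G = "delete_vertex ?H v"
  have H: "?H \<in> graphs" by (rule complete_at_graphs[OF G])
  have G': "?G \<in> graphs" using nonfree_not_singleton[OF G v] by (intro delete_vertex_graphs[OF H]) simp
  have agree: "(a, b) \<in> adj ?G \<longleftrightarrow> (a, b) \<in> adj G" if "a \<notin> component G v" for a b
    using agree_delete[OF H, of a v b] agree_complete_at[OF G that, of b] that by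
      (simp add: component_complete_at[OF G])
  have vs: "verts ?G - component G v = verts G - component G v" by auto
  have uV: "u \<in> verts ?G \<inter> component G v" using uw component_sub[OF G v(1)] by auto
  have cG: "conn G u w" using uw by (auto simp: component_def intro: conn_trans conn_sym)
  have c: "conn ?G u w" using conn_complete_delete[OF G cG] uw by simp
  have cH: "conn ?H u w" using cG by (simp add: conn_complete_at[OF G])
  have "class_diam G (component G v) \<le> gdist ?H u w + 1" using gdist_complete_at[OF G cG, of v] uw(5) by simp
  also have "gdist ?H u w \<le> gdist ?G u w" by (rule gdist_mono[OF adj_delete_sub[OF H] c])
  also have "gdist ?G u w \<le> class_diam ?G (component ?G u)"
    using uV c by (intro class_diam_ge finite_component[OF G']) (auto simp: component_def)
  finally have d: "class_diam G (component G v) \<le> class_diam ?G (component ?G u) + 1" by simp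
  show ?thesis
  proof (rule Psi0_local_change[OF G G' agree vs v(1), where F = "{}" and I = "{}" and N = "{component ?G u}"])
    show "free_vertices G \<union> {} \<subseteq> free_vertices ?G"
      using free_delete[OF H G' free_complete_at[OF G]] v(2) by (auto simp: free_vertices_def)
    show "isolated_vertices G \<union> {} \<subseteq> isolated_vertices ?G" using isolated_local_change[OF G G' agree vs v]
      by simp
    show "verts ?G \<inter> component G v \<noteq> {}" using uV by blast
    show "{component ?G u} \<subseteq> component ?G ` (verts ?G \<inter> component G v)" using uV by blast
    show "class_diam G (component G v) \<le> (\<Sum>C\<in>{component ?G u}. class_diam ?G C) + card {} + card {} + 1"
      using d by simp
  qed auto
qed

section \<open>Deleting a separating vertex\<close>

lemma components_partition:
  assumes "G \<in> graphs"
  shows "partition_on (verts G) (components G)"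
proof (rule partition_onI)
  show "\<Union> (components G) = verts G" using component_sub[OF assms] by (auto simp: components_def)
  fix C D assume "C \<in> components G" "D \<in> components G" "C \<noteq> D"
  then obtain a b where ab: "C = component G a" "D = component G b" "component G a \<noteq> component G b" by
    (auto simp: components_def)
  have "\<not> conn G a b" using ab component_eq by blast
  then show "disjnt C D" unfolding ab disjnt_iff by (auto simp: component_def intro: conn_trans conn_sym)
qed (auto simp: components_def intro: component_self)

lemma disjoint_union_components:
  assumes G: "G \<in> graphs" and Q: "disjoint_union_of_complete G Q"
  shows "components G = Q" and "\<And>B a b. B \<in> Q \<Longrightarrow> a \<in> B \<Longrightarrow> b \<in> B \<Longrightarrow> a \<noteq> b \<Longrightarrow> {a, b} \<in> edges G"
proof -
  have part: "\<Union> Q = verts G" "disjoint Q" "{} \<notin> Q" and E: "edges G = (\<Union>B\<in>Q. all_pairs B)"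
    using Q by (auto simp: disjoint_union_of_complete_def partition_on_def)
  show e: "{a, b} \<in> edges G" if "B \<in> Q" "a \<in> B" "b \<in> B" "a \<noteq> b" for B a b
    unfolding E using that by (intro UN_I[of B]) auto
  have eB: "b \<in> B" if "B \<in> Q" "a \<in> B" and ab: "{a, b} \<in> edges G" for a b B
  proof -
    obtain B' where "B' \<in> Q" "{a, b} \<in> all_pairs B'" using ab unfolding E by blast
    then have "a \<in> B'" "b \<in> B'" "B' \<in> Q" by simp_all
    moreover have "B' = B" using \<open>a \<in> B'\<close> \<open>B' \<in> Q\<close> that(1,2) part(2) unfolding disjoint_def by blast
    ultimately show ?thesis by simp
  qed
  have component: "component G a = B" if B: "B \<in> Q" "a \<in> B" for a B
  proof
    show "component G a \<subseteq> B"
    proof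
      fix b assume "b \<in> component G a"
      then have "(a, b) \<in> (adj G)\<^sup>*" by (simp add: component_def conn_def)
      then show "b \<in> B" by (induction rule: rtrancl_induct) (auto simp: adj_iff B eB[OF B(1)])
    qed
    show "B \<subseteq> component G a"
    proof
      fix b assume "b \<in> B"
      then show "b \<in> component G a" using e[OF B, of b] by (cases "a = b")
        (auto simp: component_def intro: conn_edge)
    qed
  qed
  show "components G = Q"
  proof
    show "components G \<subseteq> Q"
    proof
      fix C assume "C \<in> components G"
      then obtain a where a: "a \<in> verts G" "C = component G a" by (auto simp: components_def)
      then obtain B where "B \<in> Q" "a \<in> B" using part(1) by blast
      then show "C \<in> Q" using a component by simp
    qed
    show "Q \<subseteq> components G"
    proof
      fix B assume B: "B \<in> Q"
      then obtain a where "a \<in> B" using part(3) by (metis all_not_in_conv)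
      then have "a \<in> verts G" "component G a = B" using B part(1) component by auto
      then show "B \<in> components G" by (auto simp: components_def)
    qed
  qed
qed

text \<open>
  Each block contributes at most one to \<open>d(G)\<close>: an isolated vertex by being isolated, a larger
  complete graph by its diameter.
\<close>

lemma Psi0_complete:
  assumes G: "G \<in> graphs" and m: "2 \<le> m" and Q: "disjoint_union_of_complete G Q"
  shows "Psi0 (complete_graph m) G \<le> card Q * (m - 1) + (\<Sum>B\<in>Q. card B)"
proof -
  note cl = disjoint_union_components[OF G Q]
  have part: "partition_on (verts G) Q" using Q by (simp add: disjoint_union_of_complete_def)
  have finQ: "finite Q" using finite_components[OF G] by (simp add: cl)
  have finB: "finite B" if "B \<in> Q" for B
    using that part graphsD(1)[OF G] by (auto simp: partition_on_def intro: finite_subset[of B "verts G"])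
  have "card (verts G) = card (\<Union>Q)" using part by (simp add: partition_on_def)
  also have "\<dots> = (\<Sum>B\<in>Q. card B)" using part finB by (intro card_Union_disjoint) (auto simp: partition_on_def)
  finally have 1: "card (free_vertices G) \<le> (\<Sum>B\<in>Q. card B)"
    using card_mono[OF graphsD(1)[OF G] free_vertices_sub] by simp
  let ?S = "{B \<in> Q. \<exists>u. B = {u}}"
  have "(\<lambda>u. {u}) ` isolated_vertices G \<subseteq> ?S"
  proof clarify
    fix u assume u: "u \<in> isolated_vertices G"
    have "u \<in> verts G" using u by (simp add: isolated_vertices_def)
    then have "component G u \<in> Q" unfolding cl(1)[symmetric] by (simp add: components_def)
    moreover have "component G u = {u}"
    proof -
      have "b = u" if "b \<in> component G u" for b
        using cl(2)[OF \<open>component G u \<in> Q\<close> that component_self] u by (auto simp: isolated_vertices_iff[OF G])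
      then show ?thesis using component_self[of u G] by blast
    qed
    ultimately show "{u} \<in> Q \<and> (\<exists>v. {u} = {v})" by simp
  qed
  then have "card (isolated_vertices G) \<le> card ?S" using finQ by (intro card_inj_on_le[of "\<lambda>u. {u}"]) auto
  moreover have "(\<Sum>B\<in>Q. class_diam G B) \<le> (\<Sum>B\<in>Q. if \<exists>u. B = {u} then 0 else 1)"
  proof (rule sum_mono)
    fix B assume B: "B \<in> Q"
    have "B \<noteq> {}" using B part by (auto simp: partition_on_def)
    then obtain a b where ab: "a \<in> B" "b \<in> B" "gdist G a b = class_diam G B"
      using class_diam_attained[OF finB[OF B]] by metis
    show "class_diam G B \<le> (if \<exists>u. B = {u} then 0 else 1)"
    proof (cases "a = b")
      case True
      then show ?thesis using ab by auto
    next
      case False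
      then have "\<not> (\<exists>u. B = {u})" using ab by auto
      moreover have "gdist G a b \<le> 1" using cl(2)[OF B ab(1,2) False] by (rule gdist_edge)
      ultimately show ?thesis using ab by simp
    qed
  qed
  moreover have "(\<Sum>B\<in>Q. if \<exists>u. B = {u} then 0 else 1) = card (Q - ?S)"
  proof -
    have "(\<Sum>B\<in>Q. if \<exists>u. B = {u} then 0 else (1::nat)) = (\<Sum>B\<in>Q - ?S. 1)"
      using finQ by (intro sum.mono_neutral_cong_right) auto
    then show ?thesis by simp
  qed
  moreover have "card ?S + card (Q - ?S) = card Q"
  proof -
    have "card (Q - ?S) = card Q - card ?S" using finQ by (intro card_Diff_subset) auto
    moreover have "card ?S \<le> card Q" using finQ by (intro card_mono) auto
    ultimately show ?thesis by simp
  qed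
  ultimately have 2: "card (isolated_vertices G) + (\<Sum>B\<in>Q. class_diam G B) \<le> card Q" by linarith
  obtain k where "m = 2 + k" using le_Suc_ex[OF m] by blast
  then have "card Q * (m - 1) = (m - 2) * card Q + card Q" by (simp add: algebra_simps)
  then show ?thesis using 1 2 by (simp add: Psi0_eq[OF G] cl(1))
qed

lemma disjoint_unionI:
  assumes G: "G \<in> graphs"
    and complete: "\<And>a b. conn G a b \<Longrightarrow> a \<in> verts G \<Longrightarrow> a \<noteq> b \<Longrightarrow> {a, b} \<in> edges G"
  shows "disjoint_union_of_complete G (components G)"
  unfolding disjoint_union_of_complete_def
proof
  show "partition_on (verts G) (components G)" by (rule components_partition[OF G])
  show "edges G = (\<Union>B\<in>components G. all_pairs B)"
  proof
    show "edges G \<subseteq> (\<Union>B\<in>components G. all_pairs B)"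
    proof
      fix e assume e: "e \<in> edges G"
      then obtain a b where ab: "e = {a, b}" "a \<in> verts G" "a \<noteq> b" using graphsD(3)[OF G]
        by (blast elim: all_pairsE)
      then have "b \<in> component G a" using e by (simp add: component_def conn_edge)
      then show "e \<in> (\<Union>B\<in>components G. all_pairs B)"
        using ab by (intro UN_I[of "component G a"]) (auto simp: components_def)
    qed
    show "(\<Union>B\<in>components G. all_pairs B) \<subseteq> edges G"
    proof
      fix e assume "e \<in> (\<Union>B\<in>components G. all_pairs B)"
      then obtain u where u: "u \<in> verts G" "e \<in> all_pairs (component G u)" by (auto simp: components_def)
      then obtain a b where ab: "e = {a, b}" "a \<in> component G u" "b \<in> component G u" "a \<noteq> b"
        by (blast elim: all_pairsE)
      have "conn G a b" using ab by (auto simp: component_def intro: conn_trans conn_sym)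
      moreover have "a \<in> verts G" using ab component_sub[OF G u(1)] by auto
      ultimately show "e \<in> edges G" using complete ab by simp
    qed
  qed
qed

lemma conn_delete_walk:
  assumes G: "G \<in> graphs" and st: "s \<le> t"
    and e: "\<And>l. s \<le> l \<Longrightarrow> l < t \<Longrightarrow> {f l, f (Suc l)} \<in> edges G"
    and nv: "\<And>l. s \<le> l \<Longrightarrow> l \<le> t \<Longrightarrow> f l \<noteq> v"
  shows "conn (delete_vertex G v) (f s) (f t)"
  using st e nv
proof (induction t rule: dec_induct)
  case (step t)
  then have "conn (delete_vertex G v) (f s) (f t)" by simp
  moreover have "{f t, f (Suc t)} \<in> edges (delete_vertex G v)"
    using step by (simp add: edges_delete[OF G])
  ultimately show ?case by (auto intro: conn_trans conn_edge)
qed simp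

text \<open>A shortest walk must pass through a separating vertex.\<close>

lemma separating_gdist:
  assumes G: "G \<in> graphs" and ab: "conn G a b" and sep: "\<not> conn (delete_vertex G v) a b"
  shows "gdist G a v + gdist G v b \<le> gdist G a b"
proof -
  let ?k = "gdist G a b"
  obtain f where f: "f 0 = a" "f ?k = b" "\<And>i. i < ?k \<Longrightarrow> (f i, f (Suc i)) \<in> adj G"
    using gdist_walk[OF ab] unfolding relpow_fun_conv by blast
  have "\<exists>l\<le>?k. f l = v"
  proof (rule ccontr)
    assume "\<not> ?thesis"
    then have "conn (delete_vertex G v) (f 0) (f ?k)"
      using f(3) by (intro conn_delete_walk[OF G]) (auto simp: adj_iff)
    then show False using sep f by simp
  qed
  then obtain l where l: "l \<le> ?k" "f l = v" by blast
  have "(a, v) \<in> adj G ^^ l"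
    unfolding relpow_fun_conv using f l by (intro exI[of _ f]) auto
  moreover have "(v, b) \<in> adj G ^^ (?k - l)"
    unfolding relpow_fun_conv using f l by (intro exI[of _ "\<lambda>i. f (l + i)"]) auto
  ultimately show ?thesis using gdist_le[of a v l G] gdist_le[of v b "?k - l" G] l
    by (metis add_mono le_add_diff_inverse)
qed

lemma geodesic:
  assumes "conn G u w"
  obtains f where "f 0 = u" "f (gdist G u w) = w" "\<And>i. i < gdist G u w \<Longrightarrow> {f i, f (Suc i)} \<in> edges G"
    "\<And>i j. i \<le> j \<Longrightarrow> j \<le> gdist G u w \<Longrightarrow> gdist G (f i) (f j) = j - i"
proof -
  let ?k = "gdist G u w"
  obtain f where f: "f 0 = u" "f ?k = w" "\<And>i. i < ?k \<Longrightarrow> (f i, f (Suc i)) \<in> adj G"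
    using gdist_walk[OF assms] unfolding relpow_fun_conv by blast
  have walk: "(f i, f j) \<in> adj G ^^ (j - i)" if "i \<le> j" "j \<le> ?k" for i j
    unfolding relpow_fun_conv using f that by (intro exI[of _ "\<lambda>l. f (i + l)"]) auto
  have con: "conn G (f i) (f j)" if "i \<le> j" "j \<le> ?k" for i j
    using walk[OF that] by (auto simp: conn_iff_relpow)
  have "gdist G (f i) (f j) = j - i" if ij: "i \<le> j" "j \<le> ?k" for i j
  proof -
    have le: "gdist G (f i) (f j) \<le> j - i" "gdist G (f 0) (f i) \<le> i" "gdist G (f j) (f ?k) \<le> ?k - j"
      using walk[of i j] walk[of 0 i] walk[of j ?k] ij gdist_le by fastforce+
    have "?k \<le> gdist G (f 0) (f i) + gdist G (f i) (f ?k)"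
      using gdist_triangle[OF con[of 0 i] con[of i ?k]] ij f by simp
    moreover have "gdist G (f i) (f ?k) \<le> gdist G (f i) (f j) + gdist G (f j) (f ?k)"
      using gdist_triangle[OF con[of i j] con[of j ?k]] ij by simp
    ultimately show ?thesis using le ij by linarith
  qed
  then show ?thesis using f that by (simp add: adj_iff)
qed

definition new_frees :: "ugraph \<Rightarrow> nat \<Rightarrow> nat set" where
  "new_frees G v = free_vertices (delete_vertex G v) - free_vertices G"

definition new_isolated :: "ugraph \<Rightarrow> nat \<Rightarrow> nat set" where
  "new_isolated G v = isolated_vertices (delete_vertex G v) - isolated_vertices G"

text \<open>
  What the component of \<open>z\<close> in \<open>G - v\<close> contributes to the invariant of \<open>G - v\<close> beyond the free
  and isolated vertices that \<open>G\<close> already has.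
\<close>

definition side_gain :: "ugraph \<Rightarrow> nat \<Rightarrow> nat \<Rightarrow> nat" where
  "side_gain G v z = (let C = component (delete_vertex G v) z in
     class_diam (delete_vertex G v) C + card (new_frees G v \<inter> C) + card (new_isolated G v \<inter> C))"

context
  fixes G v assumes G: "G \<in> graphs" and v: "v \<in> verts G" "\<not> free_vertex G v"
begin

lemma delete_in_graphs: "delete_vertex G v \<in> graphs"
  by (rule delete_vertex_graphs[OF G nonfree_not_singleton[OF G v]])

lemma Psi0_delete_aux:
  assumes N: "N \<subseteq> component (delete_vertex G v) ` (verts (delete_vertex G v) \<inter> component G v)" "N \<noteq> {}"
    and le: "class_diam G (component G v) \<le> (\<Sum>C\<in>N. class_diam (delete_vertex G v) C) + card (new_frees G v) +
      card (new_isolated G v)"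
  shows "Psi0 (complete_graph m) G \<le> Psi0 (complete_graph m) (delete_vertex G v)"
proof -
  let ?G = "delete_vertex G v"
  have vs: "verts ?G - component G v = verts G - component G v" by auto
  have "Psi0 (complete_graph m) G \<le> Psi0 (complete_graph m) ?G + 0"
  proof (rule Psi0_local_change[OF G delete_in_graphs agree_delete[OF G] vs v(1), where F = "new_frees G v" and I = "new_isolated G v" and N = N])
    show "free_vertices G \<union> new_frees G v \<subseteq> free_vertices ?G"
      using free_delete[OF G delete_in_graphs] v(2) by (auto simp: free_vertices_def new_frees_def)
    show "isolated_vertices G \<union> new_isolated G v \<subseteq> isolated_vertices ?G"
      using isolated_local_change[OF G delete_in_graphs agree_delete[OF G] vs v] by
        (auto simp: new_isolated_def)
    show "verts ?G \<inter> component G v \<noteq> {}" using N by auto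
  qed (use N le in \<open>auto simp: new_frees_def new_isolated_def\<close>)
  then show ?thesis by simp
qed

lemma Psi0_delete_nonseparating:
  assumes uw: "u \<in> component G v" "gdist G u w = class_diam G (component G v)"
    and c: "conn (delete_vertex G v) u w" and uv: "u \<noteq> v"
  shows "Psi0 (complete_graph m) G \<le> Psi0 (complete_graph m) (delete_vertex G v)"
proof (rule Psi0_delete_aux[of "{component (delete_vertex G v) u}"])
  let ?G = "delete_vertex G v"
  have uV: "u \<in> verts ?G" using uw uv component_sub[OF G v(1)] by auto
  then show "{component ?G u} \<subseteq> component ?G ` (verts ?G \<inter> component G v)" using uw by auto
  have "class_diam G (component G v) \<le> gdist ?G u w" using gdist_mono[OF adj_delete_sub[OF G] c] uw by simp
  also have "\<dots> \<le> class_diam ?G (component ?G u)" using c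
    by (intro class_diam_ge finite_component[OF delete_in_graphs uV]) (auto simp: component_def)
  finally show "class_diam G (component G v) \<le> (\<Sum>C\<in>{component ?G u}. class_diam ?G C) + card (new_frees G v) +
    card (new_isolated G v)"
    by simp
qed simp

lemma Psi0_delete_separating:
  assumes uw: "u \<in> component G v" "w \<in> component G v" "u \<noteq> v" "w \<noteq> v"
    and sep: "\<not> conn (delete_vertex G v) u w"
    and le: "class_diam G (component G v) \<le> side_gain G v u + side_gain G v w"
  shows "Psi0 (complete_graph m) G \<le> Psi0 (complete_graph m) (delete_vertex G v)"
proof -
  let ?G = "delete_vertex G v"
  let ?A = "component ?G u" and ?B = "component ?G w"
  have dis: "?A \<inter> ?B = {}" using sep by (auto simp: component_def intro: conn_trans conn_sym)
  have ne: "?A \<noteq> ?B" using dis component_self by blast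
  have uV: "u \<in> verts ?G" "w \<in> verts ?G" using uw component_sub[OF G v(1)] by auto
  have fin: "finite (new_frees G v)" "finite (new_isolated G v)"
    using graphsD(1)[OF delete_in_graphs] finite_subset[OF free_vertices_sub[of ?G] graphsD(1)[OF delete_in_graphs]]
    by (auto simp: new_frees_def new_isolated_def isolated_vertices_def)
  have split: "card (F \<inter> ?A) + card (F \<inter> ?B) \<le> card F" if "finite F" for F
  proof -
    have "card (F \<inter> ?A) + card (F \<inter> ?B) = card ((F \<inter> ?A) \<union> (F \<inter> ?B))"
      using that dis by (intro card_Un_disjoint[symmetric]) auto
    also have "\<dots> \<le> card F" using that by (intro card_mono) auto
    finally show ?thesis .
  qed
  show ?thesis
  proof (rule Psi0_delete_aux[of "{?A, ?B}"])
    show "{?A, ?B} \<subseteq> component ?G ` (verts ?G \<inter> component G v)" using uV uw by auto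
    show "class_diam G (component G v) \<le> (\<Sum>C\<in>{?A, ?B}. class_diam ?G C) + card (new_frees G v) +
      card (new_isolated G v)"
      using le ne split[OF fin(1)] split[OF fin(2)] by (simp add: side_gain_def Let_def)
  qed simp
qed

text \<open>A neighbour of \<open>v\<close> becomes isolated or lies in a component of positive diameter.\<close>

lemma side_gain_adjacent:
  assumes z: "{z, v} \<in> edges G"
  shows "1 \<le> side_gain G v z"
proof -
  let ?G = "delete_vertex G v" and ?C = "component (delete_vertex G v) z"
  have zV: "z \<in> verts ?G" using edge_verts[OF G z] by simp
  have fin: "finite ?C" by (rule finite_component[OF delete_in_graphs zV])
  show ?thesis
  proof (cases "z \<in> isolated_vertices ?G")
    case True
    moreover have "z \<notin> isolated_vertices G" using z by (auto simp: isolated_vertices_iff[OF G] insert_commute)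
    ultimately have "z \<in> new_isolated G v \<inter> ?C" by (simp add: new_isolated_def)
    moreover have "finite (new_isolated G v \<inter> ?C)" using fin by simp
    ultimately have "card (new_isolated G v \<inter> ?C) > 0" by (auto simp: card_gt_0_iff)
    then show ?thesis by (simp add: side_gain_def Let_def)
  next
    case False
    then obtain x where x: "{x, z} \<in> edges ?G" using zV by
      (auto simp: isolated_vertices_iff[OF delete_in_graphs])
    have c: "conn ?G z x" by (rule conn_sym[OF conn_edge[OF x]])
    have "gdist ?G z x \<noteq> 0" using gdist_eq_0[OF c] edge_verts(3)[OF delete_in_graphs x] by auto
    moreover have "gdist ?G z x \<le> class_diam ?G ?C" using c fin by (intro class_diam_ge)
      (auto simp: component_def)
    ultimately show ?thesis by (simp add: side_gain_def Let_def)
  qed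
qed

lemma side_gain_dist:
  assumes "conn (delete_vertex G v) z a" "conn (delete_vertex G v) z b" "z \<in> verts G" "z \<noteq> v"
  shows "gdist G a b \<le> side_gain G v z"
proof -
  let ?G = "delete_vertex G v"
  have c: "conn ?G a b" using assms by (auto intro: conn_trans conn_sym)
  have "gdist G a b \<le> gdist ?G a b" by (rule gdist_mono[OF adj_delete_sub[OF G] c])
  also have "\<dots> \<le> class_diam ?G (component ?G z)" using assms
    by (intro class_diam_ge finite_component[OF delete_in_graphs]) (auto simp: component_def)
  finally show ?thesis by (simp add: side_gain_def Let_def)
qed

lemma side_gain_new_free:
  assumes "conn (delete_vertex G v) z a" "conn (delete_vertex G v) z b" "z \<in> verts G" "z \<noteq> v"
    and y: "conn (delete_vertex G v) z y" "free_vertex (delete_vertex G v) y" "\<not> free_vertex G y"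
  shows "gdist G a b + 1 \<le> side_gain G v z"
proof -
  let ?G = "delete_vertex G v"
  have c: "conn ?G a b" using assms by (auto intro: conn_trans conn_sym)
  have fin: "finite (component ?G z)" using assms by (intro finite_component[OF delete_in_graphs]) auto
  have "gdist G a b \<le> gdist ?G a b" by (rule gdist_mono[OF adj_delete_sub[OF G] c])
  also have "\<dots> \<le> class_diam ?G (component ?G z)" using assms by (intro class_diam_ge fin)
    (auto simp: component_def)
  finally have "gdist G a b \<le> class_diam ?G (component ?G z)" .
  moreover have "y \<in> new_frees G v \<inter> component ?G z" using y by
    (simp add: new_frees_def free_vertices_def component_def)
  then have "card (new_frees G v \<inter> component ?G z) > 0" using fin by (auto simp: card_gt_0_iff)
  ultimately show ?thesis by (simp add: side_gain_def Let_def)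
qed

end

section \<open>The choice of the vertex\<close>

text \<open>
  The hypothesis \<open>bad\<close> in the second case says that every non-free vertex separates every
  pair at maximal distance in the component. It is used for the fixed pair \<open>(u, w)\<close> and, when the path
  ends at \<open>v\<^bsub>i+2\<^esub> = w\<close>, for a second pair \<open>(u, x)\<close> and the vertex \<open>w\<close>, which then is non-free and does not
  separate it.
\<close>

lemma exists_good_vertex:
  assumes G: "G \<in> graphs" and nd: "\<nexists>P. disjoint_union_of_complete G P"
  shows "\<exists>v u w. v \<in> verts G \<and> \<not> free_vertex G v \<and> u \<in> component G v \<and> w \<in> component G v \<and> u \<noteq> v \<and> w \<noteq> v \<and>
    gdist G u w = class_diam G (component G v) \<and>
    (\<forall>m. Psi0 (complete_graph m) G \<le> Psi0 (complete_graph m) (delete_vertex G v))"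
proof -
  obtain a b where ab: "conn G a b" "a \<in> verts G" "a \<noteq> b" "{a, b} \<notin> edges G"
    using disjoint_unionI[OF G] nd by blast
  define C where "C = component G a"
  define d where "d = class_diam G C"
  have fin: "finite C" unfolding C_def by (rule finite_component[OF G ab(2)])
  have CV: "C \<subseteq> verts G" unfolding C_def by (rule component_sub[OF G ab(2)])
  have component: "component G v = C" if "v \<in> C" for v
    using component_eq[of G a v] that by (simp add: C_def component_def)
  have C_conn: "conn G x y" if "x \<in> C" "y \<in> C" for x y
    using that by (auto simp: C_def component_def intro: conn_trans conn_sym)
  have d2: "2 \<le> d"
    using gdist_ge_2[OF ab(1,3,4)] class_diam_ge[OF fin, of a b G] ab(1) by
      (simp add: d_def C_def component_def)
  show ?thesis
  proof (cases "\<exists>u w v. u \<in> C \<and> w \<in> C \<and> gdist G u w = d \<and> v \<in> C \<and> \<not> free_vertex G v \<and> u \<noteq> v \<and> w \<noteq> v \<and>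
      conn (delete_vertex G v) u w")
    case True
    then obtain u w v where uw: "u \<in> C" "w \<in> C" "gdist G u w = d" "u \<noteq> v" "w \<noteq> v"
      and v: "v \<in> C" "\<not> free_vertex G v" and c: "conn (delete_vertex G v) u w" by blast
    have vV: "v \<in> verts G" using v CV by auto
    have "Psi0 (complete_graph m) G \<le> Psi0 (complete_graph m) (delete_vertex G v)" for m
      using uw c by (intro Psi0_delete_nonseparating[OF G vV v(2), of u w])
        (auto simp: component[OF v(1)] d_def)
    then show ?thesis using uw v vV component[OF v(1)] d_def by blast
  next
    case bad: False
    obtain u w where uw: "u \<in> C" "w \<in> C" "gdist G u w = d"
      using class_diam_attained[OF fin] component_self[of a G] unfolding d_def C_def by (metis empty_iff)
    have cuw: "conn G u w" by (rule C_conn[OF uw(1,2)])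
    obtain f where f0: "f 0 = u" and fd: "f d = w" and fe: "\<And>i. i < d \<Longrightarrow> {f i, f (Suc i)} \<in> edges G"
      and fdist: "\<And>i j. i \<le> j \<Longrightarrow> j \<le> d \<Longrightarrow> gdist G (f i) (f j) = j - i"
      using geodesic[OF cuw] unfolding uw(3) by blast
    have f_conn: "conn G u (f i)" if "i \<le> d" for i
      using that
    proof (induction i)
      case (Suc i)
      then show ?case using fe[of i] by (auto intro: conn_trans conn_edge)
    qed (simp add: f0)
    have fC: "f i \<in> C" if "i \<le> d" for i
      using f_conn[OF that] uw(1) by (auto simp: C_def component_def intro: conn_trans)
    have f_ne: "f i \<noteq> f j" if "i < j" "j \<le> d" for i j
      using fdist[of i j] that by auto
    have nonfree: "\<not> free_vertex G (f i)" if i: "1 \<le> i" "i < d" for i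
    proof
      assume free: "free_vertex G (f i)"
      have "{f (i - 1), f i} \<in> edges G" using fe[of "i - 1"] i by simp
      moreover have "{f (Suc i), f i} \<in> edges G" using fe[of i] i by (simp add: insert_commute)
      moreover have "f (i - 1) \<noteq> f (Suc i)" using f_ne[of "i - 1" "Suc i"] i by simp
      ultimately have "{f (i - 1), f (Suc i)} \<in> edges G" using free by (simp add: free_vertex_iff[OF G])
      then have "gdist G (f (i - 1)) (f (Suc i)) \<le> 1" by (rule gdist_edge)
      moreover have "gdist G (f (i - 1)) (f (Suc i)) = 2" using fdist[of "i - 1" "Suc i"] i by auto
      ultimately show False by simp
    qed
    have not_end: "u \<noteq> f i" "w \<noteq> f i" if "1 \<le> i" "i < d" for i
      using f_ne[of 0 i] f_ne[of i d] that f0 fd by auto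
    have sep: "\<not> conn (delete_vertex G (f i)) u w" if "1 \<le> i" "i < d" for i
      using bad uw fC[of i] nonfree[OF that] not_end[OF that] that by auto
    have before: "conn (delete_vertex G (f j)) u (f i)" if "i < j" "j \<le> d" for i j
    proof -
      have "conn (delete_vertex G (f j)) (f 0) (f i)"
        using that fe f_ne[of _ j] by (intro conn_delete_walk[OF G, of 0 i f "f j"]) auto
      then show ?thesis by (simp add: f0)
    qed
    have after: "conn (delete_vertex G (f j)) (f i) w" if "j < i" "i \<le> d" for i j
    proof -
      have "conn (delete_vertex G (f j)) (f i) (f d)"
      proof (rule conn_delete_walk[OF G, of i d f "f j"])
        show "f l \<noteq> f j" if "i \<le> l" "l \<le> d" for l using f_ne[of j l] \<open>j < i\<close> that by auto
      qed (use that fe in auto)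
      then show ?thesis by (simp add: fd)
    qed
    define L where "L = (\<lambda>i. 1 \<le> i \<and> i < d \<and> i \<le> side_gain G (f i) u)"
    have fV: "f i \<in> verts G" if "i \<le> d" for i using fC[OF that] CV by auto
    have uV: "u \<in> verts G" and wV: "w \<in> verts G" using uw CV by auto
    have L1: "L 1"
    proof -
      have "{u, f 1} \<in> edges G" using fe[of 0] d2 f0 by simp
      then show ?thesis using side_gain_adjacent[OF G fV nonfree, of 1 u] d2 by (simp add: L_def)
    qed
    define i where "i = Max {i. L i}"
    have finL: "finite {i. L i}" by (rule finite_subset[of _ "{..<d}"]) (auto simp: L_def)
    have Li: "L i" unfolding i_def using Max_in[OF finL] L1 by auto
    have max: "j \<le> i" if "L j" for j unfolding i_def using finL that by (intro Max_ge) auto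
    have i: "1 \<le> i" "i < d" using Li by (auto simp: L_def)
    let ?v = "f i"
    note v = fV[OF less_imp_le[OF i(2)]] nonfree[OF i]
    have R: "d - i \<le> side_gain G ?v w"
    proof (rule ccontr)
      assume fail: "\<not> d - i \<le> side_gain G ?v w"
      have "Suc i \<noteq> d"
      proof
        assume "Suc i = d"
        then have "{w, ?v} \<in> edges G" using fe[of i] i fd by (simp add: insert_commute)
        then have "1 \<le> side_gain G ?v w" by (rule side_gain_adjacent[OF G v])
        then show False using fail \<open>Suc i = d\<close> by simp
      qed
      define j where "j = Suc (Suc i)"
      have j: "j \<le> d" "1 \<le> j" using i \<open>Suc i \<noteq> d\<close> by (auto simp: j_def)
      let ?x1 = "f (Suc i)"
      have si: "1 \<le> Suc i" "Suc i < d" using i \<open>Suc i \<noteq> d\<close> by auto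
      have wv: "w \<noteq> ?v" "u \<noteq> ?v" using not_end[OF i] by auto
      have D: "delete_vertex G ?v \<in> graphs" by (rule delete_in_graphs[OF G v])
      have cx1: "conn (delete_vertex G ?v) w ?x1" using after[of i "Suc i"] si by (auto intro: conn_sym)
      have "\<not> free_vertex (delete_vertex G ?v) ?x1"
      proof
        assume "free_vertex (delete_vertex G ?v) ?x1"
        then have "gdist G ?x1 w + 1 \<le> side_gain G ?v w"
          using cx1 nonfree[OF si] wv wV by (intro side_gain_new_free[OF G v, of w _ _ ?x1]) auto
        then show False using fail fdist[of "Suc i" d] si fd by simp
      qed
      moreover have "?x1 \<in> verts (delete_vertex G ?v)" using fV[of "Suc i"] si f_ne[of i "Suc i"] by auto
      ultimately obtain x y
        where xy: "{x, ?x1} \<in> edges (delete_vertex G ?v)" "{y, ?x1} \<in> edges (delete_vertex G ?v)"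
          "x \<noteq> y" "{x, y} \<notin> edges (delete_vertex G ?v)"
        using nonfreeE[OF D] by blast
      then have e: "{x, ?x1} \<in> edges G" "{y, ?x1} \<in> edges G" "x \<noteq> ?v" "y \<noteq> ?v" "{x, y} \<notin> edges G"
        by (auto simp: edges_delete[OF G])
      have cw: "conn (delete_vertex G ?v) w z" if "{z, ?x1} \<in> edges (delete_vertex G ?v)" for z
        using conn_trans[OF cx1 conn_sym[OF conn_edge[OF that]]] .
      \<comment> \<open>The walk along the path up to \<open>f (i + 1)\<close> and on to \<open>z\<close> avoids \<open>f j\<close>.\<close>
      have via: "conn (delete_vertex G (f j)) u z" if "{z, ?x1} \<in> edges G" "z \<noteq> f j" for z
      proof -
        have "?x1 \<noteq> f j" using f_ne[of "Suc i" j] j by (simp add: j_def)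
        then have "{?x1, z} \<in> edges (delete_vertex G (f j))"
          using that by (simp add: edges_delete[OF G] insert_commute)
        then show ?thesis using before[of "Suc i" j] j by (auto simp: j_def intro: conn_trans conn_edge)
      qed
      \<comment> \<open>Otherwise \<open>z\<close> and \<open>w\<close> would be at distance at least \<open>d - i\<close> on the side of \<open>w\<close>.\<close>
      have near: "z = f j \<or> {z, f j} \<in> edges G"
        if z: "{z, ?x1} \<in> edges (delete_vertex G ?v)" for z
      proof (rule ccontr)
        assume far: "\<not> ?thesis"
        have zG: "{z, ?x1} \<in> edges G" using z by (simp add: edges_delete[OF G])
        have conn_z: "conn G z (f j)"
          using conn_trans[OF conn_edge[OF zG] conn_edge[OF fe[of "Suc i"]]] si by (simp add: j_def)
        have two: "2 \<le> gdist G z (f j)" using far by (intro gdist_ge_2[OF conn_z]) auto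
        have "d - i \<le> gdist G z w"
        proof (cases "j = d")
          case True
          then show ?thesis using two fd by (simp add: j_def)
        next
          case False
          then have jd: "1 \<le> j" "j < d" using j by auto
          have "conn (delete_vertex G (f j)) u z" using via zG far by blast
          then have "\<not> conn (delete_vertex G (f j)) z w" using sep[OF jd] conn_trans by blast
          moreover have "conn G z w"
            using conn_mono[OF adj_delete_sub[OF G] cw[OF z]] by (rule conn_sym)
          ultimately have "gdist G z (f j) + gdist G (f j) w \<le> gdist G z w"
            by (intro separating_gdist[OF G])
          then show ?thesis using two fdist[of j d] fd jd by (simp add: j_def)
        qed
        also have "\<dots> \<le> side_gain G ?v w"
          using cw[OF z] wv wV by (intro side_gain_dist[OF G v]) auto
        finally show False using fail by simp
      qed
      have adj_j: "{x, f j} \<in> edges G" "{y, f j} \<in> edges G"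
        using near[OF xy(1)] near[OF xy(2)] xy(3) e(5) by (auto simp: insert_commute)
      have xj: "x \<noteq> f j" using edge_verts(3)[OF G adj_j(1)] .
      have reach: "conn (delete_vertex G (f j)) u x" by (rule via[OF e(1) xj])
      \<comment> \<open>Otherwise the walk could bypass \<open>f (i + 1)\<close>, which separates \<open>u\<close> from \<open>w\<close>.\<close>
      have nadj: "{?v, x} \<notin> edges G"
      proof
        assume vx: "{?v, x} \<in> edges G"
        have ne: "?v \<noteq> ?x1" "x \<noteq> ?x1" "f j \<noteq> ?x1"
          using f_ne[of i "Suc i"] f_ne[of "Suc i" j] si j edge_verts(3)[OF G e(1)] by (auto simp: j_def)
        have "conn (delete_vertex G ?x1) ?v x" using vx ne by (intro conn_edge) (simp add: edges_delete[OF G])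
        moreover have "conn (delete_vertex G ?x1) x (f j)"
          using adj_j ne by (intro conn_edge) (simp add: edges_delete[OF G])
        ultimately have "conn (delete_vertex G ?x1) u w"
          using before[of i "Suc i"] after[of "Suc i" j] si j by (auto simp: j_def intro: conn_trans)
        then show False using sep[OF si] by simp
      qed
      \<comment> \<open>\<open>?v\<close> separates \<open>u\<close> from \<open>x\<close>, which has distance at least two from it.\<close>
      have ux: "j \<le> gdist G u x"
      proof -
        have cux: "conn G u x" by (rule conn_mono[OF adj_delete_sub[OF G] reach])
        have "\<not> conn (delete_vertex G ?v) u x"
          using sep[OF i] cw[OF xy(1)] conn_trans conn_sym by blast
        then have "gdist G u ?v + gdist G ?v x \<le> gdist G u x" by (rule separating_gdist[OF G cux])
        moreover have "conn G ?v x" using f_conn[of i] i cux by (auto intro: conn_trans conn_sym)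
        then have "2 \<le> gdist G ?v x" using nadj e(3) by (intro gdist_ge_2) auto
        moreover have "gdist G u ?v = i" using fdist[of 0 i] i f0 by simp
        ultimately show ?thesis by (simp add: j_def)
      qed
      show False
      proof (cases "j = d")
        case False
        then have jd: "1 \<le> j" "j < d" using j by auto
        have "j \<le> side_gain G (f j) u"
          using ux side_gain_dist[OF G fV[OF j(1)] nonfree[OF jd] conn_refl reach uV not_end(1)[OF jd]]
            by simp
        then have "L j" using jd by (simp add: L_def)
        then show False using max[of j] by (simp add: j_def)
      next
        case True
        have xC: "x \<in> C"
          using conn_mono[OF adj_delete_sub[OF G] reach] uw(1) by
            (auto simp: C_def component_def intro: conn_trans)
        have "gdist G u x \<le> d" unfolding d_def by (rule class_diam_ge[OF fin uw(1) xC])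
        then have dux: "gdist G u x = d" using ux True by simp
        have fw: "f j = w" using True fd by simp
        have "\<not> free_vertex G w"
          using adj_j xy(3) e(5) unfolding fw by (auto simp: free_vertex_iff[OF G])
        moreover have "u \<noteq> w" using f_ne[of 0 d] d2 f0 fd by simp
        ultimately show False
          using bad uw(1,2) xC dux xj reach unfolding fw by blast
      qed
    qed
    have "Psi0 (complete_graph m) G \<le> Psi0 (complete_graph m) (delete_vertex G ?v)" for m
    proof (rule Psi0_delete_separating[OF G v])
      have vC: "?v \<in> C" using fC i by simp
      show "u \<in> component G ?v" "w \<in> component G ?v" using uw by (simp_all add: component[OF vC])
      show "u \<noteq> ?v" "w \<noteq> ?v" by (rule not_end[OF i])+
      show "\<not> conn (delete_vertex G ?v) u w" by (rule sep[OF i])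
      show "class_diam G (component G ?v) \<le> side_gain G ?v u + side_gain G ?v w"
        using Li R unfolding component[OF vC] L_def d_def[symmetric] by linarith
    qed
    moreover have vC: "component G ?v = C" using fC i component by simp
    ultimately show ?thesis
      using v uw not_end[OF i] by (intro exI[of _ ?v] exI[of _ u] exI[of _ w]) (simp add: vC d_def)
  qed
qed

theorem d_compatible_Psi0: "d_compatible Psi0"
  unfolding d_compatible_def Let_def
proof (intro allI impI ballI conjI)
  fix m :: nat and G P assume "2 \<le> m" "G \<in> graphs" "disjoint_union_of_complete G P"
  then show "Psi0 (complete_graph m) G \<le> card P * (m - 1) + sum card P" by (intro Psi0_complete)
next
  fix m :: nat and G assume G: "G \<in> graphs" and nd: "\<nexists>P. disjoint_union_of_complete G P"
  obtain v u w where v: "v \<in> verts G" "\<not> free_vertex G v"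
    and uw: "u \<in> component G v" "w \<in> component G v" "u \<noteq> v" "w \<noteq> v" "gdist G u w =
      class_diam G (component G v)"
    and del: "\<And>m. Psi0 (complete_graph m) G \<le> Psi0 (complete_graph m) (delete_vertex G v)"
    using exists_good_vertex[OF G nd] by blast
  show "\<exists>v\<in>verts G. \<not> free_vertex G v \<and>
      Psi0 (complete_graph m) G \<le> Psi0 (complete_graph m) (delete_vertex G v) \<and>
      Psi0 (complete_graph m) G \<le> Psi0 (complete_graph m) (complete_at G v) \<and>
      Psi0 (complete_graph m) G \<le> Psi0 (complete_graph m) (delete_vertex (complete_at G v) v) + 1"
    using v del Psi0_complete_at[OF G v] Psi0_complete_delete[OF G v uw] by blast
qed

section \<open>The depth bound\<close>

lemma depth_bound:
  assumes "2 \<le> m" "G \<in> graphs" "verts G = {1..n}" "d_compatible \<Psi>"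
  shows "enat (\<Psi> (complete_graph m) G) \<le>
    depth_S m n (gen_binomial_edge_quotient m n G :: ('k::field mpoly2, 'k mpoly2 set) module)"
proof -
  interpret poly_mat m n "carrier (poly_ring m n) :: 'k mpoly2 set" by unfold_locales simp
  show ?thesis
    using assms by (intro depth_S_ge d_compatible_depth) auto
qed

theorem theorem1p1:
  shows "(\<forall>m n G \<Psi>. 2 \<le> m \<and> 1 \<le> n \<and> G \<in> graphs \<and> verts G = {1..n} \<and> d_compatible \<Psi> \<longrightarrow>
            enat (\<Psi> (complete_graph m) G) \<le>
              depth_S m n (gen_binomial_edge_quotient m n G :: ('k::field mpoly2, 'k mpoly2 set) module)) \<and>
         d_compatible Psi0 \<and>
         (\<forall>m n G. 2 \<le> m \<and> 1 \<le> n \<and> G \<in> graphs \<and> verts G = {1..n} \<longrightarrow>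
            enat ((m - 2) * num_components G + num_free G + d_inv G) \<le>
              depth_S m n (gen_binomial_edge_quotient m n G :: ('k mpoly2, 'k mpoly2 set) module))"
proof (intro conjI allI impI)
  show "d_compatible Psi0" by (rule d_compatible_Psi0)
next
  fix m n :: nat and G :: ugraph and \<Psi> :: "ugraph \<Rightarrow> ugraph \<Rightarrow> nat"
  assume "2 \<le> m \<and> 1 \<le> n \<and> G \<in> graphs \<and> verts G = {1..n} \<and> d_compatible \<Psi>"
  then show "enat (\<Psi> (complete_graph m) G) \<le>
      depth_S m n (gen_binomial_edge_quotient m n G :: ('k mpoly2, 'k mpoly2 set) module)"
    by (intro depth_bound) auto
next
  fix m n :: nat and G :: ugraph
  assume "2 \<le> m \<and> 1 \<le> n \<and> G \<in> graphs \<and> verts G = {1..n}"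
  then have "enat (Psi0 (complete_graph m) G) \<le>
      depth_S m n (gen_binomial_edge_quotient m n G :: ('k mpoly2, 'k mpoly2 set) module)"
    using d_compatible_Psi0 by (intro depth_bound) auto
  then show "enat ((m - 2) * num_components G + num_free G + d_inv G) \<le>
      depth_S m n (gen_binomial_edge_quotient m n G :: ('k mpoly2, 'k mpoly2 set) module)"
    by (simp add: Psi0_def complete_graph_def)
qed

end
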